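(* Let $\varphi:[0,\infty)\to[0,\infty)$ be increasing, subadditive and continuous with $\lim_{t\to\infty}\varphi(t)/t=0$. Suppose the open set $\Omega\subset\mathbb{R}^m$ has a Lipschitz boundary. Then $$\mathrm{TV}^\varphi_{\mathrm c}(u)=0\quad\text{for } u\in\mathrm{BV}(\Omega).$$
   Context: $\mathrm{BV}(\Omega)$ is the space of functions $u\in L^1(\Omega)$ whose distributional gradient $Du$ is a finite $\mathbb{R}^m$-valued Radon measure on $\Omega$. Weak* convergence $u^i\rightharpoonup^* u$ in $\mathrm{BV}(\Omega)$ means $u^i\to u$ strongly in $L^1(\Omega)$ and $Du^i\rightharpoonup^* Du$ weakly* as Radon measures in $\mathcal{M}(\Omega;\mathbb{R}^m)$. For $u\in C^1(\Omega)$ set $\widetilde{\mathrm{TV}}^\varphi_{\mathrm c}(u):=\int_\Omega\varphi(|\nabla u(x)|)\,dx$. For $u\in\mathrm{BV}(\Omega)$ define $\mathrm{TV}^\varphi_{\mathrm c}(u)$ as the weak* lower semicontinuous envelope $$\mathrm{TV}^\varphi_{\mathrm c}(u):=\liminf_{u^i\rightharpoonup^* u,\ u^i\in C^1(\Omega)}\widetilde{\mathrm{TV}}^\varphi_{\mathrm c}(u^i),$$ that is, the infimum of $\liminf_{i\to\infty}\widetilde{\mathrm{TV}}^\varphi_{\mathrm c}(u^i)$ over all sequences $\{u^i\}\subset C^1(\Omega)\cap\mathrm{BV}(\Omega)$ with $u^i\rightharpoonup^* u$ weakly* in $\mathrm{BV}(\Omega)$.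
   Formalization: The formal theorem additionally assumes φ(0)=0; without it the claim fails, e.g. for φ(t)=1+t/(1+t), since TV_c(u) ≥ φ(0)|Ω| > 0 for every nonempty open Ω. *)

theory Defs
  imports "HOL-Analysis.Analysis"
begin

definition gradient :: "('a::euclidean_space \<Rightarrow> real) \<Rightarrow> 'a \<Rightarrow> 'a" where
  "gradient f x = (\<Sum>b\<in>Basis. frechet_derivative f (at x) b *\<^sub>R b)"

text \<open>\<open>Ck_on k S f\<close>: \<open>f\<close> is of class \<open>C\<^sup>k\<close> on \<open>S\<close>; meant for open \<open>S\<close> only, because the
  derivatives are taken in the full space.\<close>

primrec Ck_on :: "nat \<Rightarrow> 'a::euclidean_space set \<Rightarrow> ('a \<Rightarrow> real) \<Rightarrow> bool" where
  "Ck_on 0 S f \<longleftrightarrow> continuous_on S f"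
| "Ck_on (Suc k) S f \<longleftrightarrow> (\<forall>x\<in>S. f differentiable (at x)) \<and>
     (\<forall>b\<in>Basis. Ck_on k S (\<lambda>x. frechet_derivative f (at x) b))"

text \<open>\<open>C\<^sub>c\<^sup>\<infinity>(\<Omega>)\<close>, with functions extended by zero to the whole space.\<close>

definition test_functions :: "'a::euclidean_space set \<Rightarrow> ('a \<Rightarrow> real) set" where
  "test_functions \<Omega> = {\<psi>. (\<forall>k. Ck_on k UNIV \<psi>) \<and>
     compact (closure {x. \<psi> x \<noteq> 0}) \<and> closure {x. \<psi> x \<noteq> 0} \<subseteq> \<Omega>}"

text \<open>\<open>C\<^sub>0(\<Omega>)\<close>, the predual of the finite Radon measures on \<open>\<Omega>\<close>.\<close>

definition vanishing_functions :: "'a::euclidean_space set \<Rightarrow> ('a \<Rightarrow> real) set" where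
  "vanishing_functions \<Omega> = {\<psi>. continuous_on \<Omega> \<psi> \<and>
     (\<forall>\<epsilon>>0. \<exists>K. compact K \<and> K \<subseteq> \<Omega> \<and> (\<forall>x\<in>\<Omega> - K. \<bar>\<psi> x\<bar> < \<epsilon>))}"

text \<open>A finite vector-valued Radon measure on an open set \<open>\<Omega>\<close> is a countably additive
  vector-valued function on the Borel subsets of \<open>\<Omega>\<close>; finiteness of the total variation and
  regularity are automatic. Its values on other sets are irrelevant.\<close>

definition vector_radon_measure :: "'a::euclidean_space set \<Rightarrow> ('a set \<Rightarrow> 'a) \<Rightarrow> bool" where
  "vector_radon_measure \<Omega> \<mu> \<longleftrightarrow>
     (\<forall>A :: nat \<Rightarrow> 'a set. range A \<subseteq> sets (restrict_space borel \<Omega>) \<and> disjoint_family A \<longrightarrow>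
        (\<lambda>i. \<mu> (A i)) sums \<mu> (\<Union>i. A i))"

text \<open>The positive part in the Jordan decomposition of a signed measure \<open>\<nu>\<close> on \<open>\<Omega>\<close>,
  \<open>\<nu>\<^sup>+(E) = sup {\<nu>(F) | F \<subseteq> E}\<close>. Negative values of \<open>\<nu>\<close> are truncated to 0 by
  \<^const>\<open>ennreal\<close>, which does not change the supremum since \<open>F = {}\<close> is admissible.
  The negative part is the positive part of \<open>-\<nu>\<close>.\<close>

definition positive_variation :: "'a::euclidean_space set \<Rightarrow> ('a set \<Rightarrow> real) \<Rightarrow> 'a measure" where
  "positive_variation \<Omega> \<nu> = measure_of \<Omega> (sets (restrict_space borel \<Omega>))
     (\<lambda>E. SUP F\<in>{F \<in> sets (restrict_space borel \<Omega>). F \<subseteq> E}. ennreal (\<nu> F))"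

definition signed_integral :: "'a::euclidean_space set \<Rightarrow> ('a set \<Rightarrow> real) \<Rightarrow> ('a \<Rightarrow> real) \<Rightarrow> real" where
  "signed_integral \<Omega> \<nu> \<psi> =
     (LINT x|positive_variation \<Omega> \<nu>. \<psi> x) - (LINT x|positive_variation \<Omega> (\<lambda>E. - \<nu> E). \<psi> x)"

definition vector_integral :: "'a::euclidean_space set \<Rightarrow> ('a set \<Rightarrow> 'a) \<Rightarrow> ('a \<Rightarrow> real) \<Rightarrow> 'a" where
  "vector_integral \<Omega> \<mu> \<psi> = (\<Sum>b\<in>Basis. signed_integral \<Omega> (\<lambda>E. \<mu> E \<bullet> b) \<psi> *\<^sub>R b)"

text \<open>\<open>Du = \<mu>\<close>. On Borel subsets of \<open>\<Omega>\<close> such a \<open>\<mu>\<close> is uniquely determined by \<open>u\<close>.\<close>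

definition has_gradient_measure ::
    "'a::euclidean_space set \<Rightarrow> ('a \<Rightarrow> real) \<Rightarrow> ('a set \<Rightarrow> 'a) \<Rightarrow> bool" where
  "has_gradient_measure \<Omega> u \<mu> \<longleftrightarrow> vector_radon_measure \<Omega> \<mu> \<and>
     (\<forall>\<psi>\<in>test_functions \<Omega>.
        (LINT x:\<Omega>|lebesgue. u x *\<^sub>R gradient \<psi> x) = - vector_integral \<Omega> \<mu> \<psi>)"

text \<open>Elements are functions on the whole space, of which only the values on \<open>\<Omega>\<close> matter, and they
  are not identified when equal almost everywhere.\<close>

definition BV :: "'a::euclidean_space set \<Rightarrow> ('a \<Rightarrow> real) set" where
  "BV \<Omega> = {u. u absolutely_integrable_on \<Omega> \<and> (\<exists>\<mu>. has_gradient_measure \<Omega> u \<mu>)}"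

definition weak_star_measures ::
    "'a::euclidean_space set \<Rightarrow> (nat \<Rightarrow> 'a set \<Rightarrow> 'a) \<Rightarrow> ('a set \<Rightarrow> 'a) \<Rightarrow> bool" where
  "weak_star_measures \<Omega> \<mu>s \<mu> \<longleftrightarrow>
     (\<forall>\<psi>\<in>vanishing_functions \<Omega>. (\<lambda>i. vector_integral \<Omega> (\<mu>s i) \<psi>) \<longlonglongrightarrow> vector_integral \<Omega> \<mu> \<psi>)"

definition weak_star_BV ::
    "'a::euclidean_space set \<Rightarrow> (nat \<Rightarrow> 'a \<Rightarrow> real) \<Rightarrow> ('a \<Rightarrow> real) \<Rightarrow> bool" where
  "weak_star_BV \<Omega> U u \<longleftrightarrow> (\<forall>i. U i \<in> BV \<Omega>) \<and> u \<in> BV \<Omega> \<and>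
     (\<lambda>i. LINT x:\<Omega>|lebesgue. \<bar>U i x - u x\<bar>) \<longlonglongrightarrow> 0 \<and>
     (\<exists>\<mu>s \<mu>. (\<forall>i. has_gradient_measure \<Omega> (U i) (\<mu>s i)) \<and> has_gradient_measure \<Omega> u \<mu> \<and>
        weak_star_measures \<Omega> \<mu>s \<mu>)"

definition TV_smooth :: "(real \<Rightarrow> real) \<Rightarrow> 'a::euclidean_space set \<Rightarrow> ('a \<Rightarrow> real) \<Rightarrow> ennreal" where
  "TV_smooth \<phi> \<Omega> u = (\<integral>\<^sup>+x\<in>\<Omega>. ennreal (\<phi> (norm (gradient u x))) \<partial>lebesgue)"

definition TV_c :: "(real \<Rightarrow> real) \<Rightarrow> 'a::euclidean_space set \<Rightarrow> ('a \<Rightarrow> real) \<Rightarrow> ennreal" where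
  "TV_c \<phi> \<Omega> u = (INF U\<in>{U. (\<forall>i. Ck_on 1 \<Omega> (U i)) \<and> weak_star_BV \<Omega> U u}.
     liminf (\<lambda>i. TV_smooth \<phi> \<Omega> (U i)))"

text \<open>Near each boundary point, \<open>\<Omega>\<close> is the strict epigraph of a Lipschitz function over the
  hyperplane orthogonal to some unit vector \<open>n\<close>.\<close>

definition lipschitz_boundary :: "'a::euclidean_space set \<Rightarrow> bool" where
  "lipschitz_boundary \<Omega> \<longleftrightarrow> (\<forall>x0\<in>frontier \<Omega>. \<exists>r>0. \<exists>n \<gamma> L. norm n = 1 \<and>
     L-lipschitz_on {y. y \<bullet> n = 0} (\<gamma> :: 'a \<Rightarrow> real) \<and>
     \<Omega> \<inter> ball x0 r = {x \<in> ball x0 r. \<gamma> (x - (x \<bullet> n) *\<^sub>R n) < x \<bullet> n})"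

end

theory Submission
  imports Defs
begin

text \<open>Staircases defeat a sublinear energy: if \<open>v\<close> is \<open>C\<^sup>1\<close> and \<open>f\<close> is a \<open>C\<^sup>1\<close> approximation of the identity
  whose derivative has size \<open>M\<close> on a periodic set of density \<open>1 / M\<close> and vanishes elsewhere, then
  averaging over translates of \<open>f\<close> bounds \<open>\<integral>\<bar>\<nabla>(f \<circ> v)\<bar>\<close> by \<open>C \<integral>\<bar>\<nabla>v\<bar>\<close> and \<open>\<integral>\<phi>(\<bar>\<nabla>(f \<circ> v)\<bar>)\<close> by
  \<open>\<integral>\<phi>(2M\<bar>\<nabla>v\<bar>) / M\<close>, which tends to \<open>0\<close> as \<open>M\<close> grows. Letting \<open>f\<close> be constant near \<open>0\<close> confines the
  gradient to a set of finite measure. A function in BV is first replaced by \<open>C\<^sup>1\<close> functions with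
  bounded variation by convolving with a kernel whose width \<open>\<delta>(x)\<close> shrinks smoothly towards the
  boundary; this needs neither a partition of unity nor an extension operator.\<close>

section \<open>Smooth functions\<close>

text \<open>Energy and total variation have to be controlled for the same translate. So both are
  merged into one functional, the weighted sum \<open>F\<close> in
  \<open>staircase_approximation\<close>, and the translate is found by pigeonhole: at each point at
  most one of \<open>M\<close> consecutive translates is active, so the sum of \<open>F\<close> over
  the translates is bounded like a single term. Sublinearity enters as
  \<open>\<phi> t \<le> C + e' * t\<close>; the constant \<open>C\<close> is integrated only where
  \<open>\<bar>v\<bar>\<close> is bounded below, and there a multiple of
  \<open>\<bar>v\<bar>\<close> dominates it. Since \<open>\<phi> 0 = 0\<close>, flat stretches cost
  nothing, even on a set of infinite measure.

  Weak* convergence follows from L1 convergence and gradients bounded in L1: against test functions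
  it is integration by parts, and test functions are dense in C_0.

  With a variable width, \<open>\<delta>\<close> is differentiated too, so the gradient of the
  mollified function is not just a mollified gradient. The extra term is again a divergence in the
  integration variable, hence an integral against Du, and the Lipschitz bound on
  \<open>\<delta>\<close> yields an L1 estimate whose constant does not depend on the width.\<close>

lemma Ck_on_Suc_imp: "Ck_on (Suc k) S f \<Longrightarrow> Ck_on k S f"
proof (induction k arbitrary: f)
  case 0
  then show ?case
    by (auto intro!: continuous_at_imp_continuous_on differentiable_imp_continuous_within)
next
  case (Suc k)
  then show ?case by auto
qed

lemma has_derivative_gradient:
  fixes f :: "'a::euclidean_space \<Rightarrow> real"
  assumes "f differentiable (at x)"
  shows "(f has_derivative (\<lambda>h. gradient f x \<bullet> h)) (at x)"
proof -
  have D: "(f has_derivative frechet_derivative f (at x)) (at x)"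
    using assms by (simp add: frechet_derivative_works)
  then interpret linear "frechet_derivative f (at x)"
    by (rule has_derivative_linear)
  have "frechet_derivative f (at x) h = gradient f x \<bullet> h" for h
  proof -
    have "frechet_derivative f (at x) h = frechet_derivative f (at x) (\<Sum>b\<in>Basis. (h \<bullet> b) *\<^sub>R b)"
      by (simp add: euclidean_representation)
    also have "\<dots> = (\<Sum>b\<in>Basis. (h \<bullet> b) * frechet_derivative f (at x) b)"
      by (simp add: sum scale)
    also have "\<dots> = gradient f x \<bullet> h"
      by (simp add: gradient_def inner_sum_left inner_commute[of h] mult.commute)
    finally show ?thesis .
  qed
  then have "frechet_derivative f (at x) = (\<lambda>h. gradient f x \<bullet> h)" by auto
  with D show ?thesis by simp
qed

lemma gradient_eqI:
  assumes "(f has_derivative (\<lambda>h. g \<bullet> h)) (at x)"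
  shows "gradient f x = g"
proof -
  have "frechet_derivative f (at x) = (\<lambda>h. g \<bullet> h)"
    using frechet_derivative_at[OF assms] by simp
  then show ?thesis by (simp add: gradient_def euclidean_representation)
qed

lemma frechet_derivative_eq_gradient:
  assumes "f differentiable (at x)"
  shows "frechet_derivative f (at x) h = gradient f x \<bullet> h"
  using frechet_derivative_at[OF has_derivative_gradient[OF assms]] by metis

lemma Ck_on_1_iff:
  "Ck_on 1 S f \<longleftrightarrow> (\<forall>x\<in>S. f differentiable (at x)) \<and> continuous_on S (gradient f)"
proof -
  have "continuous_on S (gradient f)" if "\<forall>b\<in>Basis. continuous_on S (\<lambda>x. frechet_derivative f (at x) b)"
    unfolding gradient_def using that by (intro continuous_intros) auto
  moreover have "continuous_on S (\<lambda>x. frechet_derivative f (at x) b)"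
    if "continuous_on S (gradient f)" "\<forall>x\<in>S. f differentiable (at x)" for b
    using that
    by (subst continuous_on_cong[OF refl, of _ _ "\<lambda>x. gradient f x \<bullet> b"])
      (auto simp: frechet_derivative_eq_gradient intro!: continuous_intros)
  ultimately show ?thesis by auto
qed

text \<open>With \<open>S = UNIV\<close> the candidate \<open>f'\<close> equals
  \<open>frechet_derivative\<close> as a function, so it can be substituted inside
  \<open>Ck_on k\<close> directly; on a smaller set a congruence argument would be required at every
  level.\<close>

lemma Ck_on_SucI:
  assumes "\<And>x. x \<in> S \<Longrightarrow> (f has_derivative f' x) (at x)"
    and "\<And>b. b \<in> Basis \<Longrightarrow> Ck_on k S (\<lambda>x. f' x b)" and S: "S = UNIV"
  shows "Ck_on (Suc k) S f"
proof -
  have "frechet_derivative f (at x) = f' x" for x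
    using assms(1)[of x] frechet_derivative_at S by force
  moreover have "\<forall>x\<in>S. f differentiable (at x)"
    using assms(1) by (auto simp: differentiable_def)
  ultimately show ?thesis using assms(2) by simp
qed

lemma Ck_on_Suc_has_derivative:
  "Ck_on (Suc k) S f \<Longrightarrow> x \<in> S \<Longrightarrow> (f has_derivative frechet_derivative f (at x)) (at x)"
  by (simp add: frechet_derivative_works)

lemma Ck_on_const: "Ck_on k UNIV (\<lambda>x. c)"
proof (induction k arbitrary: c)
  case (Suc k)
  show ?case by (rule Ck_on_SucI[of _ _ "\<lambda>x h. 0"]) (auto simp: Suc)
qed simp

lemma Ck_on_bounded_linear: "bounded_linear f \<Longrightarrow> Ck_on k UNIV f"
proof (cases k)
  case (Suc n)
  assume "bounded_linear f"
  then show ?thesis unfolding Suc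
    by (intro Ck_on_SucI[of _ _ "\<lambda>x. f"]) (auto simp: Ck_on_const bounded_linear_imp_has_derivative)
qed (simp add: linear_continuous_on)

lemma Ck_on_add: "Ck_on k UNIV f \<Longrightarrow> Ck_on k UNIV g \<Longrightarrow> Ck_on k UNIV (\<lambda>x. f x + g x)"
proof (induction k arbitrary: f g)
  case (Suc k)
  show ?case
  proof (rule Ck_on_SucI)
    show "((\<lambda>x. f x + g x) has_derivative
        (\<lambda>h. frechet_derivative f (at x) h + frechet_derivative g (at x) h)) (at x)" for x
      using Suc.prems by (intro has_derivative_add Ck_on_Suc_has_derivative) auto
  qed (use Suc in auto)
qed (auto intro: continuous_intros)

lemma Ck_on_mult: "Ck_on k UNIV f \<Longrightarrow> Ck_on k UNIV g \<Longrightarrow> Ck_on k UNIV (\<lambda>x. f x * g x)"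
proof (induction k arbitrary: f g)
  case (Suc k)
  show ?case
  proof (rule Ck_on_SucI)
    show "((\<lambda>x. f x * g x) has_derivative
        (\<lambda>h. f x * frechet_derivative g (at x) h + frechet_derivative f (at x) h * g x)) (at x)" for x
      using Suc.prems by (intro has_derivative_mult Ck_on_Suc_has_derivative) auto
    show "Ck_on k UNIV (\<lambda>x. f x * frechet_derivative g (at x) b + frechet_derivative f (at x) b * g x)"
      if "b \<in> Basis" for b
      using Suc.prems that Ck_on_Suc_imp[OF Suc.prems(1)] Ck_on_Suc_imp[OF Suc.prems(2)]
      by (intro Ck_on_add Suc.IH) auto
  qed auto
qed (auto intro: continuous_intros)

lemma Ck_on_sum:
  "(\<And>i. i \<in> I \<Longrightarrow> Ck_on k UNIV (f i)) \<Longrightarrow> Ck_on k UNIV (\<lambda>x. \<Sum>i\<in>I. f i x)"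
  by (induction I rule: infinite_finite_induct) (auto simp: Ck_on_const intro!: Ck_on_add)

lemma Ck_on_affine:
  fixes f :: "'a::euclidean_space \<Rightarrow> real"
  shows "Ck_on k UNIV f \<Longrightarrow> Ck_on k UNIV (\<lambda>x. f (c *\<^sub>R (x - a)))"
proof (induction k arbitrary: f)
  case 0
  then show ?case
    by (auto intro!: continuous_on_compose2[of UNIV f] continuous_intros)
next
  case (Suc k)
  show ?case
  proof (rule Ck_on_SucI)
    show "((\<lambda>x. f (c *\<^sub>R (x - a))) has_derivative
        (\<lambda>h. c * frechet_derivative f (at (c *\<^sub>R (x - a))) h)) (at x)" for x
    proof -
      have f: "(f has_derivative frechet_derivative f (at (c *\<^sub>R (x - a)))) (at (c *\<^sub>R (x - a)))"
        using Suc.prems by (intro Ck_on_Suc_has_derivative) auto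
      have "((\<lambda>x. f (c *\<^sub>R (x - a))) has_derivative
        (\<lambda>h. frechet_derivative f (at (c *\<^sub>R (x - a))) (c *\<^sub>R (h - 0)))) (at x)"
        by (rule has_derivative_compose[where g = f and f = "\<lambda>x. c *\<^sub>R (x - a)", OF _ f])
          (intro derivative_intros)
      then show ?thesis
        using linear_scale[OF has_derivative_linear[OF f]] by simp
    qed
    show "Ck_on k UNIV (\<lambda>x. c * frechet_derivative f (at (c *\<^sub>R (x - a))) b)" if "b \<in> Basis" for b
      using Suc.prems that by (intro Ck_on_mult Ck_on_const Suc.IH) auto
  qed auto
qed

text \<open>The whole tower \<open>D\<close> of successive derivatives is given at once, so that the
  induction on \<open>k\<close> can pass from index \<open>n\<close> to
  \<open>Suc n\<close>.\<close>

lemma Ck_on_compose_real: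
  fixes q :: "'a::euclidean_space \<Rightarrow> real"
  assumes D: "\<And>n t. (D n has_real_derivative D (Suc n) t) (at t)"
  shows "Ck_on k UNIV q \<Longrightarrow> Ck_on k UNIV (\<lambda>x. D n (q x))"
proof (induction k arbitrary: n)
  case 0
  have "continuous_on UNIV (D n)"
    using D by (meson DERIV_continuous_on)
  then show ?case using 0
    by (auto intro!: continuous_on_compose2[of UNIV "D n"] continuous_intros)
next
  case (Suc k)
  show ?case
  proof (rule Ck_on_SucI)
    show "((\<lambda>x. D n (q x)) has_derivative
        (\<lambda>h. D (Suc n) (q x) * frechet_derivative q (at x) h)) (at x)" for x
      using DERIV_compose_FDERIV[OF D Ck_on_Suc_has_derivative[OF Suc.prems]]
      by (simp add: mult.commute)
    show "Ck_on k UNIV (\<lambda>x. D (Suc n) (q x) * frechet_derivative q (at x) b)" if "b \<in> Basis" for b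
      using Suc.prems that Ck_on_Suc_imp[OF Suc.prems]
      by (intro Ck_on_mult Suc.IH) auto
  qed auto
qed

lemma Ck_on_real_polynomial_function:
  "real_polynomial_function p \<Longrightarrow> Ck_on k UNIV p"
  by (induction rule: real_polynomial_function.induct)
    (blast intro: Ck_on_bounded_linear Ck_on_const Ck_on_add Ck_on_mult)+

section \<open>A smooth bump supported in the unit ball\<close>

lemma tendsto_poly_div_exp_0: "((\<lambda>s::real. poly p s / exp s) \<longlongrightarrow> 0) at_top"
proof -
  have "((\<lambda>s::real. \<Sum>i\<le>degree p. coeff p i * (s ^ i / exp s)) \<longlongrightarrow> (\<Sum>i\<le>degree p. coeff p i * 0)) at_top"
    by (intro tendsto_intros tendsto_power_div_exp_0)
  then show ?thesis by (simp add: poly_altdef sum_divide_distrib)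
qed

text \<open>The n-th derivative of exp(-1/t) is P_n(1/t) exp(-1/t). With s = 1/t the chain and
  product rules give P_(n+1)(s) = s^2 (P_n(s) - P_n'(s)), which is this recursion.\<close>

primrec bump_poly :: "nat \<Rightarrow> real poly" where
  "bump_poly 0 = 1"
| "bump_poly (Suc n) = [:0, 0, 1:] * (bump_poly n - pderiv (bump_poly n))"

definition bump_deriv :: "nat \<Rightarrow> real \<Rightarrow> real" where
  "bump_deriv n t = (if t \<le> 0 then 0 else poly (bump_poly n) (1 / t) / exp (1 / t))"

lemma bump_deriv_pos_has_derivative:
  assumes "t > 0"
  shows "((\<lambda>t. poly (bump_poly n) (1 / t) / exp (1 / t)) has_real_derivative
      poly (bump_poly (Suc n)) (1 / t) / exp (1 / t)) (at t)"
proof -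
  have i: "((\<lambda>t. 1 / t) has_real_derivative - (1 / t)\<^sup>2) (at t)"
    using assms by (auto intro!: derivative_eq_intros simp: power2_eq_square field_simps)
  have p: "((\<lambda>t. poly (bump_poly n) (1 / t)) has_real_derivative
      poly (pderiv (bump_poly n)) (1 / t) * - (1 / t)\<^sup>2) (at t)"
    by (rule DERIV_chain2[OF poly_DERIV i])
  have e: "((\<lambda>t. exp (1 / t)) has_real_derivative exp (1 / t) * - (1 / t)\<^sup>2) (at t)"
    by (rule DERIV_chain2[OF DERIV_exp i])
  show ?thesis
    by (rule DERIV_cong[OF DERIV_divide[OF p e]]) (use assms in \<open>simp_all add: field_simps power2_eq_square\<close>)
qed

lemma bump_deriv_has_derivative: "(bump_deriv n has_real_derivative bump_deriv (Suc n) t) (at t)"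
proof (cases t "0::real" rule: linorder_cases)
  case less
  have "((\<lambda>_. 0) has_real_derivative 0) (at t)" by simp
  then have "(bump_deriv n has_real_derivative 0) (at t)"
    by (rule has_field_derivative_transform_within_open[of _ _ _ "{..<0}"])
      (use less in \<open>auto simp: bump_deriv_def\<close>)
  then show ?thesis using less by (simp add: bump_deriv_def)
next
  case greater
  have "(bump_deriv n has_real_derivative poly (bump_poly (Suc n)) (1 / t) / exp (1 / t)) (at t)"
    by (rule has_field_derivative_transform_within_open[OF bump_deriv_pos_has_derivative, of _ "{0<..}"])
      (use greater in \<open>auto simp: bump_deriv_def\<close>)
  then show ?thesis using greater by (simp add: bump_deriv_def)
next
  case equal
  have "((\<lambda>h. bump_deriv n h / h) \<longlongrightarrow> 0) (at 0)"
  proof (rule filterlim_split_at)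
    show "((\<lambda>h. bump_deriv n h / h) \<longlongrightarrow> 0) (at_left 0)"
      by (rule tendsto_eventually) (auto simp: eventually_at_filter bump_deriv_def)
    \<comment> \<open>Only the right-hand limit has content: with s = 1/h the difference quotient is
      s P_n(s) / exp s, and the exponential beats every polynomial.\<close>
    have "((\<lambda>h. poly ([:0, 1:] * bump_poly n) (inverse h) / exp (inverse h)) \<longlongrightarrow> 0) (at_right (0::real))"
      by (rule filterlim_compose[OF tendsto_poly_div_exp_0 filterlim_inverse_at_top_right])
    then show "((\<lambda>h. bump_deriv n h / h) \<longlongrightarrow> 0) (at_right 0)"
      by (rule Lim_transform_eventually)
        (auto simp: eventually_at_filter bump_deriv_def field_simps)
  qed
  then show ?thesis using equal
    by (simp add: has_field_derivative_iff bump_deriv_def)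
qed

text \<open>The classical exp(-1/(1 - |x|^2)), extended by zero and not normalised.\<close>

definition bump :: "'a::euclidean_space \<Rightarrow> real" where
  "bump x = bump_deriv 0 (1 - x \<bullet> x)"

lemma Ck_on_bump: "Ck_on k UNIV (bump :: 'a::euclidean_space \<Rightarrow> real)"
proof -
  have "Ck_on k UNIV (\<lambda>x::'a. 1 + (\<Sum>b\<in>Basis. ((-1) * (x \<bullet> b)) * (x \<bullet> b)))"
    by (intro Ck_on_add Ck_on_const Ck_on_sum Ck_on_mult Ck_on_bounded_linear
        bounded_linear_inner_left)
  also have "(\<lambda>x::'a. 1 + (\<Sum>b\<in>Basis. ((-1) * (x \<bullet> b)) * (x \<bullet> b))) = (\<lambda>x. 1 - x \<bullet> x)"
  proof
    fix x :: 'a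
    have "(\<Sum>b\<in>Basis. (x \<bullet> b) * (x \<bullet> b)) = x \<bullet> x"
      by (rule euclidean_inner[symmetric])
    then show "1 + (\<Sum>b\<in>Basis. ((-1) * (x \<bullet> b)) * (x \<bullet> b)) = 1 - x \<bullet> x"
      by (simp add: sum_negf)
  qed
  finally show ?thesis
    unfolding bump_def by (rule Ck_on_compose_real[where D = bump_deriv, OF bump_deriv_has_derivative])
qed

lemma bump_nonneg: "bump x \<ge> 0"
  by (simp add: bump_def bump_deriv_def)

lemma bump_pos: "norm x < 1 \<Longrightarrow> bump x > 0"
  using abs_square_less_1[of "norm x"] by (simp add: bump_def bump_deriv_def dot_square_norm)

lemma bump_eq_0: "norm x \<ge> 1 \<Longrightarrow> bump x = 0"
  by (simp add: bump_def bump_deriv_def dot_square_norm)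

section \<open>Test functions and integration by parts\<close>

text \<open>Finitely many rescaled bumps cover \<open>K\<close>. Their sum is left unnormalised:
  \<open>s\<close> only serves as a divisor and multiplier, for which positivity on \<open>K\<close>
  is enough.\<close>

lemma smooth_cutoff:
  fixes \<Omega> :: "'a::euclidean_space set"
  assumes "compact K" "open \<Omega>" "K \<subseteq> \<Omega>"
  obtains s K' where "\<And>k. Ck_on k UNIV s" "\<And>x. s x \<ge> 0" "\<And>x. x \<in> K \<Longrightarrow> s x > 0"
    "compact K'" "K' \<subseteq> \<Omega>" "\<And>x. x \<notin> K' \<Longrightarrow> s x = 0"
proof -
  have "\<exists>r>0. cball x r \<subseteq> \<Omega>" if "x \<in> K" for x
    using that assms open_contains_cball by blast
  then obtain r where r: "\<And>x. x \<in> K \<Longrightarrow> r x > 0" "\<And>x. x \<in> K \<Longrightarrow> cball x (r x) \<subseteq> \<Omega>"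
    by metis
  obtain T where T: "T \<subseteq> K" "finite T" "K \<subseteq> (\<Union>x\<in>T. ball x (r x))"
    by (rule compactE_image[OF assms(1), of K "\<lambda>x. ball x (r x)"]) (use r(1) in auto)
  define s where "s y = (\<Sum>x\<in>T. bump ((1 / r x) *\<^sub>R (y - x)))" for y
  show thesis
  proof (rule that)
    show "Ck_on k UNIV s" for k
      unfolding s_def by (intro Ck_on_sum Ck_on_affine Ck_on_bump)
    show "s x \<ge> 0" for x
      unfolding s_def by (intro sum_nonneg bump_nonneg)
    show "s y > 0" if "y \<in> K" for y
    proof -
      have "y \<in> (\<Union>x\<in>T. ball x (r x))" using T(3) that by (rule subsetD)
      then obtain x where x: "x \<in> T" "dist x y < r x" by auto
      then have "r x > 0" using T r by auto
      then have "norm ((1 / r x) *\<^sub>R (y - x)) < 1"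
        using x by (simp add: dist_norm norm_minus_commute)
      then show ?thesis
        unfolding s_def using T x by (intro sum_pos2[of _ x] bump_pos bump_nonneg) auto
    qed
    show "compact (\<Union>x\<in>T. cball x (r x))" using T by auto
    show "(\<Union>x\<in>T. cball x (r x)) \<subseteq> \<Omega>" using T r by blast
    show "s y = 0" if "y \<notin> (\<Union>x\<in>T. cball x (r x))" for y
      unfolding s_def
    proof (intro sum.neutral ballI bump_eq_0)
      fix x assume x: "x \<in> T"
      then have "r x > 0" using T r by auto
      moreover have "r x < norm (y - x)" using that x by (auto simp: dist_norm norm_minus_commute)
      ultimately show "1 \<le> norm ((1 / r x) *\<^sub>R (y - x))" by simp
    qed
  qed
qed

lemma test_functionsI:
  assumes "\<And>k. Ck_on k UNIV \<psi>" "compact K" "K \<subseteq> \<Omega>" "\<And>x. x \<notin> K \<Longrightarrow> \<psi> x = 0"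
  shows "\<psi> \<in> test_functions \<Omega>"
proof -
  have "closure {x. \<psi> x \<noteq> 0} \<subseteq> K"
    using assms by (intro closure_minimal) (auto intro: compact_imp_closed)
  then show ?thesis
    using assms compact_closure bounded_subset[OF compact_imp_bounded[OF assms(2)]]
    unfolding test_functions_def by (auto simp: compact_eq_bounded_closed bounded_subset closure_subset)
qed

text \<open>Instead of convolving, factor: after a small correction \<open>\<psi>\<close> vanishes
  off a compact set and equals \<open>s * f\<close> with a smooth cutoff \<open>s\<close>; replacing
  the continuous factor \<open>f\<close> by a Stone-Weierstrass polynomial \<open>p\<close> gives
  \<open>s * p\<close>, which is smooth and inherits the compact support of
  \<open>s\<close>.\<close>

lemma test_functions_dense:
  fixes \<Omega> :: "'a::euclidean_space set"
  assumes \<Omega>: "open \<Omega>" and \<psi>: "\<psi> \<in> vanishing_functions \<Omega>" and e: "e > 0"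
  obtains \<psi>' where "\<psi>' \<in> test_functions \<Omega>" "\<And>x. x \<in> \<Omega> \<Longrightarrow> \<bar>\<psi> x - \<psi>' x\<bar> \<le> e"
proof -
  obtain K where K: "compact K" "K \<subseteq> \<Omega>" and small: "\<And>x. x \<in> \<Omega> - K \<Longrightarrow> \<bar>\<psi> x\<bar> < e / 2"
    using \<psi> e unfolding vanishing_functions_def by (smt (verit) mem_Collect_eq half_gt_zero)
  have cont: "continuous_on \<Omega> \<psi>" using \<psi> by (simp add: vanishing_functions_def)
  \<comment> \<open>Soft thresholding: subtracting the clamped value keeps \<open>f0\<close>
    continuous, moves it by at most \<open>e / 2\<close>, and makes it vanish exactly where
    \<open>\<bar>\<psi> x\<bar> \<le> e / 2\<close>, in particular off \<open>K\<close>.\<close>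
  define f0 where "f0 x = (if x \<in> \<Omega> then \<psi> x - max (- (e / 2)) (min (e / 2) (\<psi> x)) else 0)" for x
  have f0_K: "f0 x = 0" if "x \<notin> K" for x
    using small[of x] that by (auto simp: f0_def max_def min_def)
  have f0_close: "\<bar>\<psi> x - f0 x\<bar> \<le> e / 2" if "x \<in> \<Omega>" for x
    using that e by (auto simp: f0_def max_def min_def)
  have cont0: "continuous_on \<Omega> f0"
    by (subst continuous_on_cong[OF refl, of _ _ "\<lambda>x. \<psi> x - max (- (e / 2)) (min (e / 2) (\<psi> x))"])
      (auto simp: f0_def intro!: continuous_intros cont)
  obtain s K' where s: "\<And>k. Ck_on k UNIV s" "\<And>x. s x \<ge> 0" "\<And>x. x \<in> K \<Longrightarrow> s x > 0"
    "compact K'" "K' \<subseteq> \<Omega>" "\<And>x. x \<notin> K' \<Longrightarrow> s x = 0"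
    using smooth_cutoff[OF K(1) \<Omega> K(2)] by metis
  have cs: "continuous_on UNIV s" using s(1)[of 0] by simp
  \<comment> \<open>Off \<open>K\<close> the numerator is 0, so the quotient is 0 there even where
    \<open>s\<close> vanishes (division by zero gives 0). Continuity is therefore checked on two
    open sets: where \<open>s > 0\<close> inside \<open>\<Omega>\<close>, and on
    \<open>- K\<close>.\<close>
  define f where "f x = f0 x / s x" for x
  have "continuous_on ({x. s x > 0} \<inter> \<Omega> \<union> - K) f"
  proof (rule continuous_on_open_Un)
    show "open ({x. s x > 0} \<inter> \<Omega>)"
      using open_Collect_less[of "\<lambda>_. 0" s] cs \<Omega> by auto
    show "open (- K)" using K by (simp add: compact_imp_closed open_Compl)
    show "continuous_on ({x. s x > 0} \<inter> \<Omega>) f"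
      unfolding f_def by (intro continuous_intros continuous_on_subset[OF cs] continuous_on_subset[OF cont0]) auto
    show "continuous_on (- K) f"
      by (subst continuous_on_cong[OF refl, of _ _ "\<lambda>x. 0"]) (auto simp: f_def f0_K)
  qed
  moreover have "{x. s x > 0} \<inter> \<Omega> \<union> - K = UNIV" using s(3) K by auto
  ultimately have contf: "continuous_on K' f" by (metis continuous_on_subset subset_UNIV)
  obtain S where S: "S > 0" "\<And>x. x \<in> K' \<Longrightarrow> s x \<le> S"
  proof -
    have "bounded (s ` K')"
      by (intro compact_imp_bounded compact_continuous_image continuous_on_subset[OF cs] s) auto
    then obtain b where "b > 0" "\<And>x. x \<in> K' \<Longrightarrow> \<bar>s x\<bar> \<le> b"
      by (auto simp: bounded_pos)
    then show thesis by (intro that[of b]) force+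
  qed
  \<comment> \<open>The factor \<open>s\<close> can enlarge the error by at most its bound
    \<open>S\<close> on \<open>K'\<close>, which fixes the tolerance.\<close>
  obtain p where p: "real_polynomial_function p" "\<And>x. x \<in> K' \<Longrightarrow> \<bar>f x - p x\<bar> < e / (2 * S)"
    by (rule Stone_Weierstrass_real_polynomial_function[OF s(4) contf, of "e / (2 * S)"])
      (use e S in auto)
  show thesis
  proof (rule that)
    show "(\<lambda>x. s x * p x) \<in> test_functions \<Omega>"
      by (rule test_functionsI[OF _ s(4,5)])
        (use p(1) in \<open>auto simp: s(6) intro!: Ck_on_mult s(1) intro: Ck_on_real_polynomial_function\<close>)
    show "\<bar>\<psi> x - s x * p x\<bar> \<le> e" if "x \<in> \<Omega>" for x
    proof -
      have "\<bar>f0 x - s x * p x\<bar> \<le> e / 2"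
      proof (cases "x \<in> K'")
        case True
        have "f0 x = s x * f x" using s(3)[of x] f0_K[of x] by (cases "x \<in> K") (auto simp: f_def)
        then have "\<bar>f0 x - s x * p x\<bar> = s x * \<bar>f x - p x\<bar>"
          using s(2)[of x] by (simp add: abs_mult flip: right_diff_distrib)
        also have "\<dots> \<le> S * (e / (2 * S))"
          using S(2)[OF True] p(2)[OF True] s(2)[of x] S(1) by (intro mult_mono) auto
        finally show ?thesis using S by simp
      next
        case False
        then have "x \<notin> K" using s(3)[of x] s(6)[OF False] by auto
        then show ?thesis using s(6)[OF False] f0_K[of x] e by auto
      qed
      then show ?thesis using f0_close[OF that] by linarith
    qed
  qed
qed

section \<open>Functions of class C^1 with compact support\<close>

lemma gradient_eq_0_outside:
  assumes "closed S" "\<And>x. x \<notin> S \<Longrightarrow> F x = 0" "x \<notin> S"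
  shows "gradient F x = 0"
proof (rule gradient_eqI)
  have "((\<lambda>_. 0) has_derivative (\<bullet>) 0) (at x)"
    using has_derivative_const[of 0 "at x"] by (simp add: inner_zero_left[abs_def])
  then show "(F has_derivative (\<bullet>) 0) (at x)"
    by (rule has_derivative_transform_within_open[of _ _ _ _ "- S"]) (use assms in \<open>auto simp: has_derivative_const\<close>)
qed

text \<open>Compact support in the full space removes all boundary terms. Instances are test
  functions, the bump, the mollifier, and zero extensions of products of a C^1 function on
  \<open>\<Omega>\<close> with a test function.\<close>

locale C1_compact =
  fixes F :: "'a::euclidean_space \<Rightarrow> real" and S
  assumes diff: "\<And>x. F differentiable (at x)"
    and cont_grad: "continuous_on UNIV (gradient F)"
    and compact: "compact S" and support: "\<And>x. x \<notin> S \<Longrightarrow> F x = 0"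
begin

lemma gradient_outside: "x \<notin> S \<Longrightarrow> gradient F x = 0"
  using compact support by (intro gradient_eq_0_outside[of S]) (auto intro: compact_imp_closed)

lemma cont: "continuous_on UNIV F"
  by (simp add: continuous_at_imp_continuous_on diff differentiable_imp_continuous_within)

lemma bounded_gradient: obtains C where "C > 0" "\<And>x. norm (gradient F x) \<le> C"
proof -
  have "bounded (gradient F ` S)"
    by (intro compact_imp_bounded compact_continuous_image compact continuous_on_subset[OF cont_grad]) auto
  then obtain b where b: "b > 0" "\<And>x. x \<in> S \<Longrightarrow> norm (gradient F x) \<le> b"
    by (auto simp: bounded_pos)
  show thesis
    by (rule that[of b]) (use b gradient_outside in \<open>metis norm_zero less_imp_le\<close>)+
qed

lemma lipschitz:
  assumes "\<And>x. norm (gradient F x) \<le> C"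
  shows "\<bar>F x - F y\<bar> \<le> C * norm (x - y)"
proof -
  have "norm (F x - F y) \<le> C * norm (x - y)"
  proof (rule differentiable_bound[of UNIV])
    show "(F has_derivative (\<bullet>) (gradient F x)) (at x within UNIV)" for x
      using has_derivative_gradient[OF diff] .
    show "onorm ((\<bullet>) (gradient F x)) \<le> C" for x
      using assms[of x] by (intro onorm_le) (metis Cauchy_Schwarz_ineq2 mult_right_mono norm_ge_zero order_trans real_norm_def)
  qed auto
  then show ?thesis by simp
qed

text \<open>By translation invariance of Lebesgue measure every difference quotient of
  \<open>F\<close> in direction \<open>b\<close> has integral zero; dominated convergence carries
  this to the derivative.\<close>

lemma integral_gradient_eq_0: "(LINT x|lborel. gradient F x \<bullet> b) = 0"
proof -
  obtain C where C: "C > 0" "\<And>x. norm (gradient F x) \<le> C"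
    using bounded_gradient by blast
  obtain R where R: "R > 0" "\<And>x. x \<in> S \<Longrightarrow> norm x \<le> R"
    using compact_imp_bounded[OF compact] by (auto simp: bounded_pos)
  define h where "h n = 1 / real (Suc n)" for n
  define q where "q n x = (F (x + h n *\<^sub>R b) - F x) / h n" for n x
  have h: "h n > 0" "h n \<le> 1" for n by (auto simp: h_def)
  have Fm[measurable]: "F \<in> borel_measurable borel"
    using cont by (rule borel_measurable_continuous_onI)
  have gm[measurable]: "gradient F \<in> borel_measurable borel"
    using cont_grad by (rule borel_measurable_continuous_onI)
  have qm[measurable]: "q n \<in> borel_measurable borel" for n
    unfolding q_def by measurable
  have F_int: "integrable lborel F"
  proof -
    have "integrable lborel (\<lambda>x. indicator S x *\<^sub>R F x)"
      by (intro borel_integrable_compact compact continuous_on_subset[OF cont]) auto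
    also have "(\<lambda>x. indicator S x *\<^sub>R F x) = F" using support by (fastforce simp: fun_eq_iff split: split_indicator)
    finally show ?thesis .
  qed
  have tr: "integrable lborel (\<lambda>x. F (x + c)) \<and> (LINT x|lborel. F (x + c)) = (LINT x|lborel. F x)" for c
  proof -
    have "integrable (distr lborel borel ((+) c)) F" using F_int by (simp add: lborel_distr_plus)
    then have 1: "integrable lborel (\<lambda>x. F (c + x))" by (subst (asm) integrable_distr_eq) auto
    have "(LINT x|lborel. F x) = (LINT x|distr lborel borel ((+) c). F x)" by (simp add: lborel_distr_plus)
    also have "\<dots> = (LINT x|lborel. F (c + x))" by (subst integral_distr) auto
    finally show ?thesis using 1 by (simp add: add.commute)
  qed
  have q0: "(LINT x|lborel. q n x) = 0" for n
    unfolding q_def using tr[of "h n *\<^sub>R b"] F_int by simp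
  \<comment> \<open>The quotients are bounded by \<open>C * norm b\<close> through the Lipschitz
    estimate. As \<open>h n \<le> 1\<close>, they all vanish outside the ball of radius
    \<open>R + norm b\<close>, which makes the bound integrable.\<close>
  have "(\<lambda>n. LINT x|lborel. q n x) \<longlonglongrightarrow> (LINT x|lborel. gradient F x \<bullet> b)"
  proof (rule integral_dominated_convergence[where w = "\<lambda>x. indicator (cball 0 (R + norm b)) x *\<^sub>R (C * norm b)"])
    show "integrable lborel (\<lambda>x::'a. indicator (cball 0 (R + norm b)) x *\<^sub>R (C * norm b))"
      by (rule borel_integrable_compact) auto
    show "AE x in lborel. (\<lambda>n. q n x) \<longlonglongrightarrow> gradient F x \<bullet> b"
    proof (rule AE_I2)
      fix x
      have "((\<lambda>t. x + t *\<^sub>R b) has_derivative (\<lambda>t. t *\<^sub>R b)) (at (0::real))"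
        by (auto intro!: derivative_eq_intros)
      moreover have "(F has_derivative (\<lambda>h. gradient F x \<bullet> h)) (at (x + 0 *\<^sub>R b))"
        using has_derivative_gradient[OF diff, of x] by simp
      ultimately have "((\<lambda>t. F (x + t *\<^sub>R b)) has_derivative (\<lambda>t. gradient F x \<bullet> (t *\<^sub>R b))) (at 0)"
        by (rule has_derivative_compose)
      moreover have "(\<lambda>t. gradient F x \<bullet> (t *\<^sub>R b)) = (*) (gradient F x \<bullet> b)"
        by (simp add: fun_eq_iff)
      ultimately have "((\<lambda>t. F (x + t *\<^sub>R b)) has_real_derivative gradient F x \<bullet> b) (at 0)"
        unfolding has_field_derivative_def by simp
      then have "((\<lambda>t. (F (x + t *\<^sub>R b) - F x) / t) \<longlongrightarrow> gradient F x \<bullet> b) (at 0)"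
        by (simp add: has_field_derivative_iff)
      moreover have "filterlim h (at 0) sequentially"
        unfolding filterlim_at using h LIMSEQ_Suc[OF lim_inverse_n]
        by (auto simp: h_def[abs_def] inverse_eq_divide)
      ultimately show "(\<lambda>n. q n x) \<longlonglongrightarrow> gradient F x \<bullet> b"
        unfolding q_def by (rule filterlim_compose)
    qed
    fix n
    show "AE x in lborel. norm (q n x) \<le> indicator (cball 0 (R + norm b)) x *\<^sub>R (C * norm b)"
    proof (rule AE_I2)
      fix x
      show "norm (q n x) \<le> indicator (cball 0 (R + norm b)) x *\<^sub>R (C * norm b)"
      proof (cases "norm x \<le> R + norm b")
        case True
        have "norm (q n x) = \<bar>F (x + h n *\<^sub>R b) - F x\<bar> / h n"
          using h[of n] by (simp add: q_def)
        also have "\<dots> \<le> (C * norm (h n *\<^sub>R b)) / h n"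
          using lipschitz[OF C(2), of "x + h n *\<^sub>R b" x] h[of n] by (intro divide_right_mono) auto
        also have "\<dots> = C * norm b" using h[of n] by simp
        finally show ?thesis using True by (simp add: dist_norm)
      next
        case False
        have "norm (h n *\<^sub>R b) \<le> norm b" using h[of n] by (simp add: mult_left_le_one_le)
        then have "norm (x + h n *\<^sub>R b) > R"
          using False norm_diff_ineq[of x "h n *\<^sub>R b"] by linarith
        moreover have "norm x > R" using False norm_ge_zero[of b] by linarith
        ultimately have "F x = 0" "F (x + h n *\<^sub>R b) = 0" using R(2) support by force+
        then show ?thesis using C by (simp add: q_def)
      qed
    qed
  qed auto
  then show ?thesis by (simp add: q0 LIMSEQ_const_iff)
qed

end

lemma test_function_C1_compact:
  fixes \<psi> :: "'a::euclidean_space \<Rightarrow> real"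
  assumes "\<psi> \<in> test_functions \<Omega>"
  shows "C1_compact \<psi> (closure {x. \<psi> x \<noteq> 0})"
proof
  have "Ck_on 1 UNIV \<psi>" using assms by (auto simp: test_functions_def)
  then show "\<psi> differentiable (at x)" "continuous_on UNIV (gradient \<psi>)" for x
    by (auto simp only: Ck_on_1_iff UNIV_I)
  show "\<And>x. x \<notin> closure {x. \<psi> x \<noteq> 0} \<Longrightarrow> \<psi> x = 0"
    using closure_subset by force
qed (use assms in \<open>auto simp: test_functions_def\<close>)

lemma gradient_mult:
  fixes f g :: "'a::euclidean_space \<Rightarrow> real"
  assumes "f differentiable (at x)" "g differentiable (at x)"
  shows "gradient (\<lambda>x. f x * g x) x = f x *\<^sub>R gradient g x + g x *\<^sub>R gradient f x"
proof (rule gradient_eqI)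
  show "((\<lambda>x. f x * g x) has_derivative (\<bullet>) (f x *\<^sub>R gradient g x + g x *\<^sub>R gradient f x)) (at x)"
    by (rule has_derivative_eq_rhs[OF has_derivative_mult[OF has_derivative_gradient[OF assms(1)] has_derivative_gradient[OF assms(2)]]])
      (simp add: fun_eq_iff inner_add_left)
qed

text \<open>The function \<open>U\<close> is controlled on \<open>\<Omega>\<close> only, but
  \<open>U * \<psi>\<close> extended by zero is C^1 on the whole space, since \<open>\<psi>\<close>
  vanishes outside a compact subset of \<open>\<Omega>\<close>. Its gradient then integrates to
  zero.\<close>

lemma integration_by_parts:
  fixes U :: "'a::euclidean_space \<Rightarrow> real"
  assumes U: "Ck_on 1 \<Omega> U" and \<Omega>: "open \<Omega>" and \<psi>: "\<psi> \<in> test_functions \<Omega>"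
  shows "(LINT x:\<Omega>|lborel. U x *\<^sub>R gradient \<psi> x) = - (LINT x:\<Omega>|lborel. \<psi> x *\<^sub>R gradient U x)"
    and "set_integrable lborel \<Omega> (\<lambda>x. U x *\<^sub>R gradient \<psi> x)"
proof -
  define K where "K = closure {x. \<psi> x \<noteq> 0}"
  interpret \<psi>: C1_compact \<psi> K unfolding K_def by (rule test_function_C1_compact[OF \<psi>])
  have K: "compact K" "K \<subseteq> \<Omega>" using \<psi> by (auto simp: K_def test_functions_def)
  have dU: "U differentiable (at x)" if "x \<in> \<Omega>" for x using U that by (auto simp: Ck_on_1_iff)
  have gU: "continuous_on \<Omega> (gradient U)" using U by (auto simp only: Ck_on_1_iff)
  have cU: "continuous_on \<Omega> U"
    by (simp add: continuous_at_imp_continuous_on dU differentiable_imp_continuous_within)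
  define F where "F x = (if x \<in> \<Omega> then U x * \<psi> x else 0)" for x
  define G where "G x = (if x \<in> \<Omega> then U x *\<^sub>R gradient \<psi> x + \<psi> x *\<^sub>R gradient U x else 0)" for x
  have D: "(F has_derivative (\<bullet>) (G x)) (at x)" for x
  proof (cases "x \<in> \<Omega>")
    case True
    have "((\<lambda>x. U x * \<psi> x) has_derivative (\<bullet>) (G x)) (at x)"
      by (rule has_derivative_eq_rhs[OF has_derivative_mult[OF has_derivative_gradient[OF dU[OF True]]
              has_derivative_gradient[OF \<psi>.diff]]])
        (use True in \<open>simp add: fun_eq_iff inner_add_left G_def\<close>)
    then show ?thesis
      by (rule has_derivative_transform_within_open[of _ _ _ _ \<Omega>]) (use True \<Omega> in \<open>auto simp: F_def\<close>)
  next
    case False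
    have "((\<lambda>x. 0) has_derivative (\<bullet>) (G x)) (at x)"
      by (rule has_derivative_eq_rhs[OF has_derivative_const]) (use False in \<open>simp add: G_def fun_eq_iff\<close>)
    then show ?thesis
      by (rule has_derivative_transform_within_open[of _ _ _ _ "- K"])
        (use False K in \<open>auto simp: F_def \<psi>.support intro: compact_imp_closed\<close>)
  qed
  then have gF: "gradient F = G" by (auto intro: gradient_eqI)
  have "continuous_on (\<Omega> \<union> - K) G"
  proof (rule continuous_on_open_Un)
    show "continuous_on \<Omega> G"
      by (subst continuous_on_cong[OF refl, of _ _ "\<lambda>x. U x *\<^sub>R gradient \<psi> x + \<psi> x *\<^sub>R gradient U x"])
        (auto simp: G_def intro!: continuous_intros cU gU continuous_on_subset[OF \<psi>.cont] continuous_on_subset[OF \<psi>.cont_grad])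
    show "continuous_on (- K) G"
      by (subst continuous_on_cong[OF refl, of _ _ "\<lambda>x. 0"])
        (auto simp: G_def \<psi>.support \<psi>.gradient_outside)
  qed (use \<Omega> K in \<open>auto intro: compact_imp_closed\<close>)
  moreover have "\<Omega> \<union> - K = UNIV" using K by auto
  ultimately have cG: "continuous_on UNIV G" by simp
  interpret F: C1_compact F K
    by standard (use D cG K in \<open>auto simp: differentiable_def gF F_def \<psi>.support\<close>)
  have i1: "integrable lborel (\<lambda>x. indicator K x *\<^sub>R (U x *\<^sub>R gradient \<psi> x))"
    by (intro borel_integrable_compact K continuous_intros continuous_on_subset[OF cU K(2)]
        continuous_on_subset[OF \<psi>.cont_grad]) auto
  have i2: "integrable lborel (\<lambda>x. indicator K x *\<^sub>R (\<psi> x *\<^sub>R gradient U x))"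
    by (intro borel_integrable_compact K continuous_intros continuous_on_subset[OF gU K(2)]
        continuous_on_subset[OF \<psi>.cont]) auto
  have e1: "(\<lambda>x. indicator K x *\<^sub>R (U x *\<^sub>R gradient \<psi> x)) = (\<lambda>x. indicator \<Omega> x *\<^sub>R (U x *\<^sub>R gradient \<psi> x))"
    using K \<psi>.gradient_outside by (fastforce simp: fun_eq_iff split: split_indicator)
  have e2: "(\<lambda>x. indicator K x *\<^sub>R (\<psi> x *\<^sub>R gradient U x)) = (\<lambda>x. indicator \<Omega> x *\<^sub>R (\<psi> x *\<^sub>R gradient U x))"
    using K \<psi>.support by (fastforce simp: fun_eq_iff split: split_indicator)
  note i1 = i1[unfolded e1] and i2 = i2[unfolded e2]
  show "set_integrable lborel \<Omega> (\<lambda>x. U x *\<^sub>R gradient \<psi> x)"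
    using i1 by (simp add: set_integrable_def)
  have G_sum: "G x = indicator \<Omega> x *\<^sub>R (U x *\<^sub>R gradient \<psi> x) + indicator \<Omega> x *\<^sub>R (\<psi> x *\<^sub>R gradient U x)" for x
    by (simp add: G_def indicator_def)
  have iG: "integrable lborel G" unfolding G_sum[abs_def] using i1 i2 by (rule Bochner_Integration.integrable_add)
  have "(LINT x|lborel. G x) \<bullet> b = 0" for b
    using F.integral_gradient_eq_0[of b] iG by (simp add: gF)
  \<comment> \<open>Take the integral itself as the direction \<open>b\<close>.\<close>
  then have "(LINT x|lborel. G x) = 0"
    by (metis inner_eq_zero_iff)
  then show "(LINT x:\<Omega>|lborel. U x *\<^sub>R gradient \<psi> x) = - (LINT x:\<Omega>|lborel. \<psi> x *\<^sub>R gradient U x)"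
    unfolding G_sum set_lebesgue_integral_def using i1 i2 by (simp add: eq_neg_iff_add_eq_0)
qed

section \<open>Signed measures and their variation\<close>

lemma space_positive_variation: "space (positive_variation \<Omega> \<nu>) = \<Omega>"
  unfolding positive_variation_def by (intro space_measure_of) (auto simp: sets_restrict_space)

lemma sets_positive_variation:
  "sets (positive_variation \<Omega> \<nu>) = sets (restrict_space borel \<Omega>)"
proof -
  have "sets (positive_variation \<Omega> \<nu>) = sigma_sets \<Omega> (sets (restrict_space borel \<Omega>))"
    unfolding positive_variation_def by (intro sets_measure_of) (auto simp: sets_restrict_space)
  also have "\<dots> = sets (restrict_space borel \<Omega>)"
    using sets.sigma_sets_eq[of "restrict_space borel \<Omega>"] by (simp add: space_restrict_space)
  finally show ?thesis .
qed

text \<open>An inequality suffices and avoids proving that the supremum is countably additive: if it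
  were not a measure, \<open>measure_of\<close> would return the zero measure, and the bound would
  hold trivially.\<close>

lemma emeasure_positive_variation_le:
  "emeasure (positive_variation \<Omega> \<nu>) E \<le>
    (SUP F\<in>{F \<in> sets (restrict_space borel \<Omega>). F \<subseteq> E}. ennreal (\<nu> F))"
  unfolding positive_variation_def by (subst emeasure_measure_of_conv) auto

locale signed_measure_on =
  fixes \<Omega> :: "'a::euclidean_space set" and \<nu> :: "'a set \<Rightarrow> real"
  assumes sums: "\<And>A :: nat \<Rightarrow> 'a set. range A \<subseteq> sets (restrict_space borel \<Omega>) \<Longrightarrow>
    disjoint_family A \<Longrightarrow> (\<lambda>i. \<nu> (A i)) sums \<nu> (\<Union>i. A i)"
begin

lemma empty: "\<nu> {} = 0"
proof -
  have "(\<lambda>i::nat. \<nu> {}) sums \<nu> (\<Union>i::nat. {})"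
    by (rule sums) (auto simp: disjoint_family_on_def)
  then show ?thesis using sums_summable summable_const_iff by blast
qed

lemma Un:
  assumes "A \<in> sets (restrict_space borel \<Omega>)" "B \<in> sets (restrict_space borel \<Omega>)" "A \<inter> B = {}"
  shows "\<nu> (A \<union> B) = \<nu> A + \<nu> B"
proof -
  have "(\<lambda>i. \<nu> (binaryset A B i)) sums \<nu> (\<Union>i. binaryset A B i)"
    using assms by (intro sums) (auto simp: disjoint_family_on_def binaryset_def)
  moreover have "(\<lambda>i. \<nu> (binaryset A B i)) sums (\<nu> A + \<nu> B)"
    by (rule binaryset_sums) (rule empty)
  ultimately show ?thesis by (simp add: UN_binaryset_eq sums_unique2)
qed

text \<open>The classical argument for signed measures: were the positive variation infinite, sets
  of infinite variation could be shrunk repeatedly, each time removing a piece of size at least 1.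
  The removed pieces are disjoint, so their values form a convergent series, whose terms must tend
  to 0.\<close>

lemma finite_SUP:
  assumes "\<Omega> \<in> sets borel"
  shows "(SUP F\<in>{F \<in> sets (restrict_space borel \<Omega>). F \<subseteq> \<Omega>}. ennreal (\<nu> F)) < top"
proof (rule ccontr)
  let ?B = "sets (restrict_space borel \<Omega>)"
  define P where "P E = (SUP F\<in>{F \<in> ?B. F \<subseteq> E}. ennreal (\<nu> F))" for E
  assume "\<not> ?thesis"
  then have top: "P \<Omega> = top" by (metis P_def less_top)
  have sub: "P (A \<union> B) \<le> P A + P B" if AB: "A \<in> ?B" "B \<in> ?B" "A \<inter> B = {}" for A B
    unfolding P_def[of "A \<union> B"]
  proof (rule SUP_least)
    fix F assume F: "F \<in> {F \<in> ?B. F \<subseteq> A \<union> B}"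
    have "\<nu> F = \<nu> (F \<inter> A) + \<nu> (F \<inter> B)"
      using Un[of "F \<inter> A" "F \<inter> B"] F AB by (auto simp: Int_Un_distrib[symmetric] Int_absorb2)
    then have "ennreal (\<nu> F) \<le> ennreal (max 0 (\<nu> (F \<inter> A)) + max 0 (\<nu> (F \<inter> B)))"
      by (intro ennreal_leI) linarith
    also have "\<dots> = ennreal (\<nu> (F \<inter> A)) + ennreal (\<nu> (F \<inter> B))"
      by (subst ennreal_plus) (auto simp: max_def ennreal_neg)
    also have "\<dots> \<le> P A + P B"
      unfolding P_def using F AB by (intro add_mono SUP_upper) auto
    finally show "ennreal (\<nu> F) \<le> P A + P B" .
  qed
  have step: "\<exists>F. (F \<in> ?B \<and> P F = top) \<and> F \<subseteq> E \<and> 1 \<le> \<bar>\<nu> (E - F)\<bar>" if E: "E \<in> ?B \<and> P E = top" for E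
  proof -
    \<comment> \<open>The margin \<open>\<bar>\<nu> E\<bar> + 1\<close> makes both
      \<open>\<nu> G\<close> and \<open>\<nu> (E - G)\<close> at least 1 in absolute value. One of
      the two parts inherits infinite variation by \<open>sub\<close>; it is kept and the other one
      removed.\<close>
    have "\<exists>G\<in>{F \<in> ?B. F \<subseteq> E}. ennreal (\<bar>\<nu> E\<bar> + 1) < ennreal (\<nu> G)"
    proof -
      have "ennreal (\<bar>\<nu> E\<bar> + 1) < P E" using E by simp
      then show ?thesis unfolding P_def by (simp add: less_SUP_iff)
    qed
    then obtain G where G: "G \<in> ?B" "G \<subseteq> E" "\<bar>\<nu> E\<bar> + 1 < \<nu> G"
      by (metis (no_types, lifting) ennreal_less_iff mem_Collect_eq abs_ge_zero add_nonneg_nonneg zero_le_one)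
    have d: "E - G \<in> ?B" using E G by auto
    have "\<nu> E = \<nu> G + \<nu> (E - G)"
      using Un[of G "E - G"] G d by (auto simp: Un_absorb1)
    then have n: "1 \<le> \<bar>\<nu> (E - G)\<bar>" "1 \<le> \<bar>\<nu> G\<bar>" using G by linarith+
    have "P E \<le> P G + P (E - G)" using sub[of G "E - G"] G d by (auto simp: Un_absorb1)
    then have "P G = top \<or> P (E - G) = top" using E by (auto simp: top_unique)
    then show ?thesis
    proof
      assume "P G = top" then show ?thesis using G n by auto
    next
      assume "P (E - G) = top"
      moreover have "E - (E - G) = G" using G by auto
      ultimately show ?thesis using d n by (intro exI[of _ "E - G"]) auto
    qed
  qed
  have "\<Omega> \<in> ?B" using assms by (auto simp: sets_restrict_space_iff)
  then obtain E where E: "\<And>n. E n \<in> ?B \<and> P (E n) = top" "\<And>n. E (Suc n) \<subseteq> E n \<and> 1 \<le> \<bar>\<nu> (E n - E (Suc n))\<bar>"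
    using dependent_nat_choice[of "\<lambda>_ E. E \<in> ?B \<and> P E = top" "\<lambda>_ E F. F \<subseteq> E \<and> 1 \<le> \<bar>\<nu> (E - F)\<bar>"] top step
    by (metis (lifting))
  have "decseq E" using E(2) by (intro decseq_SucI) auto
  then have "disjoint_family (\<lambda>n. E n - E (Suc n))"
    unfolding disjoint_family_on_def
  proof (intro ballI impI)
    fix m n :: nat assume "m \<noteq> n"
    then have "E n \<subseteq> E (Suc m) \<or> E m \<subseteq> E (Suc n)"
      using \<open>decseq E\<close> by (metis decseqD linorder_neqE_nat Suc_leI)
    then show "(E m - E (Suc m)) \<inter> (E n - E (Suc n)) = {}" by auto
  qed
  then have "(\<lambda>n. \<nu> (E n - E (Suc n))) sums \<nu> (\<Union>n. E n - E (Suc n))"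
    using E(1) by (intro sums) auto
  then have "(\<lambda>n. \<nu> (E n - E (Suc n))) \<longlonglongrightarrow> 0"
    using sums_summable summable_LIMSEQ_zero by blast
  then have "eventually (\<lambda>n. \<bar>\<nu> (E n - E (Suc n))\<bar> < 1) sequentially"
    by (auto simp: tendsto_iff dist_real_def)
  then show False using E(2) by (auto simp: eventually_sequentially not_less[symmetric])
qed

lemma finite_positive_variation:
  assumes "\<Omega> \<in> sets borel"
  shows "finite_measure (positive_variation \<Omega> \<nu>)"
proof
  show "emeasure (positive_variation \<Omega> \<nu>) (space (positive_variation \<Omega> \<nu>)) \<noteq> \<infinity>"
    using order_le_less_trans[OF emeasure_positive_variation_le finite_SUP[OF assms]]
    by (simp add: space_positive_variation)
qed

lemma uminus: "signed_measure_on \<Omega> (\<lambda>E. - \<nu> E)"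
  by standard (intro sums_minus sums)

end

lemma signed_measure_on_inner:
  "vector_radon_measure \<Omega> \<mu> \<Longrightarrow> signed_measure_on \<Omega> (\<lambda>E. \<mu> E \<bullet> b)"
  unfolding vector_radon_measure_def
  by standard (auto intro: bounded_linear.sums[OF bounded_linear_inner_left])

lemma vector_integral_inner:
  "b \<in> Basis \<Longrightarrow> vector_integral \<Omega> \<mu> \<psi> \<bullet> b = signed_integral \<Omega> (\<lambda>E. \<mu> E \<bullet> b) \<psi>"
  unfolding vector_integral_def by (rule inner_sum_left_Basis)

lemma ennreal_max_zero: "ennreal (max 0 x) = ennreal x"
  by (simp add: max_def ennreal_neg)

text \<open>The supremum is attained on the Hahn set where \<open>g > 0\<close>. In this case the
  set function passed to \<open>measure_of\<close> agrees on all Borel subsets of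
  \<open>\<Omega>\<close> with a genuine measure, the one with density the positive part of
  \<open>g\<close>; \<open>ennreal\<close> performs the truncation.\<close>

lemma positive_variation_density:
  fixes g :: "'a::euclidean_space \<Rightarrow> real"
  assumes \<Omega>: "\<Omega> \<in> sets borel" and g: "set_integrable lborel \<Omega> g"
  shows "positive_variation \<Omega> (\<lambda>E. LINT x:E|lborel. g x) =
    density (restrict_space lborel \<Omega>) (\<lambda>x. ennreal (g x))" (is "_ = ?N")
proof -
  let ?B = "sets (restrict_space borel \<Omega>)"
  have sB: "sets (restrict_space lborel \<Omega>) = ?B" by (rule sets_restrict_space_cong) simp
  have spB: "space (restrict_space lborel \<Omega>) = \<Omega>" by (simp add: space_restrict_space)
  have gi: "integrable (restrict_space lborel \<Omega>) g"
    using g \<Omega> by (simp add: integrable_restrict_space set_integrable_def)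
  then have [measurable]: "g \<in> borel_measurable (restrict_space lborel \<Omega>)" by auto
  have gE: "set_integrable lborel E g" if "E \<in> ?B" for E
    by (rule set_integrable_subset[OF g]) (use that \<Omega> in \<open>auto simp: sets_restrict_space_iff\<close>)
  have N: "emeasure ?N E = (\<integral>\<^sup>+x. ennreal (indicator E x * g x) \<partial>lborel)" if E: "E \<in> ?B" for E
  proof -
    have "emeasure ?N E = (\<integral>\<^sup>+x. ennreal (g x) * indicator E x \<partial>restrict_space lborel \<Omega>)"
      using E by (intro emeasure_density) (auto simp: sB)
    also have "\<dots> = (\<integral>\<^sup>+x. ennreal (g x) * indicator E x * indicator \<Omega> x \<partial>lborel)"
      using \<Omega> by (subst nn_integral_restrict_space) auto
    also have "\<dots> = (\<integral>\<^sup>+x. ennreal (indicator E x * g x) \<partial>lborel)"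
      using E \<Omega> by (intro nn_integral_cong) (auto simp: indicator_def sets_restrict_space_iff)
    finally show ?thesis .
  qed
  have eq: "(SUP F\<in>{F \<in> ?B. F \<subseteq> E}. ennreal (LINT x:F|lborel. g x)) = emeasure ?N E" if E: "E \<in> ?B" for E
  proof (rule antisym)
    show "(SUP F\<in>{F \<in> ?B. F \<subseteq> E}. ennreal (LINT x:F|lborel. g x)) \<le> emeasure ?N E"
    proof (rule SUP_least)
      fix F assume F: "F \<in> {F \<in> ?B. F \<subseteq> E}"
      then have i: "integrable lborel (\<lambda>x. indicator F x * g x)"
        using gE[of F] by (simp add: set_integrable_def)
      have "ennreal (LINT x:F|lborel. g x) \<le> ennreal (LINT x|lborel. max 0 (indicator F x * g x))"
        unfolding set_lebesgue_integral_def using i by (intro ennreal_leI integral_mono) auto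
      also have "\<dots> = (\<integral>\<^sup>+x. ennreal (max 0 (indicator F x * g x)) \<partial>lborel)"
        using i by (intro nn_integral_eq_integral[symmetric]) auto
      also have "\<dots> = emeasure ?N F" using F by (simp add: N ennreal_max_zero)
      also have "\<dots> \<le> emeasure ?N E" using F E by (intro emeasure_mono) (auto simp: sB)
      finally show "ennreal (LINT x:F|lborel. g x) \<le> emeasure ?N E" .
    qed
    define F where "F = {x \<in> space (restrict_space lborel \<Omega>). g x > 0} \<inter> E"
    have F: "F \<in> ?B" unfolding F_def using E by (intro sets.Int) (auto simp flip: sB)
    then have i: "integrable lborel (\<lambda>x. indicator F x * g x)"
      using gE[of F] by (simp add: set_integrable_def)
    have "emeasure ?N E = (\<integral>\<^sup>+x. ennreal (indicator F x * g x) \<partial>lborel)"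
      unfolding N[OF E] using E
      by (intro nn_integral_cong) (auto simp: indicator_def F_def sets_restrict_space_iff \<Omega> ennreal_neg not_less space_restrict_space)
    also have "\<dots> = ennreal (LINT x:F|lborel. g x)"
      unfolding set_lebesgue_integral_def using i
      by (subst nn_integral_eq_integral) (auto simp: F_def indicator_def)
    also have "\<dots> \<le> (SUP F\<in>{F \<in> ?B. F \<subseteq> E}. ennreal (LINT x:F|lborel. g x))"
      using F by (intro SUP_upper) (auto simp: F_def)
    finally show "emeasure ?N E \<le> (SUP F\<in>{F \<in> ?B. F \<subseteq> E}. ennreal (LINT x:F|lborel. g x))" .
  qed
  have "positive_variation \<Omega> (\<lambda>E. LINT x:E|lborel. g x) = measure_of \<Omega> ?B (emeasure ?N)"
    unfolding positive_variation_def
  proof (rule measure_of_eq)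
    show "?B \<subseteq> Pow \<Omega>" by (auto simp: sets_restrict_space)
    have "sigma_sets \<Omega> ?B = ?B"
      using sets.sigma_sets_eq[of "restrict_space borel \<Omega>"] by (simp add: space_restrict_space)
    then show "(SUP F\<in>{F \<in> ?B. F \<subseteq> E}. ennreal (LINT x:F|lborel. g x)) = emeasure ?N E"
      if "E \<in> sigma_sets \<Omega> ?B" for E
      using that eq by simp
  qed
  also have "\<dots> = ?N"
    using measure_of_of_measure[of ?N] by (simp add: sB spB)
  finally show ?thesis .
qed

text \<open>Splitting \<open>g\<close> into positive and negative parts turns the integral against
  Jordan parts into an ordinary one.\<close>

lemma signed_integral_density:
  fixes g :: "'a::euclidean_space \<Rightarrow> real"
  assumes \<Omega>: "\<Omega> \<in> sets borel" and g: "set_integrable lborel \<Omega> g"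
    and \<psi>: "\<psi> \<in> borel_measurable (restrict_space borel \<Omega>)" "\<And>x. x \<in> \<Omega> \<Longrightarrow> \<bar>\<psi> x\<bar> \<le> C"
  shows "signed_integral \<Omega> (\<lambda>E. LINT x:E|lborel. g x) \<psi> = (LINT x:\<Omega>|lborel. \<psi> x * g x)"
    and "set_integrable lborel \<Omega> (\<lambda>x. \<psi> x * g x)"
proof -
  let ?R = "restrict_space lborel \<Omega>"
  have sB: "sets ?R = sets (restrict_space borel \<Omega>)" by (rule sets_restrict_space_cong) simp
  have [measurable]: "\<psi> \<in> borel_measurable ?R" using \<psi>(1) by (simp cong: measurable_cong_sets add: measurable_cong_sets[OF sB refl])
  have sp: "space ?R = \<Omega>" by (simp add: space_restrict_space)
  have R: "integrable ?R f \<longleftrightarrow> set_integrable lborel \<Omega> f" "(LINT x|?R. f x) = (LINT x:\<Omega>|lborel. f x)" for f :: "'a \<Rightarrow> real"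
    using \<Omega> by (simp_all add: integrable_restrict_space set_integrable_def integral_restrict_space set_lebesgue_integral_def)
  have gi: "integrable ?R g" using g by (simp add: R)
  then have [measurable]: "g \<in> borel_measurable ?R" by auto
  have D: "(LINT x|density ?R (\<lambda>x. ennreal (f x)). \<psi> x) = (LINT x|?R. max 0 (f x) * \<psi> x)"
    if [measurable]: "f \<in> borel_measurable ?R" for f
  proof -
    have "density ?R (\<lambda>x. ennreal (f x)) = density ?R (\<lambda>x. ennreal (max 0 (f x)))"
      by (simp add: ennreal_max_zero)
    then show ?thesis by (simp add: integral_density)
  qed
  have i: "integrable ?R (\<lambda>x. f x * \<psi> x)" if f: "integrable ?R f" for f
  proof (rule Bochner_Integration.integrable_bound)
    show "integrable ?R (\<lambda>x. C * f x)" using f by auto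
    show "AE x in ?R. norm (f x * \<psi> x) \<le> norm (C * f x)"
    proof (rule AE_I2)
      fix x assume "x \<in> space ?R"
      then have "\<bar>\<psi> x\<bar> \<le> \<bar>C\<bar>" using \<psi>(2)[of x] sp by auto
      then show "norm (f x * \<psi> x) \<le> norm (C * f x)"
        by (simp add: abs_mult mult.commute mult_right_mono)
    qed
  qed (use f in measurable)
  have gm: "set_integrable lborel \<Omega> (\<lambda>x. - g x)" using g by (simp add: set_integrable_def)
  have n: "(\<lambda>E. - (LINT x:E|lborel. g x)) = (\<lambda>E. LINT x:E|lborel. - g x)"
    by (simp add: set_lebesgue_integral_def)
  have "signed_integral \<Omega> (\<lambda>E. LINT x:E|lborel. g x) \<psi> =
      (LINT x|?R. max 0 (g x) * \<psi> x) - (LINT x|?R. max 0 (- g x) * \<psi> x)"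
    unfolding signed_integral_def n using g gm
    by (subst (1 2) positive_variation_density) (auto simp: \<Omega> D)
  also have "\<dots> = (LINT x|?R. max 0 (g x) * \<psi> x - max 0 (- g x) * \<psi> x)"
    using gi by (intro Bochner_Integration.integral_diff[symmetric] i) auto
  also have "\<dots> = (LINT x|?R. \<psi> x * g x)"
    by (intro Bochner_Integration.integral_cong) (auto simp: max_def)
  finally show "signed_integral \<Omega> (\<lambda>E. LINT x:E|lborel. g x) \<psi> = (LINT x:\<Omega>|lborel. \<psi> x * g x)"
    by (simp add: R)
  show "set_integrable lborel \<Omega> (\<lambda>x. \<psi> x * g x)"
    using i[OF gi] by (simp add: R mult.commute)
qed

section \<open>Gradient measures and weak* convergence\<close>

lemma vector_radon_measure_density:
  fixes G :: "'a::euclidean_space \<Rightarrow> 'a"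
  assumes \<Omega>: "\<Omega> \<in> sets borel" and G: "set_integrable lborel \<Omega> G"
  shows "vector_radon_measure \<Omega> (\<lambda>E. LINT x:E|lborel. G x)"
  unfolding vector_radon_measure_def
proof (intro allI impI)
  fix A :: "nat \<Rightarrow> 'a set"
  assume A: "range A \<subseteq> sets (restrict_space borel \<Omega>) \<and> disjoint_family A"
  have m: "A i \<in> sets lborel" "A i \<subseteq> \<Omega>" for i
    using A \<Omega> by (auto simp: sets_restrict_space_iff dest!: range_subsetD)
  have int: "set_integrable lborel E G" if "E \<in> sets lborel" "E \<subseteq> \<Omega>" for E
    by (rule set_integrable_subset[OF G]) (use that in auto)
  have "(\<Sum>i<n. LINT x:A i|lborel. G x) = (LINT x:(\<Union>i<n. A i)|lborel. G x)" for n
  proof (induction n)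
    case (Suc n)
    have "(LINT x:(\<Union>i<n. A i) \<union> A n|lborel. G x) =
        (LINT x:(\<Union>i<n. A i)|lborel. G x) + (LINT x:A n|lborel. G x)"
    proof (rule set_integral_Un)
      have "A i \<inter> A n = {}" if "i < n" for i
        using A that by (auto simp: disjoint_family_on_def)
      then show "(\<Union>i<n. A i) \<inter> A n = {}" by auto
    qed (use m in \<open>auto intro!: int\<close>)
    then show ?case using Suc by (simp add: lessThan_Suc Un_commute)
  qed (simp add: set_lebesgue_integral_def)
  moreover have "(\<lambda>n. LINT x:(\<Union>i<n. A i)|lborel. G x) \<longlonglongrightarrow> (LINT x:(\<Union>n. \<Union>i<n. A i)|lborel. G x)"
  proof (rule set_integral_cont_up)
    show "incseq (\<lambda>n. \<Union>i<n. A i)" by (fastforce simp: incseq_def)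
    show "set_integrable lborel (\<Union>n. \<Union>i<n. A i) G" using m by (intro int) auto
  qed (use m in auto)
  moreover have "(\<Union>n. \<Union>i<n. A i) = (\<Union>i. A i)" by auto
  ultimately show "(\<lambda>i. LINT x:A i|lborel. G x) sums (LINT x:(\<Union>i. A i)|lborel. G x)"
    by (simp add: sums_def)
qed

text \<open>Set functions given by integrals have default values on sets where the integrand is not
  integrable, so identities between them are available on Borel subsets of \<open>\<Omega>\<close>
  only.\<close>

lemma signed_integral_cong:
  assumes "\<And>E. E \<in> sets (restrict_space borel \<Omega>) \<Longrightarrow> \<nu> E = \<nu>' E"
  shows "signed_integral \<Omega> \<nu> \<psi> = signed_integral \<Omega> \<nu>' \<psi>"
proof -
  have "positive_variation \<Omega> \<nu> = positive_variation \<Omega> \<nu>'"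
    "positive_variation \<Omega> (\<lambda>E. - \<nu> E) = positive_variation \<Omega> (\<lambda>E. - \<nu>' E)"
    unfolding positive_variation_def using assms
    by (auto intro!: arg_cong[where f = "measure_of _ _"] SUP_cong simp: fun_eq_iff)
  then show ?thesis by (simp add: signed_integral_def)
qed

lemma signed_integral_inner_density:
  fixes G :: "'a::euclidean_space \<Rightarrow> 'a"
  assumes \<Omega>: "\<Omega> \<in> sets borel" and G: "set_integrable lborel \<Omega> G"
    and \<psi>: "\<psi> \<in> borel_measurable (restrict_space borel \<Omega>)" "\<And>x. x \<in> \<Omega> \<Longrightarrow> \<bar>\<psi> x\<bar> \<le> C"
  shows "signed_integral \<Omega> (\<lambda>E. (LINT x:E|lborel. G x) \<bullet> b) \<psi> = (LINT x:\<Omega>|lborel. \<psi> x * (G x \<bullet> b))"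
    and "set_integrable lborel \<Omega> (\<lambda>x. \<psi> x * (G x \<bullet> b))"
proof -
  have Gb: "set_integrable lborel \<Omega> (\<lambda>x. G x \<bullet> b)"
    using integrable_inner_left[of b lborel "\<lambda>x. indicator \<Omega> x *\<^sub>R G x"] G
    by (simp add: set_integrable_def)
  have "(LINT x:E|lborel. G x) \<bullet> b = (LINT x:E|lborel. G x \<bullet> b)" if "E \<in> sets (restrict_space borel \<Omega>)" for E
  proof -
    have "set_integrable lborel E G"
      by (rule set_integrable_subset[OF G]) (use that \<Omega> in \<open>auto simp: sets_restrict_space_iff\<close>)
    then show ?thesis
      using integral_inner_left[of b lborel "\<lambda>x. indicator E x *\<^sub>R G x"]
      unfolding set_integrable_def set_lebesgue_integral_def by simp
  qed
  then have "signed_integral \<Omega> (\<lambda>E. (LINT x:E|lborel. G x) \<bullet> b) \<psi> = signed_integral \<Omega> (\<lambda>E. LINT x:E|lborel. G x \<bullet> b) \<psi>"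
    by (rule signed_integral_cong)
  then show "signed_integral \<Omega> (\<lambda>E. (LINT x:E|lborel. G x) \<bullet> b) \<psi> = (LINT x:\<Omega>|lborel. \<psi> x * (G x \<bullet> b))"
    "set_integrable lborel \<Omega> (\<lambda>x. \<psi> x * (G x \<bullet> b))"
    using signed_integral_density[OF \<Omega> Gb \<psi>] by auto
qed

lemma test_functions_subset_vanishing: "test_functions \<Omega> \<subseteq> vanishing_functions \<Omega>"
proof
  fix \<psi> assume \<psi>: "\<psi> \<in> test_functions \<Omega>"
  interpret C1_compact \<psi> "closure {x. \<psi> x \<noteq> 0}" by (rule test_function_C1_compact[OF \<psi>])
  have "continuous_on \<Omega> \<psi>" by (rule continuous_on_subset[OF cont subset_UNIV])
  moreover have "closure {x. \<psi> x \<noteq> 0} \<subseteq> \<Omega>" using \<psi> by (simp add: test_functions_def)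
  moreover have "\<bar>\<psi> x\<bar> < \<epsilon>" if "\<epsilon> > 0" "x \<in> \<Omega> - closure {x. \<psi> x \<noteq> 0}" for \<epsilon> x
    using support[of x] that by simp
  ultimately show "\<psi> \<in> vanishing_functions \<Omega>"
    unfolding vanishing_functions_def using compact by blast
qed

lemma vanishing_functions_bounded_measurable:
  assumes "\<psi> \<in> vanishing_functions \<Omega>"
  obtains C where "\<psi> \<in> borel_measurable (restrict_space borel \<Omega>)" "\<And>x. x \<in> \<Omega> \<Longrightarrow> \<bar>\<psi> x\<bar> \<le> C"
proof -
  have c: "continuous_on \<Omega> \<psi>" using assms by (simp add: vanishing_functions_def)
  obtain K where K: "compact K" "K \<subseteq> \<Omega>" "\<And>x. x \<in> \<Omega> - K \<Longrightarrow> \<bar>\<psi> x\<bar> < 1"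
    using assms unfolding vanishing_functions_def by (force dest: spec[of _ "1::real"])
  have "bounded (\<psi> ` K)"
    by (intro compact_imp_bounded compact_continuous_image continuous_on_subset[OF c] K)
  then obtain B where B: "\<And>x. x \<in> K \<Longrightarrow> \<bar>\<psi> x\<bar> \<le> B" by (auto simp: bounded_iff)
  show thesis
  proof (rule that)
    show "\<psi> \<in> borel_measurable (restrict_space borel \<Omega>)"
      using c by (rule borel_measurable_continuous_on_restrict)
    show "\<bar>\<psi> x\<bar> \<le> max 1 B" if "x \<in> \<Omega>" for x
      using B[of x] K(3)[of x] that by (cases "x \<in> K") force+
  qed
qed

lemma integral_diff_le_finite_measure:
  fixes f g :: "'a::euclidean_space \<Rightarrow> real"
  assumes "finite_measure M" and f: "f \<in> borel_measurable M" "\<And>x. x \<in> space M \<Longrightarrow> \<bar>f x\<bar> \<le> A"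
    and g: "g \<in> borel_measurable M" "\<And>x. x \<in> space M \<Longrightarrow> \<bar>g x\<bar> \<le> B"
    and e: "\<And>x. x \<in> space M \<Longrightarrow> \<bar>f x - g x\<bar> \<le> e"
  shows "\<bar>(LINT x|M. f x) - (LINT x|M. g x)\<bar> \<le> e * measure M (space M)"
proof -
  interpret finite_measure M by fact
  have i: "integrable M f" "integrable M g"
    using integrable_const_bound[of f A, OF AE_I2 f(1)] integrable_const_bound[of g B, OF AE_I2 g(1)] f(2) g(2)
    by simp_all
  then have "\<bar>(LINT x|M. f x) - (LINT x|M. g x)\<bar> = norm (LINT x|M. f x - g x)" by simp
  also have "\<dots> \<le> (LINT x|M. e)"
    using i e by (intro Bochner_Integration.integral_norm_bound_integral) auto
  finally show ?thesis by (simp add: mult.commute)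
qed

text \<open>Continuity in the sup norm, with the total variation as constant. It carries weight
  because both variations are finite measures.\<close>

lemma signed_integral_diff_le:
  assumes \<nu>: "signed_measure_on \<Omega> \<nu>" and \<Omega>: "open \<Omega>"
    and f: "f \<in> vanishing_functions \<Omega>" and g: "g \<in> vanishing_functions \<Omega>"
    and e: "\<And>x. x \<in> \<Omega> \<Longrightarrow> \<bar>f x - g x\<bar> \<le> e"
  shows "\<bar>signed_integral \<Omega> \<nu> f - signed_integral \<Omega> \<nu> g\<bar> \<le>
    e * (measure (positive_variation \<Omega> \<nu>) \<Omega> + measure (positive_variation \<Omega> (\<lambda>E. - \<nu> E)) \<Omega>)"
proof -
  obtain A where A: "f \<in> borel_measurable (restrict_space borel \<Omega>)" "\<And>x. x \<in> \<Omega> \<Longrightarrow> \<bar>f x\<bar> \<le> A"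
    using vanishing_functions_bounded_measurable[OF f] by metis
  obtain B where B: "g \<in> borel_measurable (restrict_space borel \<Omega>)" "\<And>x. x \<in> \<Omega> \<Longrightarrow> \<bar>g x\<bar> \<le> B"
    using vanishing_functions_bounded_measurable[OF g] by metis
  have *: "\<bar>(LINT x|positive_variation \<Omega> \<nu>. f x) - (LINT x|positive_variation \<Omega> \<nu>. g x)\<bar>
      \<le> e * measure (positive_variation \<Omega> \<nu>) \<Omega>" if "signed_measure_on \<Omega> \<nu>" for \<nu>
    using integral_diff_le_finite_measure[OF signed_measure_on.finite_positive_variation[OF that], of f A g B e]
      A B e \<Omega> by (simp add: space_positive_variation measurable_cong_sets[OF sets_positive_variation refl])
  show ?thesis
    unfolding signed_integral_def distrib_left
    using *[OF \<nu>] *[OF signed_measure_on.uminus[OF \<nu>]] by linarith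
qed

lemma has_gradient_measure_C1:
  fixes U :: "'a::euclidean_space \<Rightarrow> real"
  assumes U: "Ck_on 1 \<Omega> U" and \<Omega>: "open \<Omega>" and G: "set_integrable lborel \<Omega> (gradient U)"
  shows "has_gradient_measure \<Omega> U (\<lambda>E. LINT x:E|lborel. gradient U x)"
  unfolding has_gradient_measure_def
proof (intro conjI ballI)
  show "vector_radon_measure \<Omega> (\<lambda>E. LINT x:E|lborel. gradient U x)"
    using \<Omega> G by (intro vector_radon_measure_density) auto
  fix \<psi> assume \<psi>: "\<psi> \<in> test_functions \<Omega>"
  then obtain C where C: "\<psi> \<in> borel_measurable (restrict_space borel \<Omega>)" "\<And>x. x \<in> \<Omega> \<Longrightarrow> \<bar>\<psi> x\<bar> \<le> C"
    using vanishing_functions_bounded_measurable test_functions_subset_vanishing by (metis subsetD)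
  have g: "set_integrable lborel \<Omega> (\<lambda>x. \<psi> x *\<^sub>R gradient U x)"
    unfolding set_integrable_def
  proof (rule Bochner_Integration.integrable_bound)
    show "integrable lborel (\<lambda>x. C *\<^sub>R (indicator \<Omega> x *\<^sub>R gradient U x))"
      using G by (intro integrable_scaleR_right) (simp add: set_integrable_def)
    have [measurable]: "(\<lambda>x. indicator \<Omega> x *\<^sub>R gradient U x) \<in> borel_measurable lborel"
      using G by (auto simp: set_integrable_def)
    have [measurable]: "(\<lambda>x. indicator \<Omega> x *\<^sub>R \<psi> x) \<in> borel_measurable lborel"
      using C(1) \<Omega> by (simp add: borel_measurable_restrict_space_iff mult.commute)
    have "(\<lambda>x. indicator \<Omega> x *\<^sub>R \<psi> x *\<^sub>R gradient U x) =
        (\<lambda>x. (indicator \<Omega> x *\<^sub>R \<psi> x) *\<^sub>R (indicator \<Omega> x *\<^sub>R gradient U x))"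
      by (auto simp: fun_eq_iff split: split_indicator)
    moreover have "\<dots> \<in> borel_measurable lborel" by measurable
    ultimately show "(\<lambda>x. indicator \<Omega> x *\<^sub>R \<psi> x *\<^sub>R gradient U x) \<in> borel_measurable lborel"
      by (simp only:)
    show "AE x in lborel. norm (indicator \<Omega> x *\<^sub>R \<psi> x *\<^sub>R gradient U x) \<le> norm (C *\<^sub>R (indicator \<Omega> x *\<^sub>R gradient U x))"
      using C(2) by (intro AE_I2) (fastforce split: split_indicator intro: mult_right_mono)
  qed
  have "vector_integral \<Omega> (\<lambda>E. LINT x:E|lborel. gradient U x) \<psi> = (LINT x:\<Omega>|lborel. \<psi> x *\<^sub>R gradient U x)"
  proof (rule euclidean_eqI)
    fix b :: 'a assume b: "b \<in> Basis"
    show "vector_integral \<Omega> (\<lambda>E. LINT x:E|lborel. gradient U x) \<psi> \<bullet> b = (LINT x:\<Omega>|lborel. \<psi> x *\<^sub>R gradient U x) \<bullet> b"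
      using integral_inner_left[of b lborel "\<lambda>x. indicator \<Omega> x *\<^sub>R \<psi> x *\<^sub>R gradient U x"] g \<Omega>
      unfolding vector_integral_inner[OF b] set_integrable_def
      by (subst signed_integral_inner_density(1)[OF _ G C]) (auto simp: set_lebesgue_integral_def mult.assoc)
  qed
  moreover have "(LINT x:\<Omega>|lebesgue. U x *\<^sub>R gradient \<psi> x) = (LINT x:\<Omega>|lborel. U x *\<^sub>R gradient \<psi> x)"
    using integration_by_parts(2)[OF U \<Omega> \<psi>] unfolding set_lebesgue_integral_def set_integrable_def
    by (intro integral_completion) auto
  ultimately show "(LINT x:\<Omega>|lebesgue. U x *\<^sub>R gradient \<psi> x) = - vector_integral \<Omega> (\<lambda>E. LINT x:E|lborel. gradient U x) \<psi>"
    using integration_by_parts(1)[OF U \<Omega> \<psi>] by simp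
qed

text \<open>Against a test function, integration by parts moves the gradient onto
  \<open>\<psi>\<close>, whose gradient is bounded, and L1 convergence finishes. For
  \<open>\<psi>\<close> in C_0 a uniformly close test function is used; the error is uniform in
  \<open>i\<close> because of the common bound \<open>C\<close> on the gradients.\<close>

lemma weak_star_BV_C1:
  fixes u :: "'a::euclidean_space \<Rightarrow> real"
  assumes \<Omega>: "open \<Omega>" and u: "u \<in> BV \<Omega>"
    and U: "\<And>i. Ck_on 1 \<Omega> (U i)" "\<And>i. set_integrable lborel \<Omega> (U i)"
      "\<And>i. set_integrable lborel \<Omega> (gradient (U i))"
    and C: "\<And>i. (LINT x:\<Omega>|lborel. norm (gradient (U i) x)) \<le> C"
    and lim: "(\<lambda>i. LINT x:\<Omega>|lebesgue. \<bar>U i x - u x\<bar>) \<longlonglongrightarrow> 0"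
  shows "weak_star_BV \<Omega> U u"
proof -
  let ?\<mu> = "\<lambda>i E. LINT x:E|lborel. gradient (U i) x"
  have gU: "has_gradient_measure \<Omega> (U i) (?\<mu> i)" for i
    by (rule has_gradient_measure_C1[OF U(1) \<Omega> U(3)])
  have aU: "set_integrable lebesgue \<Omega> (U i)" for i
    using U(2)[of i] unfolding set_integrable_def by (intro integrable_completion[THEN iffD2]) auto
  obtain \<mu> where \<mu>: "has_gradient_measure \<Omega> u \<mu>" using u by (auto simp: BV_def)
  have au: "set_integrable lebesgue \<Omega> u" using u by (simp add: BV_def)
  have C0: "C \<ge> 0"
    using order_trans[OF _ C[of 0]] unfolding set_lebesgue_integral_def by (simp add: integral_nonneg_AE)
  have test: "(\<lambda>i. vector_integral \<Omega> (?\<mu> i) \<psi>) \<longlonglongrightarrow> vector_integral \<Omega> \<mu> \<psi>" if \<psi>: "\<psi> \<in> test_functions \<Omega>" for \<psi>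
  proof -
    interpret \<psi>: C1_compact \<psi> "closure {x. \<psi> x \<noteq> 0}" by (rule test_function_C1_compact[OF \<psi>])
    obtain B where B: "B > 0" "\<And>x. norm (gradient \<psi> x) \<le> B" using \<psi>.bounded_gradient by blast
    have gm: "gradient \<psi> \<in> borel_measurable lebesgue"
      using borel_measurable_continuous_onI[OF \<psi>.cont_grad] by (auto intro: measurable_completion)
    have i: "set_integrable lebesgue \<Omega> (\<lambda>x. v x *\<^sub>R gradient \<psi> x)" if v: "set_integrable lebesgue \<Omega> v" for v
      unfolding set_integrable_def
    proof (rule Bochner_Integration.integrable_bound)
      show "integrable lebesgue (\<lambda>x. B *\<^sub>R (indicator \<Omega> x *\<^sub>R v x))"
        using v by (intro integrable_scaleR_right) (simp add: set_integrable_def)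
      have "(\<lambda>x. indicator \<Omega> x *\<^sub>R v x) \<in> borel_measurable lebesgue"
        using v by (auto simp: set_integrable_def)
      then have "(\<lambda>x. (indicator \<Omega> x *\<^sub>R v x) *\<^sub>R gradient \<psi> x) \<in> borel_measurable lebesgue"
        using gm by (rule borel_measurable_scaleR)
      then show "(\<lambda>x. indicator \<Omega> x *\<^sub>R v x *\<^sub>R gradient \<psi> x) \<in> borel_measurable lebesgue"
        by simp
      show "AE x in lebesgue. norm (indicator \<Omega> x *\<^sub>R v x *\<^sub>R gradient \<psi> x) \<le> norm (B *\<^sub>R (indicator \<Omega> x *\<^sub>R v x))"
        using B by (intro AE_I2) (auto split: split_indicator simp: abs_mult mult.commute[of B] intro!: mult_left_mono)
    qed
    have "(\<lambda>i. (LINT x:\<Omega>|lebesgue. U i x *\<^sub>R gradient \<psi> x) - (LINT x:\<Omega>|lebesgue. u x *\<^sub>R gradient \<psi> x)) \<longlonglongrightarrow> 0"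
    proof (rule tendsto_norm_zero_cancel, rule tendsto_sandwich[where f = "\<lambda>_. 0"])
      show "(\<lambda>i. B * (LINT x:\<Omega>|lebesgue. \<bar>U i x - u x\<bar>)) \<longlonglongrightarrow> 0"
        using tendsto_mult_right_zero[OF lim] by simp
      show "eventually (\<lambda>i. norm ((LINT x:\<Omega>|lebesgue. U i x *\<^sub>R gradient \<psi> x) - (LINT x:\<Omega>|lebesgue. u x *\<^sub>R gradient \<psi> x)) \<le>
          B * (LINT x:\<Omega>|lebesgue. \<bar>U i x - u x\<bar>)) sequentially"
      proof (rule always_eventually, rule allI)
        fix i :: nat
        have d: "set_integrable lebesgue \<Omega> (\<lambda>x. U i x - u x)" using aU au by (rule set_integral_diff)
        have "(LINT x:\<Omega>|lebesgue. U i x *\<^sub>R gradient \<psi> x) - (LINT x:\<Omega>|lebesgue. u x *\<^sub>R gradient \<psi> x)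
            = (LINT x:\<Omega>|lebesgue. (U i x - u x) *\<^sub>R gradient \<psi> x)"
          unfolding scaleR_diff_left using i[OF aU] i[OF au] by (rule set_integral_diff(2)[symmetric])
        also have "norm \<dots> \<le> (LINT x|lebesgue. B * (indicator \<Omega> x *\<^sub>R \<bar>U i x - u x\<bar>))"
          unfolding set_lebesgue_integral_def
        proof (rule Bochner_Integration.integral_norm_bound_integral)
          show "integrable lebesgue (\<lambda>x. indicator \<Omega> x *\<^sub>R (U i x - u x) *\<^sub>R gradient \<psi> x)"
            using i[OF d] by (simp add: set_integrable_def)
          show "integrable lebesgue (\<lambda>x. B * (indicator \<Omega> x *\<^sub>R \<bar>U i x - u x\<bar>))"
            using set_integrable_abs[OF d] by (simp add: set_integrable_def)
          show "norm (indicator \<Omega> x *\<^sub>R (U i x - u x) *\<^sub>R gradient \<psi> x) \<le> B * (indicator \<Omega> x *\<^sub>R \<bar>U i x - u x\<bar>)" for x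
            using B(2)[of x] by (auto split: split_indicator simp: mult.commute[of B] intro!: mult_left_mono)
        qed
        also have "\<dots> = B * (LINT x:\<Omega>|lebesgue. \<bar>U i x - u x\<bar>)"
          by (simp add: set_lebesgue_integral_def)
        finally show "norm ((LINT x:\<Omega>|lebesgue. U i x *\<^sub>R gradient \<psi> x) - (LINT x:\<Omega>|lebesgue. u x *\<^sub>R gradient \<psi> x)) \<le>
          B * (LINT x:\<Omega>|lebesgue. \<bar>U i x - u x\<bar>)" .
      qed
    qed auto
    then have "(\<lambda>i. LINT x:\<Omega>|lebesgue. U i x *\<^sub>R gradient \<psi> x) \<longlonglongrightarrow> (LINT x:\<Omega>|lebesgue. u x *\<^sub>R gradient \<psi> x)"
      by (simp add: LIM_zero_iff)
    then have "(\<lambda>i. - vector_integral \<Omega> (?\<mu> i) \<psi>) \<longlonglongrightarrow> - vector_integral \<Omega> \<mu> \<psi>"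
      using gU \<mu> \<psi> by (simp add: has_gradient_measure_def)
    then show ?thesis by (simp add: tendsto_minus_cancel_left)
  qed
  have "weak_star_measures \<Omega> ?\<mu> \<mu>"
    unfolding weak_star_measures_def
  proof
    fix \<psi> assume \<psi>: "\<psi> \<in> vanishing_functions \<Omega>"
    show "(\<lambda>i. vector_integral \<Omega> (?\<mu> i) \<psi>) \<longlonglongrightarrow> vector_integral \<Omega> \<mu> \<psi>"
      unfolding vector_integral_def
    proof (intro tendsto_sum tendsto_scaleR tendsto_const)
      fix b :: 'a assume b: "b \<in> Basis"
      have sm: "signed_measure_on \<Omega> (\<lambda>E. \<mu> E \<bullet> b)" "signed_measure_on \<Omega> (\<lambda>E. ?\<mu> i E \<bullet> b)" for i
        using \<mu> gU by (auto simp: has_gradient_measure_def intro: signed_measure_on_inner)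
      define M where "M = measure (positive_variation \<Omega> (\<lambda>E. \<mu> E \<bullet> b)) \<Omega> + measure (positive_variation \<Omega> (\<lambda>E. - (\<mu> E \<bullet> b))) \<Omega>"
      have M: "M \<ge> 0" by (simp add: M_def)
      show "(\<lambda>i. signed_integral \<Omega> (\<lambda>E. ?\<mu> i E \<bullet> b) \<psi>) \<longlonglongrightarrow> signed_integral \<Omega> (\<lambda>E. \<mu> E \<bullet> b) \<psi>"
      proof (rule LIMSEQ_I)
        fix e :: real assume e: "e > 0"
        \<comment> \<open>Replacing \<open>\<psi>\<close> by a test function costs at most
          \<open>d * C\<close> for the approximants and \<open>d * M\<close> for the limit. Their
          sum stays below \<open>e / 2\<close>, strictly thanks to the added 1; the other half is
          left for the convergence against the test function.\<close>
        define d where "d = e / (2 * (C + M + 1))"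
        have d: "d > 0" using e C0 M by (simp add: d_def)
        have dCM: "d * C + d * M < e / 2"
        proof -
          have "d * (C + M + 1) = e / 2" using C0 M by (simp add: d_def field_simps)
          then show ?thesis using d by (simp add: distrib_left)
        qed
        obtain \<psi>' where \<psi>': "\<psi>' \<in> test_functions \<Omega>" "\<And>x. x \<in> \<Omega> \<Longrightarrow> \<bar>\<psi> x - \<psi>' x\<bar> \<le> d"
          using test_functions_dense[OF \<Omega> \<psi> d] by metis
        have v': "\<psi>' \<in> vanishing_functions \<Omega>" using \<psi>' test_functions_subset_vanishing by auto
        obtain A where A: "\<psi> \<in> borel_measurable (restrict_space borel \<Omega>)" "\<And>x. x \<in> \<Omega> \<Longrightarrow> \<bar>\<psi> x\<bar> \<le> A"
          using vanishing_functions_bounded_measurable[OF \<psi>] by metis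
        obtain A' where A': "\<psi>' \<in> borel_measurable (restrict_space borel \<Omega>)" "\<And>x. x \<in> \<Omega> \<Longrightarrow> \<bar>\<psi>' x\<bar> \<le> A'"
          using vanishing_functions_bounded_measurable[OF v'] by metis
        have 1: "\<bar>signed_integral \<Omega> (\<lambda>E. \<mu> E \<bullet> b) \<psi> - signed_integral \<Omega> (\<lambda>E. \<mu> E \<bullet> b) \<psi>'\<bar> \<le> d * M"
          unfolding M_def by (rule signed_integral_diff_le[OF sm(1) \<Omega> \<psi> v' \<psi>'(2)])
        have 2: "\<bar>signed_integral \<Omega> (\<lambda>E. ?\<mu> i E \<bullet> b) \<psi> - signed_integral \<Omega> (\<lambda>E. ?\<mu> i E \<bullet> b) \<psi>'\<bar> \<le> d * C" for i
        proof -
          have oB: "\<Omega> \<in> sets borel" using \<Omega> by simp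
          have r1: "signed_integral \<Omega> (\<lambda>E. ?\<mu> i E \<bullet> b) \<psi> = (LINT x:\<Omega>|lborel. \<psi> x * (gradient (U i) x \<bullet> b))"
            "set_integrable lborel \<Omega> (\<lambda>x. \<psi> x * (gradient (U i) x \<bullet> b))"
            using signed_integral_inner_density[OF oB U(3) A] by blast+
          have r2: "signed_integral \<Omega> (\<lambda>E. ?\<mu> i E \<bullet> b) \<psi>' = (LINT x:\<Omega>|lborel. \<psi>' x * (gradient (U i) x \<bullet> b))"
            "set_integrable lborel \<Omega> (\<lambda>x. \<psi>' x * (gradient (U i) x \<bullet> b))"
            using signed_integral_inner_density[OF oB U(3) A'] by blast+
          have "\<bar>signed_integral \<Omega> (\<lambda>E. ?\<mu> i E \<bullet> b) \<psi> - signed_integral \<Omega> (\<lambda>E. ?\<mu> i E \<bullet> b) \<psi>'\<bar> =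
              norm (LINT x|lborel. indicator \<Omega> x *\<^sub>R (\<psi> x * (gradient (U i) x \<bullet> b) - \<psi>' x * (gradient (U i) x \<bullet> b)))"
            using set_integral_diff(2)[OF r1(2) r2(2)]
            unfolding r1(1) r2(1) by (simp add: set_lebesgue_integral_def)
          also have "\<dots> \<le> (LINT x|lborel. d * (indicator \<Omega> x *\<^sub>R norm (gradient (U i) x)))"
          proof (rule Bochner_Integration.integral_norm_bound_integral)
            show "integrable lborel (\<lambda>x. indicator \<Omega> x *\<^sub>R (\<psi> x * (gradient (U i) x \<bullet> b) - \<psi>' x * (gradient (U i) x \<bullet> b)))"
              using set_integral_diff(1)[OF r1(2) r2(2)] by (simp add: set_integrable_def)
            show "integrable lborel (\<lambda>x. d * (indicator \<Omega> x *\<^sub>R norm (gradient (U i) x)))"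
              using set_integrable_norm[OF U(3)[of i]] by (simp add: set_integrable_def)
            show "norm (indicator \<Omega> x *\<^sub>R (\<psi> x * (gradient (U i) x \<bullet> b) - \<psi>' x * (gradient (U i) x \<bullet> b)))
              \<le> d * (indicator \<Omega> x *\<^sub>R norm (gradient (U i) x))" for x
            proof (cases "x \<in> \<Omega>")
              case True
              have "\<bar>gradient (U i) x \<bullet> b\<bar> \<le> norm (gradient (U i) x)"
                using b by (rule Basis_le_norm)
              then have "\<bar>\<psi> x - \<psi>' x\<bar> * \<bar>gradient (U i) x \<bullet> b\<bar> \<le> d * norm (gradient (U i) x)"
                using \<psi>'(2)[OF True] d by (intro mult_mono) auto
              then show ?thesis using True by (simp add: abs_mult flip: left_diff_distrib)
            qed simp
          qed
          also have "\<dots> = d * (LINT x:\<Omega>|lborel. norm (gradient (U i) x))"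
            by (simp add: set_lebesgue_integral_def)
          also have "\<dots> \<le> d * C" using C d by (intro mult_left_mono) auto
          finally show ?thesis .
        qed
        have "(\<lambda>i. signed_integral \<Omega> (\<lambda>E. ?\<mu> i E \<bullet> b) \<psi>') \<longlonglongrightarrow> signed_integral \<Omega> (\<lambda>E. \<mu> E \<bullet> b) \<psi>'"
          using tendsto_inner[OF test[OF \<psi>'(1)] tendsto_const[of b]] by (simp add: vector_integral_inner[OF b])
        then obtain N where N: "\<And>i. i \<ge> N \<Longrightarrow>
            norm (signed_integral \<Omega> (\<lambda>E. ?\<mu> i E \<bullet> b) \<psi>' - signed_integral \<Omega> (\<lambda>E. \<mu> E \<bullet> b) \<psi>') < e / 2"
          using LIMSEQ_D[of _ _ "e / 2"] e by (metis half_gt_zero)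
        show "\<exists>N. \<forall>i\<ge>N. norm (signed_integral \<Omega> (\<lambda>E. ?\<mu> i E \<bullet> b) \<psi> - signed_integral \<Omega> (\<lambda>E. \<mu> E \<bullet> b) \<psi>) < e"
        proof (intro exI[of _ N] allI impI)
          fix i assume "i \<ge> N"
          from N[OF this] 1 2[of i] dCM
          show "norm (signed_integral \<Omega> (\<lambda>E. ?\<mu> i E \<bullet> b) \<psi> - signed_integral \<Omega> (\<lambda>E. \<mu> E \<bullet> b) \<psi>) < e"
            unfolding real_norm_def by linarith
        qed
      qed
    qed
  qed
  moreover have "U i \<in> BV \<Omega>" for i
    using gU[of i] aU[of i] unfolding BV_def by blast
  ultimately show ?thesis
    unfolding weak_star_BV_def using u lim gU \<mu>
    by (intro conjI allI exI[of _ ?\<mu>] exI[of _ \<mu>])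
qed

section \<open>Staircases\<close>

text \<open>The C^1 step from 0 to 1 with 2 t^2 on [0, 1/2] and 1 - 2 (1 - t)^2 on [1/2, 1]. Written
  with positive parts, its derivative \<open>quad_step'\<close> is the hat function of height 2 on
  [0, 1].\<close>

definition quad_step :: "real \<Rightarrow> real" where
  "quad_step t = 2 * ((max 0 t)\<^sup>2 - 2 * (max 0 (t - 1 / 2))\<^sup>2 + (max 0 (t - 1))\<^sup>2)"

definition quad_step' :: "real \<Rightarrow> real" where
  "quad_step' t = 4 * (max 0 t - 2 * max 0 (t - 1 / 2) + max 0 (t - 1))"

lemma has_real_derivative_pos_part_square:
  "((\<lambda>t::real. (max 0 t)\<^sup>2) has_real_derivative 2 * max 0 t) (at t)"
proof (cases t "0::real" rule: linorder_cases)
  case less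
  have "((\<lambda>_. 0) has_real_derivative 2 * max 0 t) (at t)" using less by simp
  then show ?thesis
    by (rule has_field_derivative_transform_within_open[of _ _ _ "{..<0}"]) (use less in auto)
next
  case greater
  have "((\<lambda>t. t\<^sup>2) has_real_derivative 2 * max 0 t) (at t)"
    using greater by (auto intro!: derivative_eq_intros)
  then show ?thesis
    by (rule has_field_derivative_transform_within_open[of _ _ _ "{0<..}"]) (use greater in auto)
next
  case equal
  have "((\<lambda>h::real. max 0 h) \<longlongrightarrow> max 0 0) (at 0)"
    by (intro tendsto_intros)
  moreover have "\<forall>\<^sub>F h in at (0::real). max 0 h = (max 0 h)\<^sup>2 / h"
    by (auto simp: eventually_at_filter max_def power2_eq_square)
  ultimately have "((\<lambda>h::real. (max 0 h)\<^sup>2 / h) \<longlongrightarrow> max 0 0) (at 0)"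
    by (rule Lim_transform_eventually)
  then show ?thesis using equal by (simp add: has_field_derivative_iff)
qed

lemma quad_step_has_derivative:
  "(quad_step has_real_derivative quad_step' t) (at t)"
proof -
  have "((\<lambda>t. (max 0 (t - c))\<^sup>2) has_real_derivative 2 * max 0 (t - c) * 1) (at t)" for c
    by (rule DERIV_chain2[OF has_real_derivative_pos_part_square]) (auto intro!: derivative_eq_intros)
  from DERIV_cmult[OF DERIV_add[OF DERIV_diff[OF this[of 0] DERIV_cmult[OF this[of "1/2"], of 2]] this[of 1]], of 2]
  show ?thesis
    unfolding quad_step_def[abs_def] quad_step'_def by (simp add: algebra_simps)
qed

lemma continuous_on_quad_step': "continuous_on A quad_step'"
  unfolding quad_step'_def by (intro continuous_intros)

lemma quad_step_eq_0: "t \<le> 0 \<Longrightarrow> quad_step t = 0" "t \<le> 0 \<Longrightarrow> quad_step' t = 0"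
  by (auto simp: quad_step_def quad_step'_def)

lemma quad_step_eq_1: "t \<ge> 1 \<Longrightarrow> quad_step t = 1" "t \<ge> 1 \<Longrightarrow> quad_step' t = 0"
  by (auto simp: quad_step_def quad_step'_def power2_eq_square algebra_simps)

lemma quad_step'_bounds: "0 \<le> quad_step' t" "quad_step' t \<le> 2"
  by (auto simp: quad_step'_def max_def)

lemma quad_step_bounds: "0 \<le> quad_step t" "quad_step t \<le> 1"
proof -
  have mono: "quad_step s \<le> quad_step t" if "s \<le> t" for s t
    by (rule DERIV_nonneg_imp_nondecreasing[OF that])
      (use quad_step_has_derivative quad_step'_bounds in blast)
  show "0 \<le> quad_step t"
    using mono[of t 0] mono[of 0 t] quad_step_eq_0(1)[of t] quad_step_eq_0(1)[of 0] by (cases "t \<le> 0") auto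
  show "quad_step t \<le> 1"
    using mono[of t 1] quad_step_eq_1(1)[of t] quad_step_eq_1(1)[of 1] by (cases "t \<ge> 1") auto
qed

text \<open>On each [n, n + 1) the function climbs from n to n + 1 within length 1/M and is then
  flat.\<close>

definition stair :: "real \<Rightarrow> real \<Rightarrow> real" where
  "stair M s = of_int \<lfloor>s\<rfloor> + quad_step (M * frac s)"

definition stair' :: "real \<Rightarrow> real \<Rightarrow> real" where
  "stair' M s = M * quad_step' (M * frac s)"

text \<open>\<open>floor\<close> and \<open>frac\<close> jump at integers, so smoothness there is
  invisible from the definition. On (n - 1, n + 1) the sum of two shifted steps describes the same
  function without a jump; \<open>M \<ge> 1\<close> ensures that the first step is complete before
  the second one begins.\<close>

lemma stair_local:
  assumes "M \<ge> 1" "of_int n - 1 < s" "s < of_int n + 1"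
  shows "stair M s = of_int n - 1 + quad_step (M * (s - of_int n + 1)) + quad_step (M * (s - of_int n))"
    and "stair' M s = M * quad_step' (M * (s - of_int n + 1)) + M * quad_step' (M * (s - of_int n))"
proof -
  have "stair M s = of_int n - 1 + quad_step (M * (s - of_int n + 1)) + quad_step (M * (s - of_int n)) \<and>
    stair' M s = M * quad_step' (M * (s - of_int n + 1)) + M * quad_step' (M * (s - of_int n))"
  proof (cases "s < of_int n")
    case True
    then have f: "\<lfloor>s\<rfloor> = n - 1" using assms by (simp add: floor_eq_iff)
    have "M * (s - of_int n) \<le> 0" using True assms by (simp add: mult_nonneg_nonpos)
    then show ?thesis by (simp add: stair_def stair'_def frac_def f quad_step_eq_0 algebra_simps)
  next
    case False
    then have f: "\<lfloor>s\<rfloor> = n" using assms by (simp add: floor_eq_iff)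
    have "1 * 1 \<le> M * (s - of_int n + 1)" using False assms by (intro mult_mono) auto
    then show ?thesis by (simp add: stair_def stair'_def frac_def f quad_step_eq_1)
  qed
  then show "stair M s = of_int n - 1 + quad_step (M * (s - of_int n + 1)) + quad_step (M * (s - of_int n))"
    "stair' M s = M * quad_step' (M * (s - of_int n + 1)) + M * quad_step' (M * (s - of_int n))" by auto
qed

lemma ex_int_nbhd: obtains n :: int where "of_int n - 1 < (s::real)" "s < of_int n + 1"
proof (rule that[of "\<lfloor>s\<rfloor>"])
  show "of_int \<lfloor>s\<rfloor> - 1 < s" "s < of_int \<lfloor>s\<rfloor> + 1" by linarith+
qed

lemma stair_has_derivative:
  assumes "M \<ge> 1"
  shows "(stair M has_real_derivative stair' M s) (at s)"
proof -
  obtain n :: int where n: "of_int n - 1 < s" "s < of_int n + 1" by (rule ex_int_nbhd)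
  have q: "((\<lambda>s. quad_step (M * (s - c))) has_real_derivative quad_step' (M * (s - c)) * M) (at s)" for c
    by (rule DERIV_chain2[OF quad_step_has_derivative]) (auto intro!: derivative_eq_intros)
  have "((\<lambda>s. of_int n - 1 + quad_step (M * (s - of_int n + 1)) + quad_step (M * (s - of_int n)))
      has_real_derivative stair' M s) (at s)"
    unfolding stair_local(2)[OF assms n]
    using q[of "of_int n - 1"] q[of "of_int n"]
    by (auto intro!: derivative_eq_intros simp: algebra_simps)
  then show ?thesis
    by (rule has_field_derivative_transform_within_open[of _ _ _ "{of_int n - 1<..<of_int n + 1}"])
      (use n assms in \<open>auto simp: stair_local(1)\<close>)
qed

lemma continuous_on_stair':
  assumes "M \<ge> 1"
  shows "continuous_on A (stair' M)"
proof -
  have "isCont (stair' M) s" for s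
  proof -
    obtain n :: int where n: "of_int n - 1 < s" "s < of_int n + 1" by (rule ex_int_nbhd)
    have "continuous_on {of_int n - 1<..<of_int n + 1} (stair' M)"
      by (subst continuous_on_cong[OF refl stair_local(2)[OF assms]])
        (auto intro!: continuous_intros continuous_on_compose2[OF continuous_on_quad_step'[of UNIV]])
    then show ?thesis using n by (simp add: continuous_on_eq_continuous_at)
  qed
  then show ?thesis by (simp add: continuous_at_imp_continuous_on)
qed

lemma stair'_bounds: "M \<ge> 1 \<Longrightarrow> 0 \<le> stair' M s" "M \<ge> 1 \<Longrightarrow> stair' M s \<le> 2 * M"
  using quad_step'_bounds[of "M * frac s"] by (auto simp: stair'_def)

lemma stair'_nonzero: "M \<ge> 1 \<Longrightarrow> stair' M s \<noteq> 0 \<Longrightarrow> 0 < M * frac s \<and> M * frac s < 1"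
  using quad_step_eq_0(2)[of "M * frac s"] quad_step_eq_1(2)[of "M * frac s"]
  by (auto simp: stair'_def not_le[symmetric])

lemma stair_close: "\<bar>stair M s - s\<bar> \<le> 1"
  using quad_step_bounds[of "M * frac s"] frac_ge_0[of s] frac_lt_1[of s]
  unfolding stair_def frac_def by linarith

text \<open>For \<open>M \<ge> 8\<close> the climb ends by 1/8. Shifts in [1/4, 3/4) therefore keep
  a neighbourhood of radius 1/8 around 0 on one plateau.\<close>

lemma stair_plateau:
  assumes "M \<ge> 8" "1 / 8 \<le> s" "s < 1"
  shows "stair M s = 1" "stair' M s = 0"
proof -
  have f: "\<lfloor>s\<rfloor> = 0" using assms by (simp add: floor_eq_iff)
  have "8 * (1 / 8) \<le> M * s" using assms by (intro mult_mono) auto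
  then show "stair M s = 1" "stair' M s = 0"
    by (simp_all add: stair_def stair'_def frac_def f quad_step_eq_1)
qed

text \<open>Modulo 1 the active set lies in the open interval (0, 1/M), while the shifts
  \<open>i / M\<close> are spaced by 1/M. Two distinct shifts less than a full period apart cannot
  both land in it.\<close>

lemma stair'_shift_unique:
  assumes M: "M \<ge> 1" and ij: "i < j" "j < i + M"
    and nz: "stair' (real M) (a + real i / real M) \<noteq> 0" "stair' (real M) (a + real j / real M) \<noteq> 0"
  shows False
proof -
  define f where "f i = real M * frac (a + real i / real M)" for i
  have f: "0 < f i" "f i < 1" "0 < f j" "f j < 1"
    using stair'_nonzero[of "real M"] nz M unfolding f_def by auto
  have e: "real M * a + real l = real M * of_int \<lfloor>a + real l / real M\<rfloor> + f l" for l
    using M by (simp add: f_def frac_def field_simps)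
  define d where "d = \<lfloor>a + real j / real M\<rfloor> - \<lfloor>a + real i / real M\<rfloor>"
  \<comment> \<open>The rescaled fractional parts differ by an integer and both lie in (0, 1), so
    they agree; then \<open>M\<close> divides \<open>j - i\<close>, which lies strictly between 0
    and \<open>M\<close>.\<close>
  have "f j - f i = of_int (int j - int i - int M * d)"
    using e[of i] e[of j] by (simp add: d_def algebra_simps)
  then have "\<bar>real_of_int (int j - int i - int M * d)\<bar> < 1" using f by linarith
  then have "int j - int i - int M * d = 0" by linarith
  then have *: "int j - int i = int M * d" by simp
  then have "0 < int M * d" "int M * d < int M * 1" using ij by linarith+
  then have "0 < d" "d < 1" using M by (simp_all add: zero_less_mult_iff)
  then show False by simp
qed

text \<open>This is where averaging gains: a sum over many shifts is no larger than the bound for a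
  single term, although that term may be of order \<open>M\<close>.\<close>

lemma stair'_shift_at_most_one:
  fixes g :: "nat \<Rightarrow> real"
  assumes M: "M \<ge> 1" and J: "J \<subseteq> {l..<l + M}" and X: "X \<ge> 0"
    and g: "\<And>j. j \<in> J \<Longrightarrow> g j \<le> X" "\<And>j. j \<in> J \<Longrightarrow> stair' (real M) (a + real j / real M) = 0 \<Longrightarrow> g j = 0"
  shows "(\<Sum>j\<in>J. g j) \<le> X"
proof (cases "\<exists>j\<in>J. stair' (real M) (a + real j / real M) \<noteq> 0")
  case True
  then obtain i where i: "i \<in> J" "stair' (real M) (a + real i / real M) \<noteq> 0" by auto
  have "g j = 0" if "j \<in> J - {i}" for j
  proof (rule g(2))
    have "j < i + M" "i < j + M" using that i J by (auto dest!: subsetD[OF J])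
    then show "stair' (real M) (a + real j / real M) = 0"
      using stair'_shift_unique[OF M, of i j a] stair'_shift_unique[OF M, of j i a] i that
      by (metis Diff_iff insertI1 linorder_neqE_nat)
  qed (use that in auto)
  then have "(\<Sum>j\<in>J. g j) = (\<Sum>j\<in>{i}. g j)"
    using i J finite_subset[OF J] by (intro sum.mono_neutral_right) auto
  then show ?thesis using g(1)[OF i(1)] by simp
qed (use g(2) X in auto)

section \<open>Selecting a staircase of small energy\<close>

lemma sublinear_bound:
  fixes \<phi> :: "real \<Rightarrow> real"
  assumes nonneg: "\<And>t. t \<ge> 0 \<Longrightarrow> \<phi> t \<ge> 0" and mono: "mono_on {0..} \<phi>"
    and sublinear: "((\<lambda>t. \<phi> t / t) \<longlongrightarrow> 0) at_top" and e: "e > 0"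
  obtains C where "C \<ge> 0" "\<And>t. t \<ge> 0 \<Longrightarrow> \<phi> t \<le> C + e * t"
proof -
  have "eventually (\<lambda>t. \<phi> t / t < e) at_top"
    using order_tendstoD(2)[OF sublinear e] .
  then obtain T0 where T0: "\<And>t. t \<ge> T0 \<Longrightarrow> \<phi> t / t < e" by (auto simp: eventually_at_top_linorder)
  \<comment> \<open>The lower bound 1 keeps \<open>t\<close> positive beyond \<open>T\<close>, so
    that the quotient can be cleared. Below \<open>T\<close> monotonicity gives the constant
    \<open>\<phi> T\<close>.\<close>
  define T where "T = max T0 1"
  show thesis
  proof (rule that[of "\<phi> T"])
    show "\<phi> T \<ge> 0" using nonneg by (simp add: T_def)
    fix t :: real assume t: "t \<ge> 0"
    show "\<phi> t \<le> \<phi> T + e * t"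
    proof (cases "t \<ge> T")
      case True
      then have "t > 0" "\<phi> t / t < e" using T0[of t] by (auto simp: T_def)
      then have "\<phi> t \<le> e * t" by (simp add: field_simps)
      then show ?thesis using \<open>\<phi> T \<ge> 0\<close> by simp
    next
      case False
      then have "\<phi> t \<le> \<phi> T" using t by (intro mono_onD[OF mono]) auto
      then show ?thesis using t e by (simp add: add_increasing2)
    qed
  qed
qed

lemma gradient_comp_real:
  fixes v :: "'a::euclidean_space \<Rightarrow> real"
  assumes "(f has_real_derivative f') (at (v x))" "v differentiable (at x)"
  shows "((\<lambda>x. f (v x)) has_derivative (\<bullet>) (f' *\<^sub>R gradient v x)) (at x)"
    and "gradient (\<lambda>x. f (v x)) x = f' *\<^sub>R gradient v x"
proof -
  show "((\<lambda>x. f (v x)) has_derivative (\<bullet>) (f' *\<^sub>R gradient v x)) (at x)"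
    by (rule has_derivative_eq_rhs[OF DERIV_compose_FDERIV[OF assms(1) has_derivative_gradient[OF assms(2)]]])
      (simp add: fun_eq_iff)
  then show "gradient (\<lambda>x. f (v x)) x = f' *\<^sub>R gradient v x" by (rule gradient_eqI)
qed

lemma set_nn_integral_eq_set_integral:
  fixes f :: "'a::euclidean_space \<Rightarrow> real"
  assumes "set_integrable lborel \<Omega> f" "\<And>x. x \<in> \<Omega> \<Longrightarrow> f x \<ge> 0"
  shows "(\<integral>\<^sup>+x\<in>\<Omega>. ennreal (f x) \<partial>lborel) = ennreal (LINT x:\<Omega>|lborel. f x)"
proof -
  have "(\<integral>\<^sup>+x\<in>\<Omega>. ennreal (f x) \<partial>lborel) = (\<integral>\<^sup>+x. ennreal (indicator \<Omega> x *\<^sub>R f x) \<partial>lborel)"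
    by (intro nn_integral_cong) (simp split: split_indicator)
  also have "\<dots> = ennreal (LINT x:\<Omega>|lborel. f x)"
    unfolding set_lebesgue_integral_def using assms
    by (intro nn_integral_eq_integral) (auto simp: set_integrable_def split: split_indicator)
  finally show ?thesis .
qed

lemma set_integrable_continuousI:
  fixes f :: "'a::euclidean_space \<Rightarrow> 'b::euclidean_space"
  assumes "open \<Omega>" "continuous_on \<Omega> f" "(\<integral>\<^sup>+x\<in>\<Omega>. ennreal (norm (f x)) \<partial>lborel) \<le> ennreal C"
  shows "set_integrable lborel \<Omega> f"
  unfolding set_integrable_def
proof (rule integrableI_bounded)
  show "(\<lambda>x. indicator \<Omega> x *\<^sub>R f x) \<in> borel_measurable lborel"
    using borel_measurable_continuous_on_indicator[OF _ assms(2)] assms(1) by simp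
  have "(\<integral>\<^sup>+x. ennreal (norm (indicator \<Omega> x *\<^sub>R f x)) \<partial>lborel) = (\<integral>\<^sup>+x\<in>\<Omega>. ennreal (norm (f x)) \<partial>lborel)"
    by (intro nn_integral_cong) (simp split: split_indicator)
  also have "\<dots> < \<infinity>" using assms(3) by (metis ennreal_less_top infinity_ennreal_def order_le_less_trans)
  finally show "(\<integral>\<^sup>+x. ennreal (norm (indicator \<Omega> x *\<^sub>R f x)) \<partial>lborel) < \<infinity>" .
qed

lemma TV_smooth_lborel:
  assumes "open \<Omega>" "continuous_on \<Omega> (\<lambda>x. \<phi> (norm (gradient u x)))"
  shows "TV_smooth \<phi> \<Omega> u = (\<integral>\<^sup>+x\<in>\<Omega>. ennreal (\<phi> (norm (gradient u x))) \<partial>lborel)"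
proof -
  have "(\<integral>\<^sup>+x\<in>\<Omega>. ennreal (\<phi> (norm (gradient u x))) \<partial>lebesgue) =
      (\<integral>\<^sup>+x. ennreal (indicator \<Omega> x *\<^sub>R \<phi> (norm (gradient u x))) \<partial>lebesgue)"
    by (intro nn_integral_cong) (simp split: split_indicator)
  also have "\<dots> = (\<integral>\<^sup>+x. ennreal (indicator \<Omega> x *\<^sub>R \<phi> (norm (gradient u x))) \<partial>lborel)"
    by (rule nn_integral_completion)
  also have "\<dots> = (\<integral>\<^sup>+x\<in>\<Omega>. ennreal (\<phi> (norm (gradient u x))) \<partial>lborel)"
    by (intro nn_integral_cong) (simp split: split_indicator)
  finally show ?thesis by (simp add: TV_smooth_def)
qed

text \<open>The candidates are staircases of height 1/k composed with \<open>v\<close>, one for each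
  of 2N shifts. Refining \<open>k\<close> gives L1 closeness, and enlarging \<open>M\<close> only
  afterwards gives small energy. The variation bound involves neither parameter, so it survives the
  limit.\<close>

proposition staircase_approximation:
  fixes v :: "'a::euclidean_space \<Rightarrow> real"
  assumes nonneg: "\<And>t. t \<ge> 0 \<Longrightarrow> \<phi> t \<ge> 0" and zero: "\<phi> 0 = 0" and mono: "mono_on {0..} \<phi>"
    and cont: "continuous_on {0..} \<phi>" and sublinear: "((\<lambda>t. \<phi> t / t) \<longlongrightarrow> 0) at_top"
    and \<Omega>: "open \<Omega>" and v: "Ck_on 1 \<Omega> v" "set_integrable lborel \<Omega> v"
      "set_integrable lborel \<Omega> (gradient v)"
    and e: "e > 0"
  obtains w where "Ck_on 1 \<Omega> w" "set_integrable lborel \<Omega> w" "set_integrable lborel \<Omega> (gradient w)"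
    "(LINT x:\<Omega>|lborel. \<bar>w x - v x\<bar>) \<le> e"
    "(LINT x:\<Omega>|lborel. norm (gradient w x)) \<le> 16 * (LINT x:\<Omega>|lborel. norm (gradient v x)) + 1"
    "TV_smooth \<phi> \<Omega> w \<le> ennreal e"
proof -
  have dv: "v differentiable (at x)" if "x \<in> \<Omega>" for x using v(1) that by (auto simp only: Ck_on_1_iff)
  have gv: "continuous_on \<Omega> (gradient v)" using v(1) by (auto simp only: Ck_on_1_iff)
  have cv: "continuous_on \<Omega> v"
    by (simp add: continuous_at_imp_continuous_on dv differentiable_imp_continuous_within)
  define I where "I = (LINT x:\<Omega>|lborel. norm (gradient v x))"
  define V where "V = (LINT x:\<Omega>|lborel. \<bar>v x\<bar>)"
  have I0: "I \<ge> 0" and V0: "V \<ge> 0"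
    unfolding I_def V_def set_lebesgue_integral_def by (auto intro!: integral_nonneg_AE)
  define \<beta> where "\<beta> = 16 * I + 1"
  have \<beta>: "\<beta> \<ge> 1" using I0 by (simp add: \<beta>_def)

  \<comment> \<open>An integrable majorant of \<open>\<bar>w - v\<bar>\<close>. The first bound
    comes from using \<open>stair_close\<close> twice. The second holds because \<open>w\<close>
    vanishes where \<open>k * \<bar>v\<bar> < 1 / 8\<close>, and elsewhere
    \<open>2 / k \<le> 16 * \<bar>v\<bar>\<close>. It permits dominated convergence when
    \<open>\<Omega>\<close> has infinite measure.\<close>
  define h where "h k x = min (2 / real (Suc k)) (16 * \<bar>v x\<bar>)" for k x
  have h_int: "set_integrable lborel \<Omega> (h k)" for k
  proof -
    have "continuous_on \<Omega> (h k)" unfolding h_def by (intro continuous_intros cv)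
    then have m: "(\<lambda>x. indicator \<Omega> x *\<^sub>R h k x) \<in> borel_measurable lborel"
      using borel_measurable_continuous_on_indicator[of \<Omega> "h k"] \<Omega> by simp
    have b: "AE x in lborel. norm (indicator \<Omega> x *\<^sub>R h k x) \<le> norm (16 * (indicator \<Omega> x *\<^sub>R v x))"
      by (intro AE_I2) (auto simp: h_def abs_mult split: split_indicator)
    have i: "integrable lborel (\<lambda>x. 16 * (indicator \<Omega> x *\<^sub>R v x))"
      using v(2) unfolding set_integrable_def by (rule integrable_mult_right)
    show ?thesis
      unfolding set_integrable_def by (rule Bochner_Integration.integrable_bound[OF i m b])
  qed
  have "(\<lambda>k. LINT x:\<Omega>|lborel. h k x) \<longlonglongrightarrow> (LINT x|(lborel::'a measure). 0)"
    unfolding set_lebesgue_integral_def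
  proof (rule integral_dominated_convergence[where w = "\<lambda>x. 16 * (indicator \<Omega> x *\<^sub>R \<bar>v x\<bar>)"])
    show "integrable lborel (\<lambda>x. 16 * (indicator \<Omega> x *\<^sub>R \<bar>v x\<bar>))"
      using set_integrable_abs[OF v(2)] by (simp add: set_integrable_def)
    show "(\<lambda>x. indicator \<Omega> x *\<^sub>R h k x) \<in> borel_measurable lborel" for k
      using h_int[of k] by (auto simp: set_integrable_def)
    show "AE x in lborel. norm (indicator \<Omega> x *\<^sub>R h k x) \<le> 16 * (indicator \<Omega> x *\<^sub>R \<bar>v x\<bar>)" for k
      by (intro AE_I2) (auto simp: h_def split: split_indicator)
    show "AE x in lborel. (\<lambda>k. indicator \<Omega> x *\<^sub>R h k x) \<longlonglongrightarrow> 0"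
    proof (rule AE_I2)
      fix x
      have "(\<lambda>k. 2 * inverse (real (Suc k))) \<longlonglongrightarrow> 2 * 0"
        by (intro tendsto_intros LIMSEQ_inverse_real_of_nat)
      then have "(\<lambda>k. h k x) \<longlonglongrightarrow> min 0 (16 * \<bar>v x\<bar>)"
        unfolding h_def by (intro tendsto_min tendsto_const) (simp add: divide_inverse)
      then show "(\<lambda>k. indicator \<Omega> x *\<^sub>R h k x) \<longlonglongrightarrow> 0"
        by (auto split: split_indicator)
    qed
  qed auto
  then have "eventually (\<lambda>k. (LINT x:\<Omega>|lborel. h k x) < e) sequentially"
    using e by (intro order_tendstoD) simp
  then obtain k0 where k0: "(LINT x:\<Omega>|lborel. h k0 x) < e" by (auto simp: eventually_sequentially)
  define k where "k = real (Suc k0)"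
  have k: "k \<ge> 1" by (simp add: k_def)

  \<comment> \<open>With this slope \<open>e' / e = 1 / \<beta>\<close>, so the linear part of the
    energy and the variation contribute equally to \<open>F\<close>.\<close>
  define e' where "e' = e / \<beta>"
  have e': "e' > 0" using e \<beta> by (simp add: e'_def)
  obtain C where C: "C \<ge> 0" "\<And>t. t \<ge> 0 \<Longrightarrow> \<phi> t \<le> C + e' * t"
    using sublinear_bound[OF nonneg mono sublinear e'] by blast
  obtain N0 :: nat where N0: "8 * k * C * V / e \<le> real N0" using real_arch_simple by blast
  \<comment> \<open>The summand 2 guarantees \<open>M \<ge> 8\<close>, as the plateaus require;
    \<open>N0\<close> is large enough for the constant part of the energy to integrate to at most
    \<open>N\<close>.\<close>
  define N where "N = N0 + 2"
  define M where "M = 4 * N"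
  \<comment> \<open>The middle half of one period: 2N = M/2 shifts with \<open>\<theta>\<close> in
    [1/4, 3/4), safely away from the climbs near the integers.\<close>
  define J where "J = {N..<3 * N}"
  have N: "N \<ge> 2" "8 * k * C * V / e \<le> real N" using N0 by (auto simp: N_def)
  have M: "real M \<ge> 8" "M \<ge> 1" "real M = 4 * real N" "real M \<ge> 1" using N by (auto simp: M_def)
  define \<theta> where "\<theta> j = real j / real M" for j
  have \<theta>: "1 / 4 \<le> \<theta> j" "\<theta> j < 3 / 4" if "j \<in> J" for j
    using that M N by (auto simp: \<theta>_def J_def field_simps)
  define s where "s j x = stair' M (k * v x + \<theta> j)" for j x
  have s_bounds: "0 \<le> s j x" "s j x \<le> 2 * M" for j x
    using stair'_bounds[of M] M by (auto simp: s_def)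
  have s_cont: "continuous_on \<Omega> (s j)" for j
    unfolding s_def
    by (intro continuous_on_compose2[OF continuous_on_stair'[of M UNIV]] continuous_intros cv) (use M in auto)
  \<comment> \<open>Subtracting the value at \<open>v = 0\<close> makes \<open>w\<close> vanish
    where \<open>v\<close> is small, which keeps it integrable on sets of infinite measure.\<close>
  define w where "w j x = (stair M (k * v x + \<theta> j) - stair M (\<theta> j)) / k" for j x
  have "((\<lambda>y. (stair M (k * y + \<theta> j) - stair M (\<theta> j)) / k) has_real_derivative s j x) (at (v x))" for j x
  proof -
    have "((\<lambda>y. stair M (k * y + \<theta> j)) has_real_derivative s j x * k) (at (v x))"
      unfolding s_def by (rule DERIV_chain2[OF stair_has_derivative]) (use M in \<open>auto intro!: derivative_eq_intros\<close>)
    then show ?thesis using k by (auto intro!: derivative_eq_intros)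
  qed
  note w_deriv = gradient_comp_real[OF this dv, folded w_def]
  have dw: "w j differentiable (at x)" and gw: "gradient (w j) x = s j x *\<^sub>R gradient v x" if "x \<in> \<Omega>" for j x
    using w_deriv[OF that] that by (auto simp: differentiable_def)
  have cgw: "continuous_on \<Omega> (gradient (w j))" for j
    by (subst continuous_on_cong[OF refl gw]) (auto intro!: continuous_intros s_cont gv)
  have w_C1: "Ck_on 1 \<Omega> (w j)" for j
    unfolding Ck_on_1_iff using dw cgw by auto
  have plateau: "w j x = 0" "s j x = 0" if "j \<in> J" "\<bar>k * v x\<bar> < 1 / 8" for j x
    using stair_plateau[of M "k * v x + \<theta> j"] stair_plateau[of M "\<theta> j"] \<theta>[OF that(1)] that M
    by (auto simp: w_def s_def)
  have w_close: "\<bar>w j x - v x\<bar> \<le> h k0 x" if j: "j \<in> J" for j x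
  proof -
    have kw: "k * w j x = stair M (k * v x + \<theta> j) - stair M (\<theta> j)" using k by (simp add: w_def)
    have "\<bar>k * w j x - k * v x\<bar> \<le> 2"
      unfolding kw using stair_close[of M "k * v x + \<theta> j"] stair_close[of M "\<theta> j"] by linarith
    then have "k * \<bar>w j x - v x\<bar> \<le> 2" using k by (simp add: abs_mult flip: right_diff_distrib)
    then have 1: "\<bar>w j x - v x\<bar> \<le> 2 / k" using k by (simp add: field_simps)
    have 2: "\<bar>w j x - v x\<bar> \<le> 16 * \<bar>v x\<bar>"
    proof (cases "\<bar>k * v x\<bar> < 1 / 8")
      case True
      then show ?thesis using plateau[OF j] by simp
    next
      case False
      then have "2 / k \<le> 16 * \<bar>v x\<bar>" using k by (simp add: abs_mult field_simps)
      then show ?thesis using 1 by linarith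
    qed
    show ?thesis using 1 2 by (simp add: h_def k_def)
  qed

  \<comment> \<open>If the integral of \<open>F j\<close> is at most 1, each of its nonnegative
    summands is too. This yields energy at most \<open>e\<close> and variation at most
    \<open>\<beta>\<close> for the same \<open>j\<close>.\<close>
  define F where "F j x = \<phi> (norm (gradient (w j) x)) / e + norm (gradient (w j) x) / \<beta>" for j x
  have F0: "F j x \<ge> 0" for j x using nonneg e \<beta> by (simp add: F_def)
  have c\<phi>: "continuous_on \<Omega> (\<lambda>x. \<phi> (norm (gradient (w j) x)))" for j
    by (rule continuous_on_compose2[OF cont]) (auto intro!: continuous_intros cgw)
  have Fm: "(\<lambda>x. ennreal (F j x) * indicator \<Omega> x) \<in> borel_measurable lborel" for j
  proof -
    have "continuous_on \<Omega> (F j)"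
      unfolding F_def using e \<beta> by (intro continuous_intros cgw c\<phi>) auto
    then have "(\<lambda>x. indicator \<Omega> x *\<^sub>R F j x) \<in> borel_measurable borel"
      by (rule borel_measurable_continuous_on_indicator[OF borel_open[OF \<Omega>]])
    then have "(\<lambda>x. ennreal (indicator \<Omega> x *\<^sub>R F j x)) \<in> borel_measurable lborel"
      by simp
    also have "(\<lambda>x. ennreal (indicator \<Omega> x *\<^sub>R F j x)) = (\<lambda>x. ennreal (F j x) * indicator \<Omega> x)"
      by (auto split: split_indicator)
    finally show ?thesis .
  qed
  \<comment> \<open>A bound for one active term. Off the plateau
    \<open>1 \<le> 8 * k * \<bar>v x\<bar>\<close>, so the constant \<open>C\<close> is replaced by
    an integrable function; the slope of the staircase contributes the factor
    \<open>2 * M\<close>.\<close>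
  define H where "H x = (8 * k * C / e) * \<bar>v x\<bar> + (2 * (e' / e + 1 / \<beta>) * M) * norm (gradient v x)" for x
  have H0: "H x \<ge> 0" for x using k C e e' \<beta> by (auto simp: H_def intro!: add_nonneg_nonneg mult_nonneg_nonneg)
  have sumF: "(\<Sum>j\<in>J. F j x) \<le> H x" if x: "x \<in> \<Omega>" for x
  proof (rule stair'_shift_at_most_one[OF M(2)])
    show "J \<subseteq> {N..<N + M}" by (auto simp: J_def M_def)
    show "H x \<ge> 0" by (rule H0)
    fix j assume j: "j \<in> J"
    show z: "F j x = 0" if "stair' M (k * v x + real j / real M) = 0"
      using that by (simp add: F_def gw[OF x] s_def \<theta>_def zero)
    show "F j x \<le> H x"
    proof (cases "\<bar>k * v x\<bar> < 1 / 8")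
      case True
      then have "F j x = 0" using plateau[OF j True] by (simp add: F_def gw[OF x] zero)
      then show ?thesis using H0 by simp
    next
      case False
      let ?t = "norm (gradient v x)"
      have n: "norm (gradient (w j) x) \<le> 2 * M * ?t"
        using s_bounds[of j x] by (simp add: gw[OF x] mult_right_mono)
      have "1 \<le> 8 * k * \<bar>v x\<bar>" using False k by (simp add: abs_mult)
      then have "C * 1 \<le> C * (8 * k * \<bar>v x\<bar>)" using C by (intro mult_left_mono)
      moreover have "\<phi> (norm (gradient (w j) x)) \<le> C + e' * norm (gradient (w j) x)"
        by (rule C) simp
      moreover have "e' * norm (gradient (w j) x) \<le> e' * (2 * M * ?t)" using n e' by (intro mult_left_mono) auto
      ultimately have "\<phi> (norm (gradient (w j) x)) \<le> C * (8 * k * \<bar>v x\<bar>) + e' * (2 * M * ?t)" by linarith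
      then have "F j x \<le> (C * (8 * k * \<bar>v x\<bar>) + e' * (2 * M * ?t)) / e + (2 * M * ?t) / \<beta>"
        unfolding F_def using n e \<beta> by (intro add_mono divide_right_mono) auto
      also have "\<dots> = H x" by (simp add: H_def algebra_simps add_divide_distrib)
      finally show ?thesis .
    qed
  qed
  have H_int: "set_integrable lborel \<Omega> H"
    unfolding H_def using v by (intro set_integral_add set_integrable_mult_right set_integrable_abs set_integrable_norm) auto
  have "(LINT x:\<Omega>|lborel. H x) = (8 * k * C / e) * V + (2 * (e' / e + 1 / \<beta>) * M) * I"
    unfolding H_def V_def I_def using v
    by (subst set_integral_add(2)) (auto intro!: set_integrable_mult_right set_integrable_abs set_integrable_norm)
  \<comment> \<open>The first summand is at most \<open>N\<close> by the choice of
    \<open>N0\<close>. In the second, \<open>M = 4 * N\<close> gives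
    \<open>N * (16 * I / \<beta>)\<close>, below \<open>N\<close> because
    \<open>\<beta> = 16 * I + 1\<close>. This is the origin of the constant 16.\<close>
  also have "\<dots> < real N + real N"
  proof (rule add_le_less_mono)
    show "8 * k * C / e * V \<le> real N" using N by simp
    have "e' / e = 1 / \<beta>" using e by (simp add: e'_def)
    then have "2 * (e' / e + 1 / \<beta>) * M * I = N * (16 * I / \<beta>)" using M by (simp add: field_simps)
    also have "\<dots> < real N * 1"
      using \<beta> I0 N by (intro mult_strict_left_mono) (auto simp: \<beta>_def field_simps)
    finally show "2 * (e' / e + 1 / \<beta>) * M * I < N" by simp
  qed
  finally have HN: "(LINT x:\<Omega>|lborel. H x) < 2 * N" by simp
  \<comment> \<open>Pigeonhole: there are 2N shifts, and the integrals of \<open>F j\<close> sum to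
    less than 2N.\<close>
  have "\<exists>j\<in>J. (\<integral>\<^sup>+x\<in>\<Omega>. ennreal (F j x) \<partial>lborel) \<le> 1"
  proof (rule ccontr)
    assume "\<not> ?thesis"
    then have gt: "1 < (\<integral>\<^sup>+x\<in>\<Omega>. ennreal (F j x) \<partial>lborel)" if "j \<in> J" for j using that by (auto simp: not_le)
    have "ennreal (2 * N) = (\<Sum>j\<in>J. 1)" using N by (simp add: J_def ennreal_of_nat_eq_real_of_nat)
    also have "\<dots> \<le> (\<Sum>j\<in>J. \<integral>\<^sup>+x\<in>\<Omega>. ennreal (F j x) \<partial>lborel)"
      using gt by (intro sum_mono less_imp_le)
    also have "\<dots> = (\<integral>\<^sup>+x. (\<Sum>j\<in>J. ennreal (F j x) * indicator \<Omega> x) \<partial>lborel)"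
      by (rule nn_integral_sum[symmetric]) (rule Fm)
    also have "\<dots> \<le> (\<integral>\<^sup>+x\<in>\<Omega>. ennreal (H x) \<partial>lborel)"
    proof (intro nn_integral_mono)
      fix x show "(\<Sum>j\<in>J. ennreal (F j x) * indicator \<Omega> x) \<le> ennreal (H x) * indicator \<Omega> x"
        using sumF[of x] F0 by (auto split: split_indicator simp: sum_ennreal intro: ennreal_leI)
    qed
    also have "\<dots> = ennreal (LINT x:\<Omega>|lborel. H x)"
      by (rule set_nn_integral_eq_set_integral[OF H_int H0])
    also have "\<dots> < ennreal (2 * N)" using HN N by (intro ennreal_lessI) auto
    finally show False by simp
  qed
  then obtain j where j: "j \<in> J" and Fj: "(\<integral>\<^sup>+x\<in>\<Omega>. ennreal (F j x) \<partial>lborel) \<le> 1" by auto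
  have part: "(\<integral>\<^sup>+x\<in>\<Omega>. ennreal (f x) \<partial>lborel) \<le> ennreal c"
    if f: "\<And>x. f x / c \<le> F j x" "continuous_on \<Omega> f" "c > 0" for f c
  proof -
    have "continuous_on \<Omega> (\<lambda>x. f x / c)" using f by (intro continuous_intros) auto
    then have "(\<lambda>x. indicator \<Omega> x *\<^sub>R (f x / c)) \<in> borel_measurable borel"
      by (rule borel_measurable_continuous_on_indicator[OF borel_open[OF \<Omega>]])
    then have fm: "(\<lambda>x. ennreal (indicator \<Omega> x *\<^sub>R (f x / c))) \<in> borel_measurable lborel"
      by simp
    have "(\<integral>\<^sup>+x\<in>\<Omega>. ennreal (f x) \<partial>lborel) = (\<integral>\<^sup>+x. ennreal c * ennreal (indicator \<Omega> x *\<^sub>R (f x / c)) \<partial>lborel)"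
      using f(3) by (intro nn_integral_cong) (auto split: split_indicator simp flip: ennreal_mult')
    also have "\<dots> = ennreal c * (\<integral>\<^sup>+x. ennreal (indicator \<Omega> x *\<^sub>R (f x / c)) \<partial>lborel)"
      using fm by (rule nn_integral_cmult)
    also have "\<dots> \<le> ennreal c * (\<integral>\<^sup>+x\<in>\<Omega>. ennreal (F j x) \<partial>lborel)"
      using f(1) by (intro mult_left_mono nn_integral_mono) (auto split: split_indicator intro: ennreal_leI)
    also have "\<dots> \<le> ennreal c * 1" using Fj by (intro mult_left_mono) auto
    finally show ?thesis by simp
  qed
  have TV: "TV_smooth \<phi> \<Omega> (w j) \<le> ennreal e"
    unfolding TV_smooth_lborel[OF \<Omega> c\<phi>] using e \<beta> by (intro part c\<phi>) (auto simp: F_def)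
  have G: "(\<integral>\<^sup>+x\<in>\<Omega>. ennreal (norm (gradient (w j) x)) \<partial>lborel) \<le> ennreal \<beta>"
    using e \<beta> nonneg by (intro part continuous_intros cgw) (auto simp: F_def)
  have giw: "set_integrable lborel \<Omega> (gradient (w j))"
    by (rule set_integrable_continuousI[OF \<Omega> cgw G])
  have cw: "continuous_on \<Omega> (w j)"
    by (simp add: continuous_at_imp_continuous_on dw differentiable_imp_continuous_within)
  have "set_integrable lborel \<Omega> (\<lambda>x. w j x - v x)"
    unfolding set_integrable_def
  proof (rule Bochner_Integration.integrable_bound)
    show "integrable lborel (\<lambda>x. indicator \<Omega> x *\<^sub>R h k0 x)" using h_int by (simp add: set_integrable_def)
    show "(\<lambda>x. indicator \<Omega> x *\<^sub>R (w j x - v x)) \<in> borel_measurable lborel"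
      using borel_measurable_continuous_on_indicator[of \<Omega> "\<lambda>x. w j x - v x"] \<Omega>
      by (auto intro!: continuous_intros cv cw)
    show "AE x in lborel. norm (indicator \<Omega> x *\<^sub>R (w j x - v x)) \<le> norm (indicator \<Omega> x *\<^sub>R h k0 x)"
      using w_close[OF j] by (intro AE_I2) (auto split: split_indicator intro: order_trans[OF _ abs_ge_self])
  qed
  note d = this
  have wi: "set_integrable lborel \<Omega> (w j)"
    using set_integral_add(1)[OF d v(2)] by simp
  have "(LINT x:\<Omega>|lborel. \<bar>w j x - v x\<bar>) \<le> (LINT x:\<Omega>|lborel. h k0 x)"
    using w_close[OF j] by (intro set_integral_mono set_integrable_abs d h_int) auto
  then have close: "(LINT x:\<Omega>|lborel. \<bar>w j x - v x\<bar>) \<le> e" using k0 by simp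
  have "ennreal (LINT x:\<Omega>|lborel. norm (gradient (w j) x)) \<le> ennreal \<beta>"
    using G set_nn_integral_eq_set_integral[OF set_integrable_norm[OF giw]] by simp
  then have "(LINT x:\<Omega>|lborel. norm (gradient (w j) x)) \<le> \<beta>"
    using \<beta> by (subst (asm) ennreal_le_iff) auto
  then show thesis
    using that[OF w_C1 wi giw close _ TV] by (simp add: I_def \<beta>_def)
qed

section \<open>Mollification with variable scale\<close>

lemma has_derivative_affine_gradient:
  fixes \<rho> :: "'a::euclidean_space \<Rightarrow> real"
  assumes "\<rho> differentiable (at (s *\<^sub>R (x - q)))"
  shows "((\<lambda>x. c * \<rho> (s *\<^sub>R (x - q))) has_derivative (\<bullet>) ((c * s) *\<^sub>R gradient \<rho> (s *\<^sub>R (x - q)))) (at x)"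
proof -
  have "((\<lambda>x. s *\<^sub>R (x - q)) has_derivative (\<lambda>h. s *\<^sub>R (h - 0))) (at x)"
    by (intro derivative_intros)
  from has_derivative_compose[OF this has_derivative_gradient[OF assms]]
  have "((\<lambda>x. c * \<rho> (s *\<^sub>R (x - q))) has_derivative (\<lambda>h. c * (gradient \<rho> (s *\<^sub>R (x - q)) \<bullet> s *\<^sub>R (h - 0)))) (at x)"
    by (rule has_derivative_mult_right)
  then show ?thesis by (rule has_derivative_eq_rhs) (simp add: fun_eq_iff)
qed

lemma C1_compact_bump: "C1_compact (bump :: 'a::euclidean_space \<Rightarrow> real) (cball 0 1)"
proof
  have "Ck_on 1 UNIV (bump :: 'a \<Rightarrow> real)" by (rule Ck_on_bump)
  then show "(bump :: 'a \<Rightarrow> real) differentiable (at x)" "continuous_on UNIV (gradient (bump :: 'a \<Rightarrow> real))" for x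
    by (auto simp only: Ck_on_1_iff UNIV_I)
qed (auto simp: bump_eq_0)

lemma bump_le_1: "bump x \<le> 1"
  by (simp add: bump_def bump_deriv_def)

lemma mollifier_exists:
  obtains \<eta> :: "'a::euclidean_space \<Rightarrow> real" and H where
    "\<And>k. Ck_on k UNIV \<eta>" "\<And>x. \<eta> x \<ge> 0" "\<And>x. norm x \<ge> 1 \<Longrightarrow> \<eta> x = 0"
    "(LINT x|lborel. \<eta> x) = 1" "\<And>x. \<eta> x \<le> H" "\<And>x. norm (gradient \<eta> x) \<le> H"
proof -
  interpret bump: C1_compact "bump :: 'a \<Rightarrow> real" "cball 0 1" by (rule C1_compact_bump)
  obtain G where G: "G > 0" "\<And>x::'a. norm (gradient bump x) \<le> G" using bump.bounded_gradient by blast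
  define c where "c = (LINT x|(lborel :: 'a measure). bump x)"
  have int: "integrable lborel (bump :: 'a \<Rightarrow> real)"
  proof -
    have "integrable lborel (\<lambda>x::'a. indicator (cball 0 1) x *\<^sub>R bump x)"
      by (intro borel_integrable_compact continuous_on_subset[OF bump.cont]) auto
    also have "(\<lambda>x::'a. indicator (cball 0 1) x *\<^sub>R bump x) = bump"
      by (auto simp: fun_eq_iff bump_eq_0 split: split_indicator)
    finally show ?thesis .
  qed
  have c: "c > 0"
  proof -
    have "c \<noteq> 0"
    proof
      assume "c = 0"
      then have "AE x in (lborel :: 'a measure). bump x = (0::real)"
        using integral_nonneg_eq_0_iff_AE[OF int AE_I2[OF bump_nonneg]] c_def by metis
      then have "AE x in (lborel :: 'a measure). x \<notin> ball 0 1"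
        by eventually_elim (use bump_pos in force)
      then have "emeasure lborel (ball (0::'a) 1) = 0"
        using AE_iff_null_sets[of "ball (0::'a) 1" lborel] by auto
      then show False using content_ball_pos[of 1 "0::'a"] by (simp add: measure_def)
    qed
    moreover have "c \<ge> 0" unfolding c_def by (intro integral_nonneg_AE AE_I2 bump_nonneg)
    ultimately show ?thesis by simp
  qed
  show thesis
  proof (rule that[of "\<lambda>x. (1 / c) * bump x" "max (1 / c) (G / c)"])
    show "Ck_on k UNIV (\<lambda>x::'a. 1 / c * bump x)" for k by (intro Ck_on_mult Ck_on_const Ck_on_bump)
    show "0 \<le> 1 / c * bump x" for x :: 'a using c bump_nonneg[of x] by simp
    show "1 \<le> norm x \<Longrightarrow> 1 / c * bump x = 0" for x :: 'a by (simp add: bump_eq_0)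
    show "(LINT x|(lborel :: 'a measure). 1 / c * bump x) = 1" using c c_def by simp
    show "1 / c * bump x \<le> max (1 / c) (G / c)" for x :: 'a
      using c bump_le_1[of x] by (intro max.coboundedI1) (simp add: divide_right_mono)
    show "norm (gradient (\<lambda>x. 1 / c * bump x) x) \<le> max (1 / c) (G / c)" for x :: 'a
    proof -
      have "gradient (\<lambda>x. 1 / c * bump x) x = (1 / c) *\<^sub>R gradient bump x"
        using gradient_eqI[OF has_derivative_affine_gradient[of bump 1 x 0 "1 / c", OF bump.diff]] by simp
      then show ?thesis using c G(2)[of x] by (intro max.coboundedI2) (simp add: divide_right_mono)
    qed
  qed
qed

text \<open>A regularised distance to the complement. Balls with room to double inside
  \<open>\<Omega>\<close> form a countable cover, and \<open>\<delta>\<close> is a weighted series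
  of bumps on them. Each weight contains the radius of its ball, which cancels the factor 1/r in the
  gradient and also keeps \<open>\<delta>\<close> below the size of some ball containing the
  point.\<close>

lemma smooth_scale_exists:
  fixes \<Omega> :: "'a::euclidean_space set"
  assumes \<Omega>: "open \<Omega>"
  obtains \<delta> :: "'a \<Rightarrow> real" where "\<And>x. \<delta> differentiable (at x)" "continuous_on UNIV (gradient \<delta>)"
    "\<And>x. norm (gradient \<delta> x) \<le> 1 / 2" "\<And>x. x \<in> \<Omega> \<Longrightarrow> \<delta> x > 0" "\<And>x. \<delta> x \<le> 1"
    "\<And>x. x \<in> \<Omega> \<Longrightarrow> cball x (\<delta> x) \<subseteq> \<Omega>"
proof (cases "\<Omega> = {}")
  case True
  have "gradient (\<lambda>_. 0) x = 0" for x :: 'a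
    using gradient_eq_0_outside[of "{}" "\<lambda>_. 0" x] by simp
  then have "gradient (\<lambda>_::'a. 0) = (\<lambda>_. 0)" by auto
  then show thesis by (intro that[of "\<lambda>_. 0"]) (auto simp: True)
next
  case False
  interpret bump: C1_compact "bump :: 'a \<Rightarrow> real" "cball 0 1" by (rule C1_compact_bump)
  obtain G where G: "G \<ge> 1" "\<And>x::'a. norm (gradient bump x) \<le> G"
    using bump.bounded_gradient by (metis max.cobounded1 max.coboundedI2)
  define \<F> where "\<F> = (\<lambda>(x, r). ball x r) ` {(x::'a, r). 0 < r \<and> r \<le> 1 \<and> cball x (2 * r) \<subseteq> \<Omega>}"
  have U: "\<Union>\<F> = \<Omega>"
  proof
    show "\<Union>\<F> \<subseteq> \<Omega>"
    proof
      fix y assume "y \<in> \<Union>\<F>"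
      then obtain x r where "0 < r" "cball x (2 * r) \<subseteq> \<Omega>" "y \<in> ball x r" by (auto simp: \<F>_def)
      then have "y \<in> cball x (2 * r)" by simp
      then show "y \<in> \<Omega>" using \<open>cball x (2 * r) \<subseteq> \<Omega>\<close> by blast
    qed
    show "\<Omega> \<subseteq> \<Union>\<F>"
    proof
      fix x assume "x \<in> \<Omega>"
      then obtain e where e: "e > 0" "cball x e \<subseteq> \<Omega>" using \<Omega> open_contains_cball by blast
      define r where "r = min 1 (e / 2)"
      have r: "0 < r" "r \<le> 1" "2 * r \<le> e" using e by (auto simp: r_def)
      then have "cball x (2 * r) \<subseteq> \<Omega>" using e(2) subset_cball by blast
      then show "x \<in> \<Union>\<F>" using r by (auto simp: \<F>_def intro!: exI[of _ x] exI[of _ r])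
    qed
  qed
  obtain \<F>' where F': "\<F>' \<subseteq> \<F>" "countable \<F>'" "\<Union>\<F>' = \<Union>\<F>"
  proof -
    have "open S" if "S \<in> \<F>" for S using that by (auto simp: \<F>_def)
    then show thesis using Lindelof[of \<F>] that by metis
  qed
  have "\<F>' \<noteq> {}" using F' U False by auto
  have "\<exists>q r. 0 < r \<and> r \<le> 1 \<and> cball q (2 * r) \<subseteq> \<Omega> \<and> from_nat_into \<F>' n = ball q r" for n
  proof -
    have "from_nat_into \<F>' n \<in> \<F>" using from_nat_into[OF \<open>\<F>' \<noteq> {}\<close>, of n] F'(1) by blast
    then show ?thesis unfolding \<F>_def by auto
  qed
  then obtain q r where qr: "\<And>n. 0 < r n" "\<And>n. r n \<le> 1" "\<And>n. cball (q n) (2 * r n) \<subseteq> \<Omega>"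
    "\<And>n. from_nat_into \<F>' n = ball (q n) (r n)" by metis
  have cover: "\<exists>n. x \<in> ball (q n) (r n)" if "x \<in> \<Omega>" for x
    using that F' U qr(4) range_from_nat_into[OF \<open>\<F>' \<noteq> {}\<close> F'(2)] by (metis (no_types, lifting) UnionE imageE)
  \<comment> \<open>The division by \<open>2 * G\<close> brings the total gradient down to 1/2, the
    weights 2^-(n+1) make the series and its gradients converge uniformly, and
    \<open>G \<ge> 1\<close> preserves the bound by \<open>r n / 2\<close>.\<close>
  define f where "f n x = (r n / (2 * G) * (1 / 2) ^ Suc n) * bump ((1 / r n) *\<^sub>R (x - q n))" for n x
  define g where "g n x = (r n / (2 * G) * (1 / 2) ^ Suc n * (1 / r n)) *\<^sub>R gradient bump ((1 / r n) *\<^sub>R (x - q n))" for n x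
  have f_deriv: "(f n has_derivative (\<bullet>) (g n x)) (at x)" for n x
    unfolding f_def g_def by (rule has_derivative_affine_gradient) (rule bump.diff)
  have g_le: "norm (g n x) \<le> (1 / 2) * (1 / 2) ^ Suc n" for n x
  proof -
    have "norm (g n x) = (1 / (2 * G) * (1 / 2) ^ Suc n) * norm (gradient bump ((1 / r n) *\<^sub>R (x - q n)))"
      using qr(1)[of n] G by (simp add: g_def abs_mult)
    also have "\<dots> \<le> (1 / (2 * G) * (1 / 2) ^ Suc n) * G" using G by (intro mult_left_mono) auto
    finally show ?thesis using G by simp
  qed
  have f0: "0 \<le> f n x" for n x
    unfolding f_def using qr(1)[of n] G by (intro mult_nonneg_nonneg bump_nonneg) auto
  have f_le: "f n x \<le> r n / 2 * (1 / 2) ^ Suc n" for n x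
  proof -
    have "f n x \<le> (r n / (2 * G) * (1 / 2) ^ Suc n) * 1"
      unfolding f_def using qr(1)[of n] G by (intro mult_left_mono bump_le_1) auto
    also have "\<dots> \<le> r n / 2 * (1 / 2) ^ Suc n"
      using qr(1)[of n] G by (simp add: field_simps)
    finally show ?thesis .
  qed
  have f_le': "f n x \<le> (1 / 2) * (1 / 2) ^ Suc n" for n x
    by (rule order_trans[OF f_le]) (use qr(2)[of n] in \<open>intro mult_right_mono, auto\<close>)
  have geo: "(\<lambda>n. c * (1 / 2) ^ Suc n) sums (c * (1::real))" for c
    by (intro sums_mult power_half_series)
  have sf: "summable (\<lambda>n. f n x)" for x
    by (rule summable_comparison_test[OF _ sums_summable[OF geo[of "1 / 2"]]])
      (use f0 f_le' in \<open>auto intro!: exI[of _ 0]\<close>)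
  have sg: "summable (\<lambda>n. g n x)" for x
    by (rule summable_comparison_test[OF _ sums_summable[OF geo[of "1 / 2"]]])
      (use g_le in \<open>auto intro!: exI[of _ 0]\<close>)
  define \<delta> where "\<delta> x = (\<Sum>n. f n x)" for x
  define \<delta>' where "\<delta>' x = (\<Sum>n. g n x)" for x
  have ul: "uniform_limit UNIV (\<lambda>n x. \<Sum>i<n. g i x) \<delta>' sequentially"
    unfolding \<delta>'_def
    by (rule Weierstrass_m_test[OF _ sums_summable[OF geo[of "1 / 2"]]]) (rule g_le)
  have \<delta>_deriv: "(\<delta> has_derivative (\<bullet>) (\<delta>' x)) (at x)" for x
  proof -
    have "\<exists>F. \<forall>x\<in>UNIV. (\<lambda>n. f n x) sums F x \<and> (F has_derivative (\<bullet>) (\<delta>' x)) (at x within UNIV)"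
    proof (rule has_derivative_series)
      show "(f n has_derivative (\<bullet>) (g n x)) (at x within UNIV)" for n x using f_deriv by simp
      show "\<forall>\<^sub>F n in sequentially. \<forall>x\<in>UNIV. \<forall>h. norm ((\<Sum>i<n. g i x \<bullet> h) - \<delta>' x \<bullet> h) \<le> e * norm h" if "e > 0" for e
        using uniform_limitD[OF ul that]
      proof eventually_elim
        case (elim n)
        show ?case
        proof (intro ballI allI)
          fix x h
          have "norm ((\<Sum>i<n. g i x \<bullet> h) - \<delta>' x \<bullet> h) = \<bar>((\<Sum>i<n. g i x) - \<delta>' x) \<bullet> h\<bar>"
            by (simp add: inner_sum_left inner_diff_left)
          also have "\<dots> \<le> norm ((\<Sum>i<n. g i x) - \<delta>' x) * norm h" by (rule Cauchy_Schwarz_ineq2)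
          also have "\<dots> \<le> e * norm h"
            using elim by (intro mult_right_mono) (auto simp: dist_norm less_imp_le)
          finally show "norm ((\<Sum>i<n. g i x \<bullet> h) - \<delta>' x \<bullet> h) \<le> e * norm h" .
        qed
      qed
      show "(\<lambda>n. f n 0) sums \<delta> 0" unfolding \<delta>_def using sf by (rule summable_sums)
    qed auto
    then obtain F where F: "\<And>x. (\<lambda>n. f n x) sums F x" "\<And>x. (F has_derivative (\<bullet>) (\<delta>' x)) (at x)" by auto
    have "F = \<delta>" using F(1) by (auto simp: \<delta>_def sums_iff)
    then show ?thesis using F(2) by simp
  qed
  then have grad: "gradient \<delta> = \<delta>'" by (auto intro: gradient_eqI)
  have active: "x \<in> ball (q n) (r n)" if "f n x \<noteq> 0" for n x
  proof -
    have "norm ((1 / r n) *\<^sub>R (x - q n)) < 1" using that bump_eq_0 unfolding f_def by (metis mult_zero_right not_less)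
    then show ?thesis using qr(1)[of n] by (simp add: dist_norm norm_minus_commute)
  qed
  show thesis
  proof (rule that)
    show "\<delta> differentiable (at x)" for x using \<delta>_deriv by (auto simp: differentiable_def)
    have "continuous_on UNIV (g n)" for n
      unfolding g_def by (intro continuous_intros continuous_on_compose2[OF bump.cont_grad]) auto
    then show "continuous_on UNIV (gradient \<delta>)"
      unfolding grad by (intro uniform_limit_theorem[OF _ ul] always_eventually allI continuous_on_sum) auto
    show "norm (gradient \<delta> x) \<le> 1 / 2" for x
    proof -
      have "norm (\<delta>' x) \<le> (\<Sum>n. (1 / 2) * (1 / 2) ^ Suc n)"
        unfolding \<delta>'_def by (rule norm_suminf_le[OF g_le sums_summable[OF geo[of "1 / 2"]]])
      then show ?thesis using sums_unique[OF geo[of "1 / 2"]] by (simp add: grad)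
    qed
    show "\<delta> x \<le> 1" for x
    proof -
      have "\<delta> x \<le> (\<Sum>n. (1 / 2) * (1 / 2) ^ Suc n)"
        unfolding \<delta>_def by (rule suminf_le[OF f_le' sf sums_summable[OF geo[of "1 / 2"]]])
      then show ?thesis using sums_unique[OF geo[of "1 / 2"]] by simp
    qed
    show pos: "\<delta> x > 0" if x: "x \<in> \<Omega>" for x
    proof -
      obtain n where n: "x \<in> ball (q n) (r n)" using cover[OF x] by auto
      then have "norm ((1 / r n) *\<^sub>R (x - q n)) < 1" using qr(1)[of n] by (simp add: dist_norm norm_minus_commute)
      then have "f n x > 0" unfolding f_def using qr(1)[of n] G by (intro mult_pos_pos bump_pos) auto
      then show ?thesis unfolding \<delta>_def by (rule suminf_pos2[OF sf f0])
    qed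
    show "cball x (\<delta> x) \<subseteq> \<Omega>" if x: "x \<in> \<Omega>" for x
    proof -
      \<comment> \<open>If every ball active at \<open>x\<close> had radius below
        \<open>\<delta> x\<close>, the series would sum to at most \<open>\<delta> x / 2\<close>.
        With an active radius \<open>r n \<ge> \<delta> x\<close>, the ball around \<open>x\<close>
        fits into the doubled ball around \<open>q n\<close>.\<close>
      have "\<exists>n. f n x \<noteq> 0 \<and> \<delta> x \<le> r n"
      proof (rule ccontr)
        assume *: "\<not> ?thesis"
        have "f n x \<le> \<delta> x / 2 * (1 / 2) ^ Suc n" for n
        proof (cases "f n x = 0")
          case True
          then show ?thesis using pos[OF x] by simp
        next
          case False
          then have "r n \<le> \<delta> x" using * by (metis linear)
          then have "r n / 2 * (1 / 2) ^ Suc n \<le> \<delta> x / 2 * (1 / 2) ^ Suc n" by (intro mult_right_mono) auto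
          then show ?thesis using f_le[of n x] by linarith
        qed
        then have "\<delta> x \<le> (\<Sum>n. \<delta> x / 2 * (1 / 2) ^ Suc n)"
          by (subst \<delta>_def) (rule suminf_le[OF _ sf sums_summable[OF geo]])
        then show False using sums_unique[OF geo[of "\<delta> x / 2"]] pos[OF x] by simp
      qed
      then obtain n where n: "f n x \<noteq> 0" "\<delta> x \<le> r n" by auto
      have "cball x (\<delta> x) \<subseteq> cball (q n) (2 * r n)"
      proof
        fix y assume "y \<in> cball x (\<delta> x)"
        then show "y \<in> cball (q n) (2 * r n)"
          using n(2) active[OF n(1)] dist_triangle[of "q n" y x] by simp
      qed
      then show ?thesis using qr(3)[of n] by blast
    qed
  qed
qed

section \<open>Differentiation under the integral sign\<close>

lemma integrable_mult_bounded:
  fixes u :: "'a \<Rightarrow> real" and k :: "'a \<Rightarrow> 'b::{banach, second_countable_topology}"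
  assumes u: "integrable M u" and k: "k \<in> borel_measurable M" "\<And>z. norm (k z) \<le> B"
  shows "integrable M (\<lambda>z. u z *\<^sub>R k z)"
proof (rule Bochner_Integration.integrable_bound)
  show "integrable M (\<lambda>z. B * u z)" using u by simp
  show "(\<lambda>z. u z *\<^sub>R k z) \<in> borel_measurable M" using u k by measurable
  have "norm (u z *\<^sub>R k z) \<le> norm (B * u z)" for z
    using order_trans[OF k(2)[of z] abs_ge_self] by (simp add: mult.commute[of "\<bar>B\<bar>"] abs_mult mult_left_mono)
  then show "AE z in M. norm (u z *\<^sub>R k z) \<le> norm (B * u z)" by simp
qed

text \<open>The gradient bound is required only locally in \<open>x\<close>, uniformly in
  \<open>z\<close>: the kernels in question blow up as the width shrinks towards the
  boundary.\<close>

locale kernel_integral =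
  fixes \<Omega> :: "'a::euclidean_space set" and u :: "'a \<Rightarrow> real" and k :: "'a \<Rightarrow> 'a \<Rightarrow> real"
    and g :: "'a \<Rightarrow> 'a \<Rightarrow> 'a"
  assumes u: "integrable lborel u"
    and deriv: "\<And>x z. x \<in> \<Omega> \<Longrightarrow> ((\<lambda>x. k x z) has_derivative (\<bullet>) (g x z)) (at x)"
    and k_meas: "\<And>x. x \<in> \<Omega> \<Longrightarrow> k x \<in> borel_measurable borel"
    and g_meas: "\<And>x. x \<in> \<Omega> \<Longrightarrow> g x \<in> borel_measurable borel"
    and k_bound: "\<And>x. x \<in> \<Omega> \<Longrightarrow> \<exists>B. \<forall>z. \<bar>k x z\<bar> \<le> B"
    and g_bound: "\<And>x. x \<in> \<Omega> \<Longrightarrow> \<exists>r>0. \<exists>B. ball x r \<subseteq> \<Omega> \<and> (\<forall>y\<in>ball x r. \<forall>z. norm (g y z) \<le> B)"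
    and g_cont: "\<And>z. continuous_on \<Omega> (\<lambda>x. g x z)"
begin

lemma k_int: "x \<in> \<Omega> \<Longrightarrow> integrable lborel (\<lambda>z. u z * k x z)"
  using integrable_mult_bounded[OF u, of "k x"] k_meas[of x] k_bound[of x] by auto

lemma g_int:
  assumes "x \<in> \<Omega>"
  shows "integrable lborel (\<lambda>z. u z *\<^sub>R g x z)"
proof -
  obtain r B where "r > 0" "\<forall>y\<in>ball x r. \<forall>z. norm (g y z) \<le> B" using g_bound[OF assms] by blast
  then have "norm (g x z) \<le> B" for z by simp
  then show ?thesis using integrable_mult_bounded[OF u, of "g x"] g_meas[OF assms] by auto
qed

lemma has_derivative_integral:
  assumes x: "x \<in> \<Omega>"
  shows "((\<lambda>x. LINT z|lborel. u z * k x z) has_derivative (\<bullet>) (LINT z|lborel. u z *\<^sub>R g x z)) (at x)"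
    (is "(?v has_derivative (\<bullet>) ?G) _")
  unfolding has_derivative_at
proof (intro conjI)
  show "bounded_linear ((\<bullet>) ?G)" by (rule bounded_linear_inner_right)
  obtain r B where r: "r > 0" "ball x r \<subseteq> \<Omega>" and B: "\<And>y z. y \<in> ball x r \<Longrightarrow> norm (g y z) \<le> B"
    using g_bound[OF x] by blast
  show "(\<lambda>h. norm (?v (x + h) - ?v x - ?G \<bullet> h) / norm h) \<midarrow>0\<rightarrow> 0"
    unfolding tendsto_at_iff_sequentially
  proof (intro allI impI)
    fix X :: "nat \<Rightarrow> 'a" assume X: "\<forall>i. X i \<in> UNIV - {0}" "X \<longlonglongrightarrow> 0"
    have "eventually (\<lambda>i. norm (X i) < r) sequentially"
      using tendstoD[OF X(2) r(1)] by simp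
    then obtain N where N: "\<And>i. i \<ge> N \<Longrightarrow> norm (X i) < r" by (auto simp: eventually_sequentially)
    \<comment> \<open>Dropping the first \<open>N\<close> terms places every \<open>x + h i\<close>
      in the ball on which \<open>B\<close> bounds the gradient. The mean value inequality then
      dominates the remainder quotient by \<open>2 * B\<close>.\<close>
    define h where "h i = X (i + N)" for i
    have h: "h i \<noteq> 0" "norm (h i) < r" "x + h i \<in> ball x r" "x + h i \<in> \<Omega>" for i
      using X(1) N[of "i + N"] r(2) by (auto simp: h_def dist_norm subset_eq)
    have h0: "h \<longlonglongrightarrow> 0" unfolding h_def by (rule LIMSEQ_ignore_initial_segment[OF X(2)])
    define q where "q i z = (k (x + h i) z - k x z - g x z \<bullet> h i) / norm (h i)" for i z
    have q_bound: "\<bar>q i z\<bar> \<le> 2 * B" for i z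
    proof -
      have "norm (k (x + h i) z - k x z) \<le> B * norm ((x + h i) - x)"
      proof (rule differentiable_bound[of "ball x r"])
        show "((\<lambda>y. k y z) has_derivative (\<bullet>) (g y z)) (at y within ball x r)" if "y \<in> ball x r" for y
          using deriv r(2) that by (meson has_derivative_at_withinI subsetD)
        show "onorm ((\<bullet>) (g y z)) \<le> B" if "y \<in> ball x r" for y
          using B[OF that, of z] by (intro onorm_le) (metis Cauchy_Schwarz_ineq2 mult_right_mono norm_ge_zero order_trans real_norm_def)
      qed (use h r(1) in auto)
      moreover have "\<bar>g x z \<bullet> h i\<bar> \<le> B * norm (h i)"
        using Cauchy_Schwarz_ineq2[of "g x z" "h i"] B[of x z] r(1)
        by (meson centre_in_ball mult_right_mono norm_ge_zero order_trans)
      ultimately have "\<bar>k (x + h i) z - k x z - g x z \<bullet> h i\<bar> \<le> 2 * B * norm (h i)" by (simp; linarith)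
      then show ?thesis using h[of i] by (simp add: q_def field_simps)
    qed
    have q_lim: "(\<lambda>i. q i z) \<longlonglongrightarrow> 0" for z
    proof -
      have "((\<lambda>h. norm (k (x + h) z - k x z - g x z \<bullet> h) / norm h) \<longlongrightarrow> 0) (at 0)"
        using deriv[OF x, of z] by (simp add: has_derivative_at)
      then have "(\<lambda>i. norm (k (x + h i) z - k x z - g x z \<bullet> h i) / norm (h i)) \<longlonglongrightarrow> 0"
        unfolding tendsto_at_iff_sequentially using h h0 by (auto simp: o_def dest!: spec[of _ h])
      then have "(\<lambda>i. norm (q i z)) \<longlonglongrightarrow> 0" by (simp add: q_def)
      then show ?thesis by (rule tendsto_norm_zero_cancel)
    qed
    have q_meas: "q i \<in> borel_measurable borel" for i
      using k_meas[OF h(4), of i] k_meas[OF x] g_meas[OF x] unfolding q_def by measurable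
    have lim: "(\<lambda>i. LINT z|lborel. u z * q i z) \<longlonglongrightarrow> (LINT z|(lborel :: 'a measure). 0)"
    proof (rule integral_dominated_convergence[where w = "\<lambda>z. 2 * B * \<bar>u z\<bar>"])
      show "integrable lborel (\<lambda>z. 2 * B * \<bar>u z\<bar>)" using u by auto
      show "AE z in lborel. (\<lambda>i. u z * q i z) \<longlonglongrightarrow> 0"
        using q_lim by (intro AE_I2 tendsto_mult_right_zero)
      show "AE z in lborel. norm (u z * q i z) \<le> 2 * B * \<bar>u z\<bar>" for i
        using mult_left_mono[OF q_bound[of i] abs_ge_zero] by (intro AE_I2) (simp add: abs_mult mult_ac)
      show "(\<lambda>z. u z * q i z) \<in> borel_measurable lborel" for i
        using u q_meas[of i] by (auto intro!: borel_measurable_times)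
    qed simp
    have "norm (?v (x + h i) - ?v x - ?G \<bullet> h i) / norm (h i) = norm (LINT z|lborel. u z * q i z)" for i
    proof -
      have "?v (x + h i) - ?v x - ?G \<bullet> h i = (LINT z|lborel. u z * k (x + h i) z - u z * k x z - (u z *\<^sub>R g x z) \<bullet> h i)"
        using k_int[OF h(4)[of i]] k_int[OF x] integrable_inner_left[of "h i", OF g_int[OF x]]
          integral_inner_left[of "h i", OF g_int[OF x], symmetric]
        by (simp only: Bochner_Integration.integral_diff Bochner_Integration.integrable_diff)
      also have "\<dots> = (LINT z|lborel. (u z * q i z) * norm (h i))"
      proof (rule Bochner_Integration.integral_cong[OF refl])
        fix z
        have "q i z * norm (h i) = k (x + h i) z - k x z - g x z \<bullet> h i"
          using h(1)[of i] by (simp add: q_def)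
        then have "u z * (q i z * norm (h i)) = u z * (k (x + h i) z - k x z - g x z \<bullet> h i)" by simp
        then show "u z * k (x + h i) z - u z * k x z - (u z *\<^sub>R g x z) \<bullet> h i = (u z * q i z) * norm (h i)"
          by (simp add: right_diff_distrib mult.assoc)
      qed
      also have "\<dots> = (LINT z|lborel. u z * q i z) * norm (h i)" by simp
      finally show ?thesis using h[of i] by (simp add: abs_mult)
    qed
    then have "(\<lambda>i. norm (?v (x + h i) - ?v x - ?G \<bullet> h i) / norm (h i)) \<longlonglongrightarrow> 0"
      using tendsto_norm[OF lim] by simp
    then show "((\<lambda>h. norm (?v (x + h) - ?v x - ?G \<bullet> h) / norm h) \<circ> X) \<longlonglongrightarrow> 0"
      unfolding h_def o_def by (rule LIMSEQ_offset)
  qed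
qed

lemma continuous_on_integral: "continuous_on \<Omega> (\<lambda>x. LINT z|lborel. u z *\<^sub>R g x z)"
  unfolding continuous_on_sequentially
proof (intro allI ballI impI, elim conjE)
  fix X x assume x: "x \<in> \<Omega>" and X: "\<forall>n. X n \<in> \<Omega>" "X \<longlonglongrightarrow> x"
  obtain r B where r: "r > 0" "ball x r \<subseteq> \<Omega>" and B: "\<And>y z. y \<in> ball x r \<Longrightarrow> norm (g y z) \<le> B"
    using g_bound[OF x] by blast
  have "eventually (\<lambda>i. dist (X i) x < r) sequentially"
    using tendstoD[OF X(2) r(1)] .
  then obtain N where N: "\<And>i. i \<ge> N \<Longrightarrow> X i \<in> ball x r"
    by (auto simp: eventually_sequentially dist_commute)
  have "(\<lambda>i. LINT z|lborel. u z *\<^sub>R g (X (i + N)) z) \<longlonglongrightarrow> (LINT z|lborel. u z *\<^sub>R g x z)"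
  proof (rule integral_dominated_convergence[where w = "\<lambda>z. B * \<bar>u z\<bar>"])
    show "integrable lborel (\<lambda>z. B * \<bar>u z\<bar>)" using u by auto
    show "AE z in lborel. (\<lambda>i. u z *\<^sub>R g (X (i + N)) z) \<longlonglongrightarrow> u z *\<^sub>R g x z"
    proof (intro AE_I2 tendsto_intros)
      fix z
      have "(\<lambda>i. g (X i) z) \<longlonglongrightarrow> g x z"
        using g_cont[of z] x X unfolding continuous_on_sequentially by (auto simp: o_def)
      then show "(\<lambda>i. g (X (i + N)) z) \<longlonglongrightarrow> g x z" by (rule LIMSEQ_ignore_initial_segment)
    qed
    show "AE z in lborel. norm (u z *\<^sub>R g (X (i + N)) z) \<le> B * \<bar>u z\<bar>" for i
      using B[OF N[of "i + N"]] by (intro AE_I2) (simp add: mult.commute[of B] mult_left_mono)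
    show "(\<lambda>z. u z *\<^sub>R g (X (i + N)) z) \<in> borel_measurable lborel" for i
      using g_int X(1) by auto
    show "(\<lambda>z. u z *\<^sub>R g x z) \<in> borel_measurable lborel" using g_int[OF x] by auto
  qed
  then show "((\<lambda>x. LINT z|lborel. u z *\<^sub>R g x z) \<circ> X) \<longlonglongrightarrow> (LINT z|lborel. u z *\<^sub>R g x z)"
    unfolding o_def by (rule LIMSEQ_offset)
qed

end

section \<open>The kernel of variable width and its derivative\<close>

lemma integral_lborel_affine:
  fixes f :: "'a::euclidean_space \<Rightarrow> real"
  assumes "c > 0" "f \<in> borel_measurable borel"
  shows "(LINT z|lborel. f z) = c ^ DIM('a) * (LINT y|lborel. f (t + c *\<^sub>R y))"
proof -
  have "(LINT z|lborel. f z) = (LINT z|density (distr lborel borel (\<lambda>x. t + c *\<^sub>R x)) (\<lambda>_. ennreal (\<bar>c\<bar> ^ DIM('a))). f z)"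
    using assms by (subst lborel_affine[of c t]) auto
  also have "\<dots> = (LINT z|distr lborel borel (\<lambda>x. t + c *\<^sub>R x). \<bar>c\<bar> ^ DIM('a) *\<^sub>R f z)"
    using assms by (intro integral_density) auto
  also have "\<dots> = (LINT y|lborel. \<bar>c\<bar> ^ DIM('a) *\<^sub>R f (t + c *\<^sub>R y))"
    using assms by (intro integral_distr) auto
  finally show ?thesis using assms by simp
qed

lemma gradient_scaled:
  fixes \<rho> :: "'a::euclidean_space \<Rightarrow> real"
  assumes "\<rho> differentiable (at (s *\<^sub>R (x - q)))"
  shows "gradient (\<lambda>x. c * \<rho> (s *\<^sub>R (x - q))) x = (c * s) *\<^sub>R gradient \<rho> (s *\<^sub>R (x - q))"
  by (rule gradient_eqI[OF has_derivative_affine_gradient[OF assms]])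

text \<open>The cap \<open>\<tau>\<close> on the width drives the convergence. The gradient bound
  1/2 makes \<open>\<delta>\<close> comparable at points within one width of each other, on which
  both the local kernel bounds and the L1 estimate rest.\<close>

locale variable_mollifier =
  fixes \<Omega> :: "'a::euclidean_space set" and \<eta> :: "'a \<Rightarrow> real" and H :: real
    and \<delta> :: "'a \<Rightarrow> real" and \<tau> :: real
  assumes open_\<Omega>: "open \<Omega>"
    and eta_smooth: "\<And>k. Ck_on k UNIV \<eta>" and eta_nonneg: "\<And>x. \<eta> x \<ge> 0"
    and eta_outside: "\<And>x. norm x \<ge> 1 \<Longrightarrow> \<eta> x = 0" and eta_integral: "(LINT x|lborel. \<eta> x) = 1"
    and eta_le: "\<And>x. \<eta> x \<le> H" and eta_gradient_le: "\<And>x. norm (gradient \<eta> x) \<le> H"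
    and delta_diff: "\<And>x. \<delta> differentiable (at x)" and delta_C1: "continuous_on UNIV (gradient \<delta>)"
    and delta_gradient_le: "\<And>x. norm (gradient \<delta> x) \<le> 1 / 2"
    and delta_pos: "\<And>x. x \<in> \<Omega> \<Longrightarrow> \<delta> x > 0" and delta_le: "\<And>x. \<delta> x \<le> \<tau>"
    and delta_cball: "\<And>x. x \<in> \<Omega> \<Longrightarrow> cball x (\<delta> x) \<subseteq> \<Omega>"
begin

text \<open>The profile \<open>\<rho>\<close> is a parameter because the derivative of the kernel
  for \<open>\<eta>\<close> involves kernels for other profiles.\<close>

definition kernel :: "('a \<Rightarrow> real) \<Rightarrow> 'a \<Rightarrow> 'a \<Rightarrow> real" where
  "kernel \<rho> x z = (1 / \<delta> x) ^ DIM('a) * \<rho> ((1 / \<delta> x) *\<^sub>R (z - x))"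

text \<open>The gradient in \<open>x\<close> of \<open>kernel \<eta> x z\<close>: the first term
  comes from moving the centre, the term along \<open>gradient \<delta> x\<close> from changing the
  width.\<close>

definition dkernel :: "'a \<Rightarrow> 'a \<Rightarrow> 'a" where
  "dkernel x z = (let \<zeta> = (1 / \<delta> x) *\<^sub>R (z - x) in
     - ((1 / \<delta> x) ^ Suc DIM('a)) *\<^sub>R
       (gradient \<eta> \<zeta> + (gradient \<eta> \<zeta> \<bullet> \<zeta> + DIM('a) * \<eta> \<zeta>) *\<^sub>R gradient \<delta> x))"

lemma eta_C1: "C1_compact \<eta> (cball 0 1)"
proof
  have "Ck_on 1 UNIV \<eta>" by (rule eta_smooth)
  then show "\<eta> differentiable (at x)" "continuous_on UNIV (gradient \<eta>)" for x
    by (auto simp only: Ck_on_1_iff UNIV_I)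
qed (auto simp: eta_outside)

sublocale eta: C1_compact \<eta> "cball 0 1" by (rule eta_C1)

lemma H_nonneg: "H \<ge> 0"
  using eta_le eta_nonneg order_trans by blast

lemma delta_cont: "continuous_on A \<delta>"
  by (meson continuous_at_imp_continuous_on delta_diff differentiable_imp_continuous_within)

lemma delta_lipschitz: "\<bar>\<delta> x - \<delta> y\<bar> \<le> norm (x - y) / 2"
proof -
  have "norm (\<delta> x - \<delta> y) \<le> 1 / 2 * norm (x - y)"
  proof (rule differentiable_bound[of UNIV])
    show "(\<delta> has_derivative (\<bullet>) (gradient \<delta> x)) (at x within UNIV)" for x
      using has_derivative_gradient[OF delta_diff] .
    show "onorm ((\<bullet>) (gradient \<delta> x)) \<le> 1 / 2" for x
      using delta_gradient_le[of x]
      by (intro onorm_le) (metis Cauchy_Schwarz_ineq2 mult_right_mono norm_ge_zero order_trans real_norm_def)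
  qed auto
  then show ?thesis by simp
qed

lemma delta_meas[measurable]: "\<delta> \<in> borel_measurable borel"
  using delta_cont by (rule borel_measurable_continuous_onI)

lemma eta_meas[measurable]: "\<eta> \<in> borel_measurable borel"
  using eta.cont by (rule borel_measurable_continuous_onI)

lemma eta_gradient_meas[measurable]: "gradient \<eta> \<in> borel_measurable borel"
  using eta.cont_grad by (rule borel_measurable_continuous_onI)

lemma kernel_nonneg: "x \<in> \<Omega> \<Longrightarrow> kernel \<eta> x z \<ge> 0"
  using delta_pos[of x] eta_nonneg by (simp add: kernel_def)

lemma kernel_le: "x \<in> \<Omega> \<Longrightarrow> kernel \<eta> x z \<le> (1 / \<delta> x) ^ DIM('a) * H"
  using delta_pos[of x] eta_le by (simp add: kernel_def divide_right_mono power_one_over)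

lemma scaled_norm_ge: "x \<in> \<Omega> \<Longrightarrow> z \<notin> cball x (\<delta> x) \<Longrightarrow> 1 \<le> norm ((1 / \<delta> x) *\<^sub>R (z - x))"
  using delta_pos[of x] by (simp add: dist_norm norm_minus_commute)

lemma kernel_outside:
  assumes "\<And>y. norm y \<ge> 1 \<Longrightarrow> \<rho> y = 0" "x \<in> \<Omega>" "z \<notin> cball x (\<delta> x)"
  shows "kernel \<rho> x z = 0"
  using assms(1)[OF scaled_norm_ge[OF assms(2,3)]] by (simp add: kernel_def)

lemma kernel_test_function:
  assumes \<rho>: "\<And>k. Ck_on k UNIV \<rho>" "\<And>y. norm y \<ge> 1 \<Longrightarrow> \<rho> y = 0" and x: "x \<in> \<Omega>"
  shows "kernel \<rho> x \<in> test_functions \<Omega>"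
proof (rule test_functionsI)
  show "Ck_on k UNIV (kernel \<rho> x)" for k
    unfolding kernel_def[abs_def] by (intro Ck_on_mult Ck_on_const Ck_on_affine \<rho>)
  show "kernel \<rho> x z = 0" if "z \<notin> cball x (\<delta> x)" for z
    by (rule kernel_outside[OF \<rho>(2) x that])
qed (use delta_cball[OF x] in auto)

lemma gradient_kernel:
  assumes "\<And>y. \<rho> differentiable (at y)"
  shows "gradient (kernel \<rho> x) z = (1 / \<delta> x) ^ Suc DIM('a) *\<^sub>R gradient \<rho> ((1 / \<delta> x) *\<^sub>R (z - x))"
  unfolding kernel_def[abs_def] gradient_scaled[OF assms] by (simp add: mult.commute)

lemma kernel_has_derivative:
  assumes x: "x \<in> \<Omega>"
  shows "((\<lambda>x. kernel \<eta> x z) has_derivative (\<bullet>) (dkernel x z)) (at x)"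
proof -
  let ?m = "DIM('a)" and ?D = "gradient \<delta> x"
  define i where "i = 1 / \<delta> x"
  have d: "\<delta> x > 0" using delta_pos[OF x] .
  have D: "(\<delta> has_derivative (\<lambda>h. ?D \<bullet> h)) (at x)" using has_derivative_gradient[OF delta_diff] .
  have I: "((\<lambda>x. 1 / \<delta> x) has_derivative (\<lambda>h. - (i\<^sup>2 * (?D \<bullet> h)))) (at x)"
    by (rule has_derivative_eq_rhs[OF has_derivative_divide[OF has_derivative_const D]])
      (use d in \<open>auto simp: i_def power2_eq_square fun_eq_iff divide_simps\<close>)
  have Z: "((\<lambda>x. (1 / \<delta> x) *\<^sub>R (z - x)) has_derivative
      (\<lambda>h. i *\<^sub>R (0 - h) + (- (i\<^sup>2 * (?D \<bullet> h))) *\<^sub>R (z - x))) (at x)"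
    unfolding i_def by (intro has_derivative_scaleR I[unfolded i_def] derivative_intros)
  have E: "((\<lambda>x. \<eta> ((1 / \<delta> x) *\<^sub>R (z - x))) has_derivative
      (\<lambda>h. gradient \<eta> (i *\<^sub>R (z - x)) \<bullet> (i *\<^sub>R (0 - h) + (- (i\<^sup>2 * (?D \<bullet> h))) *\<^sub>R (z - x)))) (at x)"
    using has_derivative_compose[OF Z has_derivative_gradient[OF eta.diff]] by (simp add: i_def)
  have P: "((\<lambda>x. (1 / \<delta> x) ^ ?m) has_derivative
      (\<lambda>h. - (i\<^sup>2 * (?D \<bullet> h)) * (of_nat ?m * i ^ (?m - 1)))) (at x)"
    by (rule has_derivative_eq_rhs[OF has_derivative_power[OF I]]) (simp add: i_def fun_eq_iff)
  \<comment> \<open>The power rule leaves the natural exponent m - 1; recombining it to m + 1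
    requires a positive dimension.\<close>
  have m: "i\<^sup>2 * i ^ (?m - 1) = i ^ Suc ?m"
    using DIM_positive[where 'a = 'a] by (cases "DIM('a)") (auto simp: power2_eq_square)
  show ?thesis
    unfolding kernel_def
  proof (rule has_derivative_eq_rhs[OF has_derivative_mult[OF P E]], rule ext)
    fix h
    let ?\<zeta> = "i *\<^sub>R (z - x)"
    have "(1 / \<delta> x) ^ ?m * (gradient \<eta> ?\<zeta> \<bullet> (i *\<^sub>R (0 - h) + (- (i\<^sup>2 * (?D \<bullet> h))) *\<^sub>R (z - x))) +
        - (i\<^sup>2 * (?D \<bullet> h)) * (of_nat ?m * i ^ (?m - 1)) * \<eta> ((1 / \<delta> x) *\<^sub>R (z - x))
      = - (i ^ Suc ?m) * (gradient \<eta> ?\<zeta> \<bullet> h) - i ^ Suc ?m * (?D \<bullet> h) * (gradient \<eta> ?\<zeta> \<bullet> ?\<zeta>)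
        - (i\<^sup>2 * i ^ (?m - 1)) * (?D \<bullet> h) * ?m * \<eta> ?\<zeta>"
      by (simp add: i_def[symmetric] inner_add_right inner_diff_right power2_eq_square algebra_simps)
    also have "\<dots> = dkernel x z \<bullet> h"
      unfolding m dkernel_def Let_def i_def[symmetric]
      by (simp add: inner_add_left algebra_simps)
    finally show "(1 / \<delta> x) ^ ?m * (gradient \<eta> ?\<zeta> \<bullet> (i *\<^sub>R (0 - h) + (- (i\<^sup>2 * (?D \<bullet> h))) *\<^sub>R (z - x))) +
        - (i\<^sup>2 * (?D \<bullet> h)) * (of_nat ?m * i ^ (?m - 1)) * \<eta> ((1 / \<delta> x) *\<^sub>R (z - x)) = dkernel x z \<bullet> h" .
  qed
qed

text \<open>\<open>m \<eta>(\<zeta>) + \<nabla>\<eta>(\<zeta>) \<bullet> \<zeta>\<close> is the divergence of \<open>\<zeta> \<eta>(\<zeta>)\<close>. Hence even the part of the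
  \<open>x\<close>-derivative caused by the varying scale is a \<open>z\<close>-derivative of test functions.\<close>

definition moment :: "'a \<Rightarrow> 'a \<Rightarrow> real" where
  "moment b y = (y \<bullet> b) * \<eta> y"

lemma moment_smooth: "Ck_on k UNIV (moment b)"
  unfolding moment_def[abs_def] by (intro Ck_on_mult Ck_on_bounded_linear bounded_linear_inner_left eta_smooth)

lemma moment_diff: "moment b differentiable (at y)"
  using moment_smooth[of "Suc 0" b] by simp

lemma moment_outside: "norm y \<ge> 1 \<Longrightarrow> moment b y = 0"
  by (simp add: moment_def eta_outside)

lemma gradient_moment: "gradient (moment b) y = (y \<bullet> b) *\<^sub>R gradient \<eta> y + \<eta> y *\<^sub>R b"
proof -
  have d: "((\<lambda>y. y \<bullet> b) has_derivative (\<lambda>h. h \<bullet> b)) (at y)"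
    by (rule bounded_linear_imp_has_derivative[OF bounded_linear_inner_left])
  then have g: "gradient (\<lambda>y. y \<bullet> b) y = b"
    by (intro gradient_eqI) (simp add: inner_commute[of _ b])
  show ?thesis
    unfolding moment_def[abs_def]
    by (subst gradient_mult) (use d in \<open>auto simp: g differentiable_def intro: eta.diff[unfolded differentiable_def]\<close>)
qed

text \<open>For fixed \<open>x\<close> both terms are partial derivatives in \<open>z\<close> of
  test functions, so integrating them against \<open>u\<close> produces integrals against
  Du.\<close>

lemma dkernel_inner:
  assumes i: "i \<in> Basis"
  shows "dkernel x z \<bullet> i = - (gradient (kernel \<eta> x) z \<bullet> i)
    - (gradient \<delta> x \<bullet> i) * (\<Sum>b\<in>Basis. gradient (kernel (moment b) x) z \<bullet> b)"
proof -
  let ?\<zeta> = "(1 / \<delta> x) *\<^sub>R (z - x)"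
  have "(\<Sum>b\<in>Basis. gradient (moment b) ?\<zeta> \<bullet> b) = (\<Sum>b\<in>Basis. (gradient \<eta> ?\<zeta> \<bullet> b) * (?\<zeta> \<bullet> b) + \<eta> ?\<zeta>)"
    by (intro sum.cong refl) (simp only: gradient_moment inner_add_left inner_scaleR_left, simp add: inner_same_Basis)
  also have "\<dots> = gradient \<eta> ?\<zeta> \<bullet> ?\<zeta> + DIM('a) * \<eta> ?\<zeta>"
    by (subst euclidean_inner[of "gradient \<eta> ?\<zeta>" ?\<zeta>]) (simp add: sum.distrib)
  finally have *: "(\<Sum>b\<in>Basis. gradient (moment b) ?\<zeta> \<bullet> b) = gradient \<eta> ?\<zeta> \<bullet> ?\<zeta> + DIM('a) * \<eta> ?\<zeta>" .
  have "(\<Sum>b\<in>Basis. gradient (kernel (moment b) x) z \<bullet> b) =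
      (1 / \<delta> x) ^ Suc DIM('a) * (gradient \<eta> ?\<zeta> \<bullet> ?\<zeta> + DIM('a) * \<eta> ?\<zeta>)"
    unfolding *[symmetric] gradient_kernel[OF moment_diff] by (simp add: sum_distrib_left)
  then show ?thesis
    by (simp only: dkernel_def Let_def gradient_kernel[OF eta.diff] inner_scaleR_left inner_add_left inner_minus_left)
      (simp add: algebra_simps)
qed

lemma dkernel_le:
  assumes x: "x \<in> \<Omega>"
  shows "norm (dkernel x z) \<le> (1 / \<delta> x) ^ Suc DIM('a) * ((2 + DIM('a)) * H)"
proof -
  let ?\<zeta> = "(1 / \<delta> x) *\<^sub>R (z - x)"
  have "norm (gradient \<eta> ?\<zeta> + (gradient \<eta> ?\<zeta> \<bullet> ?\<zeta> + DIM('a) * \<eta> ?\<zeta>) *\<^sub>R gradient \<delta> x) \<le> (2 + DIM('a)) * H"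
  proof (cases "norm ?\<zeta> \<le> 1")
    case True
    have "\<bar>gradient \<eta> ?\<zeta> \<bullet> ?\<zeta>\<bar> \<le> norm (gradient \<eta> ?\<zeta>) * norm ?\<zeta>" by (rule Cauchy_Schwarz_ineq2)
    also have "\<dots> \<le> H * 1" using True eta_gradient_le H_nonneg by (intro mult_mono) auto
    finally have "\<bar>gradient \<eta> ?\<zeta> \<bullet> ?\<zeta>\<bar> \<le> H" by simp
    moreover have "\<bar>DIM('a) * \<eta> ?\<zeta>\<bar> \<le> DIM('a) * H"
      using eta_le eta_nonneg by (simp add: abs_mult mult_left_mono)
    ultimately have "\<bar>gradient \<eta> ?\<zeta> \<bullet> ?\<zeta> + DIM('a) * \<eta> ?\<zeta>\<bar> \<le> H + DIM('a) * H"
      by (intro order_trans[OF abs_triangle_ineq] add_mono)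
    then have "\<bar>gradient \<eta> ?\<zeta> \<bullet> ?\<zeta> + DIM('a) * \<eta> ?\<zeta>\<bar> \<le> (1 + DIM('a)) * H"
      by (simp only: distrib_right of_nat_add of_nat_1 mult_1)
    then have "\<bar>gradient \<eta> ?\<zeta> \<bullet> ?\<zeta> + DIM('a) * \<eta> ?\<zeta>\<bar> * norm (gradient \<delta> x) \<le> ((1 + DIM('a)) * H) * 1"
      using delta_gradient_le[of x] H_nonneg by (intro mult_mono) auto
    then have "norm ((gradient \<eta> ?\<zeta> \<bullet> ?\<zeta> + DIM('a) * \<eta> ?\<zeta>) *\<^sub>R gradient \<delta> x) \<le> (1 + DIM('a)) * H" by simp
    then show ?thesis
      using norm_triangle_le[OF add_mono[OF eta_gradient_le[of ?\<zeta>], of _ "(1 + DIM('a)) * H"]]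
      by (simp add: distrib_right)
  next
    case False
    then show ?thesis using eta.gradient_outside[of ?\<zeta>] eta_outside[of ?\<zeta>] H_nonneg
      by (simp only: mem_cball_0 not_le) simp
  qed
  then show ?thesis
    using delta_pos[OF x] unfolding dkernel_def Let_def by (simp add: mult_left_mono divide_right_mono power_one_over)
qed

lemma mollify_kernel_integral:
  assumes "integrable lborel u"
  shows "kernel_integral \<Omega> u (kernel \<eta>) dkernel"
proof
  show "integrable lborel u" by fact
  show "\<And>x z. x \<in> \<Omega> \<Longrightarrow> ((\<lambda>x. kernel \<eta> x z) has_derivative (\<bullet>) (dkernel x z)) (at x)"
    by (rule kernel_has_derivative)
  show "kernel \<eta> x \<in> borel_measurable borel" for x unfolding kernel_def[abs_def] by measurable
  show "dkernel x \<in> borel_measurable borel" for x unfolding dkernel_def[abs_def] Let_def by measurable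
  show "\<exists>B. \<forall>z. \<bar>kernel \<eta> x z\<bar> \<le> B" if "x \<in> \<Omega>" for x
    using kernel_le[OF that] kernel_nonneg[OF that] by (intro exI[of _ "(1 / \<delta> x) ^ DIM('a) * H"]) simp
  show "continuous_on \<Omega> (\<lambda>x. dkernel x z)" for z
    unfolding dkernel_def Let_def
    by (intro continuous_intros delta_cont continuous_on_compose2[OF eta.cont]
        continuous_on_compose2[OF eta.cont_grad] continuous_on_subset[OF delta_C1]) (use delta_pos in force)+
  show "\<exists>r>0. \<exists>B. ball x r \<subseteq> \<Omega> \<and> (\<forall>y\<in>ball x r. \<forall>z. norm (dkernel y z) \<le> B)" if x: "x \<in> \<Omega>" for x
  proof (intro exI conjI ballI allI)
    \<comment> \<open>Radius \<open>\<delta> x\<close> works: the Lipschitz bound gives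
      \<open>\<delta> y \<ge> \<delta> x / 2\<close> on that ball, so the kernel bounds lose at most
      a power of 2.\<close>
    show "\<delta> x > 0" by (rule delta_pos[OF x])
    show b: "ball x (\<delta> x) \<subseteq> \<Omega>" using delta_cball[OF x] by auto
    fix y z assume y: "y \<in> ball x (\<delta> x)"
    then have "norm (x - y) < \<delta> x" by (simp add: dist_norm)
    then have "\<delta> y \<ge> \<delta> x / 2" using delta_lipschitz[of x y] by linarith
    then have "1 / \<delta> y \<le> 2 / \<delta> x" using delta_pos[OF x] by (simp add: field_simps)
    then have "(1 / \<delta> y) ^ Suc DIM('a) * ((2 + DIM('a)) * H) \<le> (2 / \<delta> x) ^ Suc DIM('a) * ((2 + DIM('a)) * H)"
      using delta_pos[of y] y b H_nonneg by (intro mult_right_mono power_mono) auto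
    then show "norm (dkernel y z) \<le> (2 / \<delta> x) ^ Suc DIM('a) * ((2 + DIM('a)) * H)"
      using dkernel_le[of y z] y b by auto
  qed
qed

definition mollify :: "('a \<Rightarrow> real) \<Rightarrow> 'a \<Rightarrow> real" where
  "mollify u x = (LINT z|lborel. u z * kernel \<eta> x z)"

lemma mollify_C1:
  assumes u: "integrable lborel u"
  shows "Ck_on 1 \<Omega> (mollify u)"
    and "x \<in> \<Omega> \<Longrightarrow> gradient (mollify u) x = (LINT z|lborel. u z *\<^sub>R dkernel x z)"
proof -
  interpret kernel_integral \<Omega> u "kernel \<eta>" dkernel by (rule mollify_kernel_integral[OF u])
  have D: "(mollify u has_derivative (\<bullet>) (LINT z|lborel. u z *\<^sub>R dkernel x z)) (at x)" if "x \<in> \<Omega>" for x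
    using has_derivative_integral[OF that] unfolding mollify_def[abs_def] .
  then show g: "gradient (mollify u) x = (LINT z|lborel. u z *\<^sub>R dkernel x z)" if "x \<in> \<Omega>" for x
    using that by (intro gradient_eqI)
  show "Ck_on 1 \<Omega> (mollify u)"
    unfolding Ck_on_1_iff
  proof
    show "\<forall>x\<in>\<Omega>. mollify u differentiable (at x)" using D by (auto simp: differentiable_def)
    show "continuous_on \<Omega> (gradient (mollify u))"
      by (subst continuous_on_cong[OF refl g]) (auto intro: continuous_on_integral)
  qed
qed

end

section \<open>L1 estimates for the mollification and its gradient\<close>

lemma ennreal_norm_integral_le:
  fixes f :: "'a \<Rightarrow> 'b::{banach, second_countable_topology}"
  shows "ennreal (norm (LINT x|M. f x)) \<le> (\<integral>\<^sup>+x. ennreal (norm (f x)) \<partial>M)"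
proof (cases "integrable M f")
  case True
  then show ?thesis by (rule integral_norm_bound_ennreal)
qed (simp add: not_integrable_integral_eq)

context variable_mollifier
begin

text \<open>On its support the kernel is at most (2/\<delta>(z))^m H, and the support in
  \<open>x\<close> lies in the ball of radius 3 \<delta>(z) around \<open>z\<close>. The widths
  cancel and leave 6^m, so the constant does not depend on \<open>\<delta>\<close> or
  \<open>\<tau>\<close>.\<close>

definition schur_const :: real where
  "schur_const = 6 ^ DIM('a) * H * measure lborel (ball (0 :: 'a) 1)"

lemma schur_const_nonneg: "schur_const \<ge> 0"
  using H_nonneg by (simp add: schur_const_def)

lemma kernel_nonzero_dist:
  assumes "\<And>y. norm y \<ge> 1 \<Longrightarrow> \<rho> y = 0" "x \<in> \<Omega>" "kernel \<rho> x z \<noteq> 0"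
  shows "norm (z - x) \<le> \<delta> x"
  using kernel_outside[of \<rho> x z] assms by (auto simp: dist_norm norm_minus_commute)

text \<open>The Lipschitz bound on \<open>\<delta>\<close> makes \<open>\<delta> x\<close> and \<open>\<delta> z\<close> comparable on the support of the kernel,
  so that the kernel has bounded mass in its first argument as well.\<close>

lemma schur: "(\<integral>\<^sup>+x\<in>\<Omega>. ennreal (kernel \<eta> x z) \<partial>lborel) \<le> ennreal schur_const"
proof (cases "\<delta> z > 0")
  \<comment> \<open>The point \<open>z\<close> may lie outside \<open>\<Omega>\<close>, where
    positivity of \<open>\<delta>\<close> is not assumed. No kernel reaches such a point:
    \<open>norm (z - x) \<le> \<delta> x\<close> would force
    \<open>\<delta> z \<ge> \<delta> x / 2 > 0\<close>.\<close>
  case False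
  have "kernel \<eta> x z = 0" if "x \<in> \<Omega>" for x
  proof (rule ccontr)
    assume "kernel \<eta> x z \<noteq> 0"
    then have "norm (z - x) \<le> \<delta> x" using kernel_nonzero_dist[OF eta_outside that] by simp
    then show False using delta_lipschitz[of z x] False delta_pos[OF that] by linarith
  qed
  then have "(\<integral>\<^sup>+x\<in>\<Omega>. ennreal (kernel \<eta> x z) \<partial>lborel) = (\<integral>\<^sup>+x. 0 \<partial>(lborel :: 'a measure))"
    by (intro nn_integral_cong) (auto split: split_indicator)
  then show ?thesis by simp
next
  case True
  let ?c = "(2 / \<delta> z) ^ DIM('a) * H"
  have "(\<integral>\<^sup>+x\<in>\<Omega>. ennreal (kernel \<eta> x z) \<partial>lborel) \<le> (\<integral>\<^sup>+x. ennreal ?c * indicator (ball z (3 * \<delta> z)) x \<partial>lborel)"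
  proof (rule nn_integral_mono)
    fix x
    show "ennreal (kernel \<eta> x z) * indicator \<Omega> x \<le> ennreal ?c * indicator (ball z (3 * \<delta> z)) x"
    proof (cases "x \<in> \<Omega> \<and> kernel \<eta> x z \<noteq> 0")
      case x: True
      then have n: "norm (z - x) \<le> \<delta> x" using kernel_nonzero_dist[OF eta_outside] by simp
      then have d: "\<delta> x \<le> 2 * \<delta> z" "\<delta> z \<le> 2 * \<delta> x" using delta_lipschitz[of z x] by linarith+
      then have "1 / \<delta> x \<le> 2 / \<delta> z" using True delta_pos[of x] x by (simp add: field_simps)
      then have "(1 / \<delta> x) ^ DIM('a) * H \<le> ?c"
        using delta_pos[of x] x H_nonneg by (intro mult_right_mono power_mono) auto
      then have "kernel \<eta> x z \<le> ?c" using kernel_le[of x z] x by simp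
      moreover have "x \<in> ball z (3 * \<delta> z)" using n d True by (simp add: dist_norm)
      ultimately show ?thesis using x by (simp add: ennreal_leI)
    qed (auto split: split_indicator)
  qed
  also have "\<dots> = ennreal ?c * ennreal ((3 * \<delta> z) ^ DIM('a) * measure lborel (ball (0 :: 'a) 1))"
  proof -
    have "emeasure lborel (ball z (3 * \<delta> z)) = ennreal (measure lborel (ball z (3 * \<delta> z)))"
      using emeasure_lborel_ball_finite[of z "3 * \<delta> z"] by (intro emeasure_eq_ennreal_measure) auto
    then show ?thesis
      using True content_ball_conv_unit_ball[of "3 * \<delta> z" z] by (simp add: nn_integral_cmult_indicator)
  qed
  also have "\<dots> = ennreal schur_const"
  proof -
    have 6: "(2 / \<delta> z) ^ DIM('a) * (3 * \<delta> z) ^ DIM('a) = 6 ^ DIM('a)"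
    proof -
      have "(2 / \<delta> z) * (3 * \<delta> z) = 6" using True by simp
      then show ?thesis by (simp only: power_mult_distrib[symmetric])
    qed
    have "?c * ((3 * \<delta> z) ^ DIM('a) * measure lborel (ball (0 :: 'a) 1)) =
        ((2 / \<delta> z) ^ DIM('a) * (3 * \<delta> z) ^ DIM('a)) * H * measure lborel (ball (0 :: 'a) 1)"
      by (simp only: mult_ac)
    also have "\<dots> = schur_const" unfolding 6 schur_const_def ..
    finally show ?thesis using True H_nonneg by (simp flip: ennreal_mult)
  qed
  finally show ?thesis .
qed

text \<open>\<open>Q\<close> is kept general to cover both uses: a density with respect to
  \<open>lborel\<close>, and a variation measure, which lives on the restricted sigma-algebra of
  \<open>\<Omega>\<close>.\<close>

lemma kernel_measurable_pair:
  assumes "(\<lambda>z. z) \<in> Q \<rightarrow>\<^sub>M borel"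
  shows "(\<lambda>(x, z). ennreal (kernel \<eta> x z) * indicator \<Omega> x) \<in> borel_measurable (lborel \<Otimes>\<^sub>M Q)"
proof -
  have [measurable]: "\<Omega> \<in> sets borel" using open_\<Omega> by simp
  have k: "(\<lambda>(x, z). ennreal (kernel \<eta> x z) * indicator \<Omega> x) \<in> borel_measurable (borel \<Otimes>\<^sub>M borel)"
    unfolding kernel_def by measurable
  have "(\<lambda>p. (fst p, snd p)) \<in> lborel \<Otimes>\<^sub>M Q \<rightarrow>\<^sub>M borel \<Otimes>\<^sub>M borel"
    by (intro measurable_Pair measurable_compose[OF measurable_snd assms]) simp
  from measurable_compose[OF this k] show ?thesis by (simp add: case_prod_beta)
qed

lemma kernel_nn_integral_measurable:
  assumes "sigma_finite_measure Q" "(\<lambda>z. z) \<in> Q \<rightarrow>\<^sub>M borel"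
  shows "(\<lambda>x. (\<integral>\<^sup>+z. ennreal (kernel \<eta> x z) \<partial>Q) * indicator \<Omega> x) \<in> borel_measurable lborel"
proof -
  interpret sigma_finite_measure Q by fact
  have "(\<lambda>x. \<integral>\<^sup>+z. ennreal (kernel \<eta> x z) * indicator \<Omega> x \<partial>Q) \<in> borel_measurable lborel"
    using kernel_measurable_pair[OF assms(2)] by (rule borel_measurable_nn_integral)
  also have "(\<lambda>x. \<integral>\<^sup>+z. ennreal (kernel \<eta> x z) * indicator \<Omega> x \<partial>Q) = (\<lambda>x. (\<integral>\<^sup>+z. ennreal (kernel \<eta> x z) \<partial>Q) * indicator \<Omega> x)"
    by (auto simp: fun_eq_iff split: split_indicator)
  finally show ?thesis .
qed

text \<open>Smoothing a measure multiplies its mass by at most \<open>schur_const\<close>. After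
  exchanging the integrals, \<open>schur\<close> bounds the inner one.\<close>

lemma kernel_tonelli:
  assumes Q: "sigma_finite_measure Q" "(\<lambda>z. z) \<in> Q \<rightarrow>\<^sub>M borel"
  shows "(\<integral>\<^sup>+x\<in>\<Omega>. (\<integral>\<^sup>+z. ennreal (kernel \<eta> x z) \<partial>Q) \<partial>lborel) \<le> ennreal schur_const * emeasure Q (space Q)"
proof -
  interpret Q: sigma_finite_measure Q by fact
  interpret pair_sigma_finite lborel Q ..
  have "(\<integral>\<^sup>+x\<in>\<Omega>. (\<integral>\<^sup>+z. ennreal (kernel \<eta> x z) \<partial>Q) \<partial>lborel) =
      (\<integral>\<^sup>+x. (\<integral>\<^sup>+z. ennreal (kernel \<eta> x z) * indicator \<Omega> x \<partial>Q) \<partial>lborel)"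
    by (intro nn_integral_cong) (auto split: split_indicator)
  also have "\<dots> = (\<integral>\<^sup>+z. (\<integral>\<^sup>+x. ennreal (kernel \<eta> x z) * indicator \<Omega> x \<partial>lborel) \<partial>Q)"
    using Fubini[OF kernel_measurable_pair[OF Q(2)]] by simp
  also have "\<dots> \<le> (\<integral>\<^sup>+z. ennreal schur_const \<partial>Q)"
    by (intro nn_integral_mono schur)
  finally show ?thesis by simp
qed

lemma mollify_nn_integral_le:
  assumes u: "integrable lborel u"
  shows "(\<integral>\<^sup>+x\<in>\<Omega>. ennreal \<bar>mollify u x\<bar> \<partial>lborel) \<le> ennreal schur_const * (\<integral>\<^sup>+z. ennreal \<bar>u z\<bar> \<partial>lborel)"
proof -
  define Q where "Q = density lborel (\<lambda>z. ennreal \<bar>u z\<bar>)"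
  have [measurable]: "u \<in> borel_measurable borel" using u by auto
  have [measurable]: "kernel \<eta> x \<in> borel_measurable borel" for x unfolding kernel_def[abs_def] by measurable
  have em: "emeasure Q (space Q) = (\<integral>\<^sup>+z. ennreal \<bar>u z\<bar> \<partial>lborel)"
    unfolding Q_def by (subst emeasure_density) (auto intro!: nn_integral_cong)
  have "finite_measure Q"
  proof
    show "emeasure Q (space Q) \<noteq> \<infinity>"
      unfolding em using u by (auto simp: integrable_iff_bounded)
  qed
  then have sf: "sigma_finite_measure Q" by (rule finite_measure.axioms)
  have id: "(\<lambda>z. z) \<in> Q \<rightarrow>\<^sub>M borel" by (simp add: Q_def)
  have "(\<integral>\<^sup>+x\<in>\<Omega>. ennreal \<bar>mollify u x\<bar> \<partial>lborel) \<le> (\<integral>\<^sup>+x\<in>\<Omega>. (\<integral>\<^sup>+z. ennreal (kernel \<eta> x z) \<partial>Q) \<partial>lborel)"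
  proof (intro nn_integral_mono)
    fix x
    show "ennreal \<bar>mollify u x\<bar> * indicator \<Omega> x \<le> (\<integral>\<^sup>+z. ennreal (kernel \<eta> x z) \<partial>Q) * indicator \<Omega> x"
    proof (cases "x \<in> \<Omega>")
      case True
      have "ennreal \<bar>mollify u x\<bar> \<le> (\<integral>\<^sup>+z. ennreal (norm (u z * kernel \<eta> x z)) \<partial>lborel)"
        unfolding mollify_def real_norm_def[symmetric] by (rule ennreal_norm_integral_le)
      also have "\<dots> = (\<integral>\<^sup>+z. ennreal \<bar>u z\<bar> * ennreal (kernel \<eta> x z) \<partial>lborel)"
        using kernel_nonneg[OF True] by (intro nn_integral_cong) (simp add: abs_mult ennreal_mult)
      also have "\<dots> = (\<integral>\<^sup>+z. ennreal (kernel \<eta> x z) \<partial>Q)"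
        unfolding Q_def by (rule nn_integral_density[symmetric]) auto
      finally show ?thesis using True by simp
    qed simp
  qed
  also have "\<dots> \<le> ennreal schur_const * emeasure Q (space Q)" by (rule kernel_tonelli[OF sf id])
  finally show ?thesis by (simp add: em)
qed

lemma kernel_integral_eq_1:
  assumes x: "x \<in> \<Omega>"
  shows "(LINT z|lborel. kernel \<eta> x z) = 1" and "integrable lborel (kernel \<eta> x)"
proof -
  have d: "\<delta> x > 0" by (rule delta_pos[OF x])
  have [measurable]: "kernel \<eta> x \<in> borel_measurable borel" unfolding kernel_def[abs_def] by measurable
  have "(LINT z|lborel. kernel \<eta> x z) = \<delta> x ^ DIM('a) * (LINT y|lborel. kernel \<eta> x (x + \<delta> x *\<^sub>R y))"
    by (rule integral_lborel_affine[OF d]) simp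
  also have "\<dots> = 1"
    using d by (simp add: kernel_def eta_integral power_one_over)
  finally show 1: "(LINT z|lborel. kernel \<eta> x z) = 1" .
  \<comment> \<open>A nonintegrable function would have integral 0, not 1.\<close>
  then show "integrable lborel (kernel \<eta> x)"
    using not_integrable_integral_eq by fastforce
qed

text \<open>The kernel has mass one and reaches no further than \<open>\<tau>\<close>, so only the
  oscillation of \<open>g\<close> at that scale matters. As \<open>\<tau> \<le> 1\<close>, both
  functions vanish beyond radius \<open>R + 1\<close>, which confines the error to a set of finite
  measure.\<close>

lemma mollify_close:
  assumes g: "integrable lborel g" "\<And>z. z \<notin> cball 0 R \<Longrightarrow> g z = 0"
    and e: "\<And>x z. norm (z - x) \<le> \<tau> \<Longrightarrow> \<bar>g z - g x\<bar> \<le> e" and \<tau>: "\<tau> \<le> 1" and x: "x \<in> \<Omega>"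
  shows "\<bar>mollify g x - g x\<bar> \<le> e * indicator (cball 0 (R + 1)) x"
proof (cases "x \<in> cball 0 (R + 1)")
  case True
  have k: "integrable lborel (\<lambda>z. g z * kernel \<eta> x z)"
    using kernel_integral.k_int[OF mollify_kernel_integral[OF g(1)] x] .
  have "mollify g x - g x = (LINT z|lborel. g z * kernel \<eta> x z) - (LINT z|lborel. g x * kernel \<eta> x z)"
    using kernel_integral_eq_1[OF x] by (simp add: mollify_def)
  also have "\<dots> = (LINT z|lborel. (g z - g x) * kernel \<eta> x z)"
    using k kernel_integral_eq_1[OF x] by (simp add: left_diff_distrib)
  finally have "\<bar>mollify g x - g x\<bar> = norm (LINT z|lborel. (g z - g x) * kernel \<eta> x z)" by simp
  also have "\<dots> \<le> (LINT z|lborel. e * kernel \<eta> x z)"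
  proof (rule Bochner_Integration.integral_norm_bound_integral)
    show "integrable lborel (\<lambda>z. (g z - g x) * kernel \<eta> x z)"
      using k kernel_integral_eq_1[OF x] by (simp add: left_diff_distrib)
    show "integrable lborel (\<lambda>z. e * kernel \<eta> x z)" using kernel_integral_eq_1[OF x] by simp
    fix z
    show "norm ((g z - g x) * kernel \<eta> x z) \<le> e * kernel \<eta> x z"
    proof (cases "kernel \<eta> x z = 0")
      case False
      then have "norm (z - x) \<le> \<tau>"
        using kernel_nonzero_dist[OF eta_outside x] delta_le[of x] by fastforce
      then show ?thesis using e[of z x] kernel_nonneg[OF x, of z] by (simp add: abs_mult mult_right_mono)
    qed simp
  qed
  also have "\<dots> = e" using kernel_integral_eq_1[OF x] by simp
  finally show ?thesis using True by simp
next
  case False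
  have z: "g z * kernel \<eta> x z = 0" for z
  proof (cases "kernel \<eta> x z = 0")
    case k: False
    then have "norm (z - x) \<le> 1"
      using kernel_nonzero_dist[OF eta_outside x] delta_le[of x] \<tau> by fastforce
    then have "z \<notin> cball 0 R" using False norm_triangle_ineq2[of x z] by (simp add: norm_minus_commute)
    then show ?thesis using g(2) by simp
  qed simp
  have "mollify g x = 0" unfolding mollify_def z by simp
  moreover have "g x = 0" using False by (intro g(2)) auto
  ultimately show ?thesis using False by simp
qed

text \<open>Lets all kernels produced by the width derivative be estimated by the single kernel of
  \<open>\<eta>\<close>.\<close>

lemma moment_le: "b \<in> Basis \<Longrightarrow> \<bar>moment b y\<bar> \<le> \<eta> y"
proof (cases "norm y \<ge> 1")
  case False
  assume "b \<in> Basis"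
  then have "\<bar>y \<bullet> b\<bar> \<le> 1" using Basis_le_norm[of b y] False by simp
  then show ?thesis using mult_right_mono[of "\<bar>y \<bullet> b\<bar>" 1 "\<eta> y"] eta_nonneg[of y]
    by (simp add: moment_def abs_mult)
qed (simp add: moment_def eta_outside)

lemma kernel_abs_le:
  assumes "\<And>y. \<bar>\<rho> y\<bar> \<le> \<eta> y" "x \<in> \<Omega>"
  shows "\<bar>kernel \<rho> x z\<bar> \<le> kernel \<eta> x z"
  using delta_pos[OF assms(2)] assms(1) by (simp add: kernel_def abs_mult divide_right_mono power_one_over)

lemma signed_integral_kernel_le:
  assumes "\<And>y. \<bar>\<rho> y\<bar> \<le> \<eta> y" "x \<in> \<Omega>"
  shows "ennreal \<bar>signed_integral \<Omega> \<nu> (kernel \<rho> x)\<bar> \<le>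
    (\<integral>\<^sup>+z. ennreal (kernel \<eta> x z) \<partial>positive_variation \<Omega> \<nu>) +
    (\<integral>\<^sup>+z. ennreal (kernel \<eta> x z) \<partial>positive_variation \<Omega> (\<lambda>E. - \<nu> E))"
proof -
  have "ennreal \<bar>signed_integral \<Omega> \<nu> (kernel \<rho> x)\<bar> \<le>
      ennreal (norm (LINT z|positive_variation \<Omega> \<nu>. kernel \<rho> x z) +
        norm (LINT z|positive_variation \<Omega> (\<lambda>E. - \<nu> E). kernel \<rho> x z))"
    unfolding signed_integral_def by (intro ennreal_leI) (simp add: abs_triangle_ineq4)
  also have "\<dots> \<le> (\<integral>\<^sup>+z. ennreal (norm (kernel \<rho> x z)) \<partial>positive_variation \<Omega> \<nu>) +
      (\<integral>\<^sup>+z. ennreal (norm (kernel \<rho> x z)) \<partial>positive_variation \<Omega> (\<lambda>E. - \<nu> E))"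
    by (subst ennreal_plus) (auto intro!: add_mono ennreal_norm_integral_le[where 'b = real, unfolded real_norm_def])
  also have "\<dots> \<le> (\<integral>\<^sup>+z. ennreal (kernel \<eta> x z) \<partial>positive_variation \<Omega> \<nu>) +
    (\<integral>\<^sup>+z. ennreal (kernel \<eta> x z) \<partial>positive_variation \<Omega> (\<lambda>E. - \<nu> E))"
    using kernel_abs_le[OF assms] by (intro add_mono nn_integral_mono ennreal_leI) auto
  finally show ?thesis .
qed

text \<open>Each component of the gradient is a combination of kernels integrated against the
  components of Du. Pointwise it is bounded by the smoothed variation measures, and
  \<open>kernel_tonelli\<close> turns this into a bound by their total masses, independent of the
  width.\<close>

lemma mollify_gradient_nn_integral_le:
  assumes u: "integrable lborel u"
    and \<nu>: "\<And>b. b \<in> Basis \<Longrightarrow> signed_measure_on \<Omega> (\<nu> b)"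
    and parts: "\<And>\<psi> b. \<psi> \<in> test_functions \<Omega> \<Longrightarrow> b \<in> Basis \<Longrightarrow>
      (LINT z|lborel. u z * (gradient \<psi> z \<bullet> b)) = - signed_integral \<Omega> (\<nu> b) \<psi>"
  shows "(\<integral>\<^sup>+x\<in>\<Omega>. ennreal (norm (gradient (mollify u) x)) \<partial>lborel) \<le>
    ennreal ((1 + DIM('a)) * schur_const *
      (\<Sum>b\<in>Basis. measure (positive_variation \<Omega> (\<nu> b)) \<Omega> + measure (positive_variation \<Omega> (\<lambda>E. - \<nu> b E)) \<Omega>))"
proof -
  let ?m = "DIM('a)"
  define S where "S b \<psi> = signed_integral \<Omega> (\<nu> b) \<psi>" for b \<psi>
  define P N where "P b = positive_variation \<Omega> (\<nu> b)" and "N b = positive_variation \<Omega> (\<lambda>E. - \<nu> b E)" for b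
  define T where "T b x = (\<integral>\<^sup>+z. ennreal (kernel \<eta> x z) \<partial>P b) + (\<integral>\<^sup>+z. ennreal (kernel \<eta> x z) \<partial>N b)" for b x
  have fin: "finite_measure (P b)" "finite_measure (N b)" if "b \<in> Basis" for b
    using signed_measure_on.finite_positive_variation[OF \<nu>[OF that]]
      signed_measure_on.finite_positive_variation[OF signed_measure_on.uminus[OF \<nu>[OF that]]] open_\<Omega>
    by (auto simp: P_def N_def)
  have id: "(\<lambda>z. z) \<in> P b \<rightarrow>\<^sub>M borel" "(\<lambda>z. z) \<in> N b \<rightarrow>\<^sub>M borel" for b
    unfolding P_def N_def measurable_cong_sets[OF sets_positive_variation refl]
    by (auto intro: measurable_restrict_space1)
  have sp: "space (P b) = \<Omega>" "space (N b) = \<Omega>" for b by (simp_all add: P_def N_def space_positive_variation)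
  note sf = fin[THEN finite_measure.axioms(1)]
  have test: "kernel \<eta> x \<in> test_functions \<Omega>" "kernel (moment b) x \<in> test_functions \<Omega>" if "x \<in> \<Omega>" for x b
    using that eta_outside moment_outside by (auto intro!: kernel_test_function eta_smooth moment_smooth)
  have int: "integrable lborel (\<lambda>z. u z * (gradient \<psi> z \<bullet> b))" if "\<psi> \<in> test_functions \<Omega>" for \<psi> b
  proof -
    interpret \<psi>: C1_compact \<psi> "closure {x. \<psi> x \<noteq> 0}" by (rule test_function_C1_compact[OF that])
    obtain B where B: "\<And>z. norm (gradient \<psi> z) \<le> B" using \<psi>.bounded_gradient by blast
    have "integrable lborel (\<lambda>z. u z *\<^sub>R gradient \<psi> z)"
      using borel_measurable_continuous_onI[OF \<psi>.cont_grad] B by (intro integrable_mult_bounded[OF u]) auto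
    from integrable_inner_left[of b, OF this] show ?thesis by simp
  qed
  have comp: "gradient (mollify u) x \<bullet> i = S i (kernel \<eta> x) + (gradient \<delta> x \<bullet> i) * (\<Sum>b\<in>Basis. S b (kernel (moment b) x))"
    if x: "x \<in> \<Omega>" and i: "i \<in> Basis" for x i
  proof -
    have "integrable lborel (\<lambda>z. u z *\<^sub>R dkernel x z)"
      by (rule kernel_integral.g_int[OF mollify_kernel_integral[OF u] x])
    then have "gradient (mollify u) x \<bullet> i = (LINT z|lborel. (u z *\<^sub>R dkernel x z) \<bullet> i)"
      using integral_inner_left[of i lborel "\<lambda>z. u z *\<^sub>R dkernel x z"] by (simp only: mollify_C1(2)[OF u x])
    also have "\<dots> = (LINT z|lborel. - (u z * (gradient (kernel \<eta> x) z \<bullet> i)) -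
        (gradient \<delta> x \<bullet> i) * (\<Sum>b\<in>Basis. u z * (gradient (kernel (moment b) x) z \<bullet> b)))"
      by (intro Bochner_Integration.integral_cong refl)
        (simp add: dkernel_inner[OF i] sum_distrib_left[symmetric] right_diff_distrib mult.left_commute)
    also have "\<dots> = - (LINT z|lborel. u z * (gradient (kernel \<eta> x) z \<bullet> i)) -
        (gradient \<delta> x \<bullet> i) * (\<Sum>b\<in>Basis. LINT z|lborel. u z * (gradient (kernel (moment b) x) z \<bullet> b))"
      using int[OF test(1)[OF x]] int[OF test(2)[OF x]]
      by (subst Bochner_Integration.integral_diff) (auto simp: Bochner_Integration.integral_sum)
    also have "\<dots> = S i (kernel \<eta> x) + (gradient \<delta> x \<bullet> i) * (\<Sum>b\<in>Basis. S b (kernel (moment b) x))"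
      using parts[OF test(1)[OF x] i] parts[OF test(2)[OF x]] by (simp add: S_def sum_negf)
    finally show ?thesis .
  qed
  have pointwise: "ennreal (norm (gradient (mollify u) x)) \<le> ennreal (1 + ?m) * (\<Sum>b\<in>Basis. T b x)" if x: "x \<in> \<Omega>" for x
  proof -
    have "norm (gradient (mollify u) x) \<le> (\<Sum>i\<in>Basis. \<bar>gradient (mollify u) x \<bullet> i\<bar>)" by (rule norm_le_l1)
    \<comment> \<open>The moment sum does not depend on \<open>i\<close>, so summing over the
      components repeats it once per dimension. This explains the factor 1 + m.\<close>
    also have "\<dots> \<le> (\<Sum>i\<in>Basis. \<bar>S i (kernel \<eta> x)\<bar> + (\<Sum>b\<in>Basis. \<bar>S b (kernel (moment b) x)\<bar>))"
    proof (rule sum_mono)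
      fix i :: 'a assume i: "i \<in> Basis"
      have "\<bar>gradient \<delta> x \<bullet> i\<bar> \<le> 1" using Basis_le_norm[OF i, of "gradient \<delta> x"] delta_gradient_le[of x] by linarith
      then have "\<bar>(gradient \<delta> x \<bullet> i) * (\<Sum>b\<in>Basis. S b (kernel (moment b) x))\<bar> \<le> 1 * (\<Sum>b\<in>Basis. \<bar>S b (kernel (moment b) x)\<bar>)"
        unfolding abs_mult by (intro mult_mono sum_abs) auto
      then show "\<bar>gradient (mollify u) x \<bullet> i\<bar> \<le> \<bar>S i (kernel \<eta> x)\<bar> + (\<Sum>b\<in>Basis. \<bar>S b (kernel (moment b) x)\<bar>)"
        unfolding comp[OF x i] by linarith
    qed
    also have "\<dots> = (\<Sum>i\<in>Basis. \<bar>S i (kernel \<eta> x)\<bar>) + ?m * (\<Sum>b\<in>Basis. \<bar>S b (kernel (moment b) x)\<bar>)"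
      by (simp add: sum.distrib)
    finally have "ennreal (norm (gradient (mollify u) x)) \<le>
        ennreal ((\<Sum>i\<in>Basis. \<bar>S i (kernel \<eta> x)\<bar>) + ?m * (\<Sum>b\<in>Basis. \<bar>S b (kernel (moment b) x)\<bar>))"
      by (rule ennreal_leI)
    also have "\<dots> = (\<Sum>i\<in>Basis. ennreal \<bar>S i (kernel \<eta> x)\<bar>) + ennreal ?m * (\<Sum>b\<in>Basis. ennreal \<bar>S b (kernel (moment b) x)\<bar>)"
      by (simp add: sum_nonneg ennreal_mult sum_ennreal)
    also have "\<dots> \<le> (\<Sum>b\<in>Basis. T b x) + ennreal ?m * (\<Sum>b\<in>Basis. T b x)"
      unfolding S_def T_def P_def N_def
      by (intro add_mono mult_left_mono sum_mono signed_integral_kernel_le x moment_le) (auto simp: eta_nonneg)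
    also have "\<dots> = ennreal (1 + ?m) * (\<Sum>b\<in>Basis. T b x)"
      by (simp add: distrib_right)
    finally show ?thesis .
  qed
  have meas: "(\<lambda>x. (\<integral>\<^sup>+z. ennreal (kernel \<eta> x z) \<partial>P b) * indicator \<Omega> x) \<in> borel_measurable lborel"
    "(\<lambda>x. (\<integral>\<^sup>+z. ennreal (kernel \<eta> x z) \<partial>N b) * indicator \<Omega> x) \<in> borel_measurable lborel" if "b \<in> Basis" for b
    using kernel_nn_integral_measurable[OF sf(1)[OF that] id(1)] kernel_nn_integral_measurable[OF sf(2)[OF that] id(2)] .
  have "(\<integral>\<^sup>+x\<in>\<Omega>. ennreal (norm (gradient (mollify u) x)) \<partial>lborel) \<le>
      (\<integral>\<^sup>+x. ennreal (1 + ?m) * (\<Sum>b\<in>Basis. (\<integral>\<^sup>+z. ennreal (kernel \<eta> x z) \<partial>P b) * indicator \<Omega> x +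
        (\<integral>\<^sup>+z. ennreal (kernel \<eta> x z) \<partial>N b) * indicator \<Omega> x) \<partial>lborel)"
    using pointwise unfolding T_def by (intro nn_integral_mono) (auto split: split_indicator)
  also have "\<dots> = ennreal (1 + ?m) * (\<Sum>b\<in>Basis. (\<integral>\<^sup>+x\<in>\<Omega>. (\<integral>\<^sup>+z. ennreal (kernel \<eta> x z) \<partial>P b) \<partial>lborel) +
        (\<integral>\<^sup>+x\<in>\<Omega>. (\<integral>\<^sup>+z. ennreal (kernel \<eta> x z) \<partial>N b) \<partial>lborel))"
  proof -
    let ?p = "\<lambda>b x. (\<integral>\<^sup>+z. ennreal (kernel \<eta> x z) \<partial>P b) * indicator \<Omega> x"
      and ?n = "\<lambda>b x. (\<integral>\<^sup>+z. ennreal (kernel \<eta> x z) \<partial>N b) * indicator \<Omega> x"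
    have "(\<integral>\<^sup>+x. ennreal (1 + ?m) * (\<Sum>b\<in>Basis. ?p b x + ?n b x) \<partial>lborel) =
        ennreal (1 + ?m) * (\<integral>\<^sup>+x. (\<Sum>b\<in>Basis. ?p b x + ?n b x) \<partial>lborel)"
      by (intro nn_integral_cmult borel_measurable_sum borel_measurable_add meas)
    also have "(\<integral>\<^sup>+x. (\<Sum>b\<in>Basis. ?p b x + ?n b x) \<partial>lborel) = (\<Sum>b\<in>Basis. \<integral>\<^sup>+x. ?p b x + ?n b x \<partial>lborel)"
      by (intro nn_integral_sum borel_measurable_add meas)
    also have "\<dots> = (\<Sum>b\<in>Basis. (\<integral>\<^sup>+x. ?p b x \<partial>lborel) + (\<integral>\<^sup>+x. ?n b x \<partial>lborel))"
      by (intro sum.cong refl nn_integral_add meas)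
    finally show ?thesis .
  qed
  also have "\<dots> \<le> ennreal (1 + ?m) * (\<Sum>b\<in>Basis. ennreal schur_const * emeasure (P b) \<Omega> + ennreal schur_const * emeasure (N b) \<Omega>)"
    using kernel_tonelli[OF sf(1) id(1)] kernel_tonelli[OF sf(2) id(2)]
    by (intro mult_left_mono sum_mono add_mono) (auto simp: sp)
  also have "\<dots> = ennreal (1 + ?m) * (\<Sum>b\<in>Basis. ennreal (schur_const * (measure (P b) \<Omega> + measure (N b) \<Omega>)))"
    using fin[THEN finite_measure.emeasure_eq_measure] schur_const_nonneg
    by (intro arg_cong2[where f = "(*)"] refl sum.cong) (simp_all add: ennreal_mult distrib_left)
  also have "\<dots> = ennreal ((1 + ?m) * schur_const * (\<Sum>b\<in>Basis. measure (P b) \<Omega> + measure (N b) \<Omega>))"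
  proof -
    have "(\<Sum>b\<in>Basis. ennreal (schur_const * (measure (P b) \<Omega> + measure (N b) \<Omega>))) =
        ennreal (schur_const * (\<Sum>b\<in>Basis. measure (P b) \<Omega> + measure (N b) \<Omega>))"
      using schur_const_nonneg by (subst sum_ennreal) (auto simp: sum_distrib_left)
    moreover have "0 \<le> schur_const * (\<Sum>b\<in>Basis. measure (P b) \<Omega> + measure (N b) \<Omega>)"
      using schur_const_nonneg by (intro mult_nonneg_nonneg sum_nonneg) auto
    ultimately show ?thesis
      by (simp only: ennreal_mult[symmetric] of_nat_0_le_iff mult.assoc)
  qed
  finally show ?thesis by (simp add: P_def N_def)
qed

end

section \<open>Approximation in L1\<close>

lemma compact_support_integrable:
  fixes g :: "'a::euclidean_space \<Rightarrow> real"
  assumes "continuous_on UNIV g" "\<And>x. x \<notin> cball 0 R \<Longrightarrow> g x = 0"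
  shows "integrable lborel g"
proof -
  have "integrable lborel (\<lambda>x. indicator (cball 0 R) x *\<^sub>R g x)"
    by (intro borel_integrable_compact continuous_on_subset[OF assms(1)]) auto
  also have "(\<lambda>x. indicator (cball 0 R) x *\<^sub>R g x) = g"
    using assms(2) by (auto simp: fun_eq_iff split: split_indicator)
  finally show ?thesis .
qed

text \<open>Density of C_c in L1, phrased as a property of one function so that it can be proved by
  induction over integrable functions.\<close>

definition L1_approx :: "('a::euclidean_space \<Rightarrow> real) \<Rightarrow> bool" where
  "L1_approx f \<longleftrightarrow> (\<forall>e>0. \<exists>g R. continuous_on UNIV g \<and> (\<forall>x. x \<notin> cball 0 R \<longrightarrow> g x = 0) \<and>
     (LINT x|lborel. \<bar>f x - g x\<bar>) \<le> e)"

lemma L1_approx_closed: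
  assumes f: "integrable lborel f" and s: "\<And>i. integrable lborel (s i)" "\<And>i. L1_approx (s i)"
    and lim: "(\<lambda>i. LINT x|lborel. \<bar>f x - s i x\<bar>) \<longlonglongrightarrow> 0"
  shows "L1_approx f"
  unfolding L1_approx_def
proof (intro allI impI)
  fix e :: real assume e: "e > 0"
  have "eventually (\<lambda>i. (LINT x|lborel. \<bar>f x - s i x\<bar>) < e / 2) sequentially"
    using lim e by (intro order_tendstoD) auto
  then obtain i where i: "(LINT x|lborel. \<bar>f x - s i x\<bar>) < e / 2" by (auto simp: eventually_sequentially)
  obtain g R where g: "continuous_on UNIV g" "\<And>x. x \<notin> cball 0 R \<Longrightarrow> g x = 0" "(LINT x|lborel. \<bar>s i x - g x\<bar>) \<le> e / 2"
    using s(2)[of i] e unfolding L1_approx_def by (metis half_gt_zero)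
  have gi: "integrable lborel g" by (rule compact_support_integrable[OF g(1,2)])
  have "(LINT x|lborel. \<bar>f x - g x\<bar>) \<le> (LINT x|lborel. \<bar>f x - s i x\<bar> + \<bar>s i x - g x\<bar>)"
    using f s(1) gi by (intro integral_mono) auto
  also have "\<dots> = (LINT x|lborel. \<bar>f x - s i x\<bar>) + (LINT x|lborel. \<bar>s i x - g x\<bar>)"
    using f s(1) gi by (intro Bochner_Integration.integral_add) auto
  finally have "(LINT x|lborel. \<bar>f x - g x\<bar>) \<le> e" using i g(3) by linarith
  then show "\<exists>g R. continuous_on UNIV g \<and> (\<forall>x. x \<notin> cball 0 R \<longrightarrow> g x = 0) \<and> (LINT x|lborel. \<bar>f x - g x\<bar>) \<le> e"
    using g by blast
qed

lemma tendsto_L1_dominated: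
  fixes f :: "'a \<Rightarrow> real"
  assumes "integrable M w" "f \<in> borel_measurable M" "\<And>i. s i \<in> borel_measurable M"
    "\<And>x. (\<lambda>i. s i x) \<longlonglongrightarrow> f x" "\<And>i x. \<bar>f x - s i x\<bar> \<le> w x"
  shows "(\<lambda>i. LINT x|M. \<bar>f x - s i x\<bar>) \<longlonglongrightarrow> 0"
proof -
  have "(\<lambda>i. LINT x|M. \<bar>f x - s i x\<bar>) \<longlonglongrightarrow> (LINT x|M. 0)"
  proof (rule integral_dominated_convergence[where w = w])
    show "AE x in M. (\<lambda>i. \<bar>f x - s i x\<bar>) \<longlonglongrightarrow> 0"
    proof (rule AE_I2)
      fix x
      have "(\<lambda>i. \<bar>f x - s i x\<bar>) \<longlonglongrightarrow> \<bar>f x - f x\<bar>" by (intro tendsto_intros assms)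
      then show "(\<lambda>i. \<bar>f x - s i x\<bar>) \<longlonglongrightarrow> 0" by simp
    qed
  qed (use assms in auto)
  then show ?thesis by simp
qed

lemma L1_approx_compact:
  fixes K :: "'a::euclidean_space set"
  assumes K: "compact K"
  shows "L1_approx (\<lambda>x. indicator K x *\<^sub>R c)"
\<comment> \<open>The distance to the empty set is 0 by convention, so the distance cutoffs below
  would be constantly \<open>c\<close>.\<close>
proof (cases "K = {}")
  case True
  then show ?thesis unfolding L1_approx_def by (intro allI impI exI[of _ "\<lambda>_. 0"] exI[of _ 0]) auto
next
  case False
  obtain R where R: "\<And>x. x \<in> K \<Longrightarrow> norm x \<le> R"
    using compact_imp_bounded[OF K] by (auto simp: bounded_iff)
  define s where "s n x = c * max 0 (1 - real (Suc n) * infdist x K)" for n x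
  have s_cont: "continuous_on UNIV (s n)" for n unfolding s_def by (intro continuous_intros)
  have s_outside: "s n x = 0" if "x \<notin> cball 0 (R + 1)" for n x
  proof -
    have "1 \<le> dist x a" if "a \<in> K" for a
      using R[OF that] \<open>x \<notin> cball 0 (R + 1)\<close> norm_triangle_ineq2[of x a] by (simp add: dist_norm)
    then have "1 \<le> infdist x K" unfolding infdist_def using False by (auto intro: cINF_greatest)
    then have "1 * 1 \<le> real (Suc n) * infdist x K" by (intro mult_mono) auto
    then show ?thesis by (simp add: s_def)
  qed
  have si: "integrable lborel (s n)" for n using compact_support_integrable[OF s_cont s_outside] .
  have Kb: "K \<in> sets borel" using K by (simp add: compact_imp_closed)
  show ?thesis
  proof (rule L1_approx_closed[OF _ si])
    show "integrable lborel (\<lambda>x. indicator K x *\<^sub>R c)"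
      by (rule borel_integrable_compact[OF K]) auto
    show "L1_approx (s n)" for n
      unfolding L1_approx_def using s_cont s_outside by (intro allI impI exI[of _ "s n"] exI[of _ "R + 1"]) auto
    show "(\<lambda>n. LINT x|lborel. \<bar>indicator K x *\<^sub>R c - s n x\<bar>) \<longlonglongrightarrow> 0"
    proof (rule tendsto_L1_dominated[where w = "\<lambda>x. indicator (cball 0 (R + 1)) x *\<^sub>R \<bar>c\<bar>"])
      show "integrable lborel (\<lambda>x::'a. indicator (cball 0 (R + 1)) x *\<^sub>R \<bar>c\<bar>)"
        by (rule borel_integrable_compact) auto
      show "(\<lambda>x. indicator K x *\<^sub>R c) \<in> borel_measurable lborel" using Kb by simp
      show "s n \<in> borel_measurable lborel" for n using si by auto
      show "(\<lambda>n. s n x) \<longlonglongrightarrow> indicator K x *\<^sub>R c" for x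
      proof (cases "x \<in> K")
        case True
        then show ?thesis by (simp add: s_def)
      next
        case x: False
        then have d: "infdist x K > 0"
          using in_closed_iff_infdist_zero[OF compact_imp_closed[OF K] False, of x] infdist_nonneg[of x K] by linarith
        obtain N where N: "1 < real N * infdist x K" using d ex_less_of_nat_mult by blast
        have "s n x = 0" if "n \<ge> N" for n
        proof -
          have "real N * infdist x K \<le> real (Suc n) * infdist x K" using that d by (intro mult_right_mono) auto
          then show ?thesis using N by (simp add: s_def)
        qed
        then have "eventually (\<lambda>n. s n x = 0) sequentially" by (auto simp: eventually_sequentially)
        then show ?thesis using x by (simp add: tendsto_eventually)
      qed
      show "\<bar>indicator K x *\<^sub>R c - s n x\<bar> \<le> indicator (cball 0 (R + 1)) x *\<^sub>R \<bar>c\<bar>" for n x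
      proof (cases "x \<in> K")
        case True
        then show ?thesis using R[OF True] by (simp add: s_def)
      next
        case x: False
        have "\<bar>s n x\<bar> \<le> \<bar>c\<bar> * 1"
          unfolding s_def abs_mult by (intro mult_left_mono) (auto simp: infdist_nonneg)
        then show ?thesis using x s_outside[of x n] by (cases "x \<in> cball 0 (R + 1)") auto
      qed
    qed
  qed
qed

text \<open>Inner regularity reduces a set of finite measure to closed sets, balls reduce these to
  compact sets, and distance cutoffs handle the latter. \<open>L1_approx_closed\<close> passes every
  one of these reductions to the limit.\<close>

proposition integrable_L1_approx:
  fixes f :: "'a::euclidean_space \<Rightarrow> real"
  assumes "integrable lborel f"
  shows "L1_approx f"
  using assms
proof (induction rule: integrable_induct)
  case (base A c)
  have closed_case: "L1_approx (\<lambda>x. indicator T x *\<^sub>R c)" if T: "closed T" "T \<subseteq> A" for T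
  proof (rule L1_approx_closed[where s = "\<lambda>n x. indicator (T \<inter> cball 0 (real n)) x *\<^sub>R c"])
    have "emeasure lborel T < \<infinity>"
      using emeasure_mono[OF T(2), of lborel] base by (metis order_le_less_trans)
    then have i: "integrable lborel (\<lambda>x. indicator T x *\<^sub>R c)" for c :: real
      using T by (intro integrable_scaleR_left) auto
    then show "integrable lborel (\<lambda>x. indicator T x *\<^sub>R c)" .
    have cp: "compact (T \<inter> cball 0 (real n))" for n using T by (simp add: closed_Int_compact)
    then show "integrable lborel (\<lambda>x. indicator (T \<inter> cball 0 (real n)) x *\<^sub>R c)" for n
      by (rule borel_integrable_compact) auto
    show "L1_approx (\<lambda>x. indicator (T \<inter> cball 0 (real n)) x *\<^sub>R c)" for n by (rule L1_approx_compact[OF cp])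
    show "(\<lambda>n. LINT x|lborel. \<bar>indicator T x *\<^sub>R c - indicator (T \<inter> cball 0 (real n)) x *\<^sub>R c\<bar>) \<longlonglongrightarrow> 0"
    proof (rule tendsto_L1_dominated[OF i[of "\<bar>c\<bar>"]])
      show "(\<lambda>x. indicator T x *\<^sub>R c) \<in> borel_measurable lborel" using T by simp
      show "(\<lambda>x. indicator (T \<inter> cball 0 (real n)) x *\<^sub>R c) \<in> borel_measurable lborel" for n
        using borel_integrable_compact[OF cp, where f = "\<lambda>_. c"] by (intro borel_measurable_integrable) auto
      show "(\<lambda>n. indicator (T \<inter> cball 0 (real n)) x *\<^sub>R c) \<longlonglongrightarrow> indicator T x *\<^sub>R c" for x
      proof (rule tendsto_eventually)
        obtain N where "norm x \<le> real N" using real_arch_simple by blast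
        then show "eventually (\<lambda>n. indicator (T \<inter> cball 0 (real n)) x *\<^sub>R c = indicator T x *\<^sub>R c) sequentially"
          unfolding eventually_sequentially by (intro exI[of _ N]) (auto simp: indicator_def)
      qed
    qed (auto split: split_indicator)
  qed
  have "\<exists>T. closed T \<and> T \<subseteq> A \<and> emeasure lborel (A - T) < ennreal (1 / real (Suc n))" for n
  proof -
    obtain T where T: "closed T" "T \<subseteq> A" "emeasure lebesgue (A - T) < ennreal (1 / real (Suc n))"
      by (rule sets_lebesgue_inner_closed[of A "1 / real (Suc n)"]) (use base in auto)
    moreover have "emeasure lebesgue (A - T) = emeasure lborel (A - T)" using base T by simp
    ultimately show ?thesis by auto
  qed
  then obtain T where T: "\<And>n. closed (T n)" "\<And>n. T n \<subseteq> A"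
    "\<And>n. emeasure lborel (A - T n) < ennreal (1 / real (Suc n))" by metis
  have fin: "emeasure lborel (T n) < \<infinity>" for n
    using emeasure_mono[OF T(2), of lborel n] base by (metis order_le_less_trans)
  show ?case
  proof (rule L1_approx_closed[where s = "\<lambda>n x. indicator (T n) x *\<^sub>R c"])
    show "integrable lborel (\<lambda>x. indicator A x *\<^sub>R c)" using base by (intro integrable_scaleR_left) auto
    show "integrable lborel (\<lambda>x. indicator (T n) x *\<^sub>R c)" for n
      using fin T(1) by (intro integrable_scaleR_left) auto
    show "L1_approx (\<lambda>x. indicator (T n) x *\<^sub>R c)" for n by (rule closed_case[OF T(1,2)])
    have "(LINT x|lborel. \<bar>indicator A x *\<^sub>R c - indicator (T n) x *\<^sub>R c\<bar>) \<le> \<bar>c\<bar> * (1 / real (Suc n))" for n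
    proof -
      have "(LINT x|lborel. \<bar>indicator A x *\<^sub>R c - indicator (T n) x *\<^sub>R c\<bar>) = (LINT x|lborel. indicator (A - T n) x *\<^sub>R \<bar>c\<bar>)"
        using T(2)[of n] by (intro Bochner_Integration.integral_cong) (auto split: split_indicator)
      also have "\<dots> = measure lborel (A - T n) * \<bar>c\<bar>" by simp
      also have "\<dots> \<le> 1 / real (Suc n) * \<bar>c\<bar>"
      proof (rule mult_right_mono)
        show "measure lborel (A - T n) \<le> 1 / real (Suc n)"
          using T(3)[of n] by (simp add: measure_def enn2real_leI less_imp_le)
      qed simp
      finally show ?thesis by (simp only: mult.commute)
    qed
    then have le: "(LINT x|lborel. \<bar>indicator A x *\<^sub>R c - indicator (T n) x *\<^sub>R c\<bar>) \<le> \<bar>c\<bar> * inverse (real (Suc n))" for n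
      by (simp only: inverse_eq_divide)
    show "(\<lambda>n. LINT x|lborel. \<bar>indicator A x *\<^sub>R c - indicator (T n) x *\<^sub>R c\<bar>) \<longlonglongrightarrow> 0"
    proof (rule tendsto_sandwich[where f = "\<lambda>_. 0"])
      show "(\<lambda>n. \<bar>c\<bar> * inverse (real (Suc n))) \<longlonglongrightarrow> 0"
        by (rule tendsto_mult_right_zero[OF LIMSEQ_inverse_real_of_nat])
      show "\<forall>\<^sub>F n in sequentially. (LINT x|lborel. \<bar>indicator A x *\<^sub>R c - indicator (T n) x *\<^sub>R c\<bar>)
          \<le> \<bar>c\<bar> * inverse (real (Suc n))"
        by (intro always_eventually allI le)
      show "\<forall>\<^sub>F n in sequentially. 0 \<le> (LINT x|lborel. \<bar>indicator A x *\<^sub>R c - indicator (T n) x *\<^sub>R c\<bar>)"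
        by (intro always_eventually allI integral_nonneg_AE AE_I2 abs_ge_zero)
    qed (rule tendsto_const)
  qed
next
  case (add f g)
  show ?case
    unfolding L1_approx_def
  proof (intro allI impI)
    fix e :: real assume "e > 0"
    then have "e / 2 > 0" by simp
    have "L1_approx f" "L1_approx g" using add by auto
    obtain f' R where f': "continuous_on UNIV f'" "\<And>x. x \<notin> cball 0 R \<Longrightarrow> f' x = 0" "(LINT x|lborel. \<bar>f x - f' x\<bar>) \<le> e / 2"
      using \<open>L1_approx f\<close>[unfolded L1_approx_def] \<open>e / 2 > 0\<close> by blast
    obtain g' Q where g': "continuous_on UNIV g'" "\<And>x. x \<notin> cball 0 Q \<Longrightarrow> g' x = 0" "(LINT x|lborel. \<bar>g x - g' x\<bar>) \<le> e / 2"
      using \<open>L1_approx g\<close>[unfolded L1_approx_def] \<open>e / 2 > 0\<close> by blast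
    have i: "integrable lborel f'" "integrable lborel g'"
      by (rule compact_support_integrable[OF f'(1,2)], assumption)
        (rule compact_support_integrable[OF g'(1,2)], assumption)
    have "(LINT x|lborel. \<bar>f x + g x - (f' x + g' x)\<bar>) \<le> (LINT x|lborel. \<bar>f x - f' x\<bar> + \<bar>g x - g' x\<bar>)"
      using add i by (intro integral_mono) auto
    also have "\<dots> = (LINT x|lborel. \<bar>f x - f' x\<bar>) + (LINT x|lborel. \<bar>g x - g' x\<bar>)"
      using add i by (intro Bochner_Integration.integral_add) auto
    also have "\<dots> \<le> e" using f'(3) g'(3) by linarith
    finally have "(LINT x|lborel. \<bar>f x + g x - (f' x + g' x)\<bar>) \<le> e" .
    then show "\<exists>h R. continuous_on UNIV h \<and> (\<forall>x. x \<notin> cball 0 R \<longrightarrow> h x = 0) \<and> (LINT x|lborel. \<bar>f x + g x - h x\<bar>) \<le> e"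
      using f' g' by (intro exI[of _ "\<lambda>x. f' x + g' x"] exI[of _ "max R Q"]) (auto intro!: continuous_intros)
  qed
next
  case (lim f s)
  show ?case
  proof (rule L1_approx_closed[OF lim(4,1,5)])
    show "(\<lambda>i. LINT x|lborel. \<bar>f x - s i x\<bar>) \<longlonglongrightarrow> 0"
    \<comment> \<open>The induction rule supplies
      \<open>\<bar>s i x\<bar> \<le> 2 * \<bar>f x\<bar>\<close>, hence the factor 3.\<close>
    proof (rule tendsto_L1_dominated[where w = "\<lambda>x. 3 * \<bar>f x\<bar>"])
      show "\<bar>f x - s i x\<bar> \<le> 3 * \<bar>f x\<bar>" for i x using lim(3)[of x i] by (simp add: abs_if split: if_splits)
    qed (use lim in auto)
  qed
qed

lemma compact_support_uniformly_continuous: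
  fixes g :: "'a::euclidean_space \<Rightarrow> real"
  assumes g: "continuous_on UNIV g" "\<And>x. x \<notin> cball 0 R \<Longrightarrow> g x = 0" and e: "e > 0"
  obtains d where "d > 0" "d \<le> 1" "\<And>x z. norm (z - x) \<le> d \<Longrightarrow> \<bar>g z - g x\<bar> \<le> e"
proof -
  have "uniformly_continuous_on (cball 0 (R + 1)) g"
    by (intro compact_uniformly_continuous continuous_on_subset[OF g(1)]) auto
  then obtain d where d: "d > 0"
    "\<And>x z. x \<in> cball 0 (R + 1) \<Longrightarrow> z \<in> cball 0 (R + 1) \<Longrightarrow> dist z x < d \<Longrightarrow> dist (g z) (g x) < e"
    using e unfolding uniformly_continuous_on_def by metis
  show thesis
  \<comment> \<open>A step of at most 1 leaves two cases: both points in the larger ball, where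
    uniform continuity applies, or both outside the support.\<close>
  proof (rule that[of "min 1 (d / 2)"])
    fix x z :: 'a assume n: "norm (z - x) \<le> min 1 (d / 2)"
    show "\<bar>g z - g x\<bar> \<le> e"
    proof (cases "x \<in> cball 0 (R + 1) \<and> z \<in> cball 0 (R + 1)")
      case True
      moreover have "dist z x < d" using n d(1) by (simp add: dist_norm)
      ultimately show ?thesis using d(2)[of x z] by (simp add: dist_real_def)
    next
      case False
      then have "x \<notin> cball 0 R" "z \<notin> cball 0 R"
        using n norm_triangle_ineq2[of z x] norm_triangle_ineq3[of z x] by auto
      then show ?thesis using g(2) e by simp
    qed
  qed (use d in auto)
qed

section \<open>Approximation of BV functions\<close>

text \<open>Shrinking the width by a factor \<open>t \<le> 1\<close> keeps every requirement, while
  \<open>H\<close>, and with it \<open>schur_const\<close>, stays the same. One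
  \<open>\<delta>\<close> thus yields a family of mollifiers with common constants.\<close>

lemma variable_mollifier_scaled:
  assumes "open \<Omega>" "\<And>k. Ck_on k UNIV \<eta>" "\<And>x. \<eta> x \<ge> 0" "\<And>x. norm x \<ge> 1 \<Longrightarrow> \<eta> x = 0"
    "(LINT x|lborel. \<eta> x) = 1" "\<And>x. \<eta> x \<le> H" "\<And>x. norm (gradient \<eta> x) \<le> H"
    and \<delta>: "\<And>x. \<delta> differentiable (at x)" "continuous_on UNIV (gradient \<delta>)"
    "\<And>x. norm (gradient \<delta> x) \<le> 1 / 2" "\<And>x. x \<in> \<Omega> \<Longrightarrow> \<delta> x > 0" "\<And>x. \<delta> x \<le> 1"
    "\<And>x. x \<in> \<Omega> \<Longrightarrow> cball x (\<delta> x) \<subseteq> \<Omega>"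
    and t: "0 < t" "t \<le> 1"
  shows "variable_mollifier \<Omega> \<eta> H (\<lambda>x. t * \<delta> x) t"
proof -
  have D: "((\<lambda>x. t * \<delta> x) has_derivative (\<bullet>) (t *\<^sub>R gradient \<delta> x)) (at x)" for x
    by (rule has_derivative_eq_rhs[OF has_derivative_mult_right[OF has_derivative_gradient[OF \<delta>(1)]]])
      (simp add: fun_eq_iff)
  then have g: "gradient (\<lambda>x. t * \<delta> x) = (\<lambda>x. t *\<^sub>R gradient \<delta> x)" by (auto intro: gradient_eqI)
  show ?thesis
  proof
    show "(\<lambda>x. t * \<delta> x) differentiable (at x)" for x using D by (auto simp: differentiable_def)
    show "continuous_on UNIV (gradient (\<lambda>x. t * \<delta> x))" unfolding g by (intro continuous_intros \<delta>)
    show "norm (gradient (\<lambda>x. t * \<delta> x) x) \<le> 1 / 2" for x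
      using mult_mono[of t 1 "norm (gradient \<delta> x)" "1 / 2"] \<delta>(3)[of x] t by (simp add: g)
    show "0 < t * \<delta> x" if "x \<in> \<Omega>" for x using \<delta>(4)[OF that] t by simp
    show "t * \<delta> x \<le> t" for x using mult_left_mono[OF \<delta>(5)[of x], of t] t by simp
    show "cball x (t * \<delta> x) \<subseteq> \<Omega>" if "x \<in> \<Omega>" for x
    proof -
      have "t * \<delta> x \<le> \<delta> x" using \<delta>(4)[OF that] t by (simp add: mult_left_le_one_le)
      then show ?thesis using \<delta>(6)[OF that] subset_cball by blast
    qed
  qed (use assms in auto)
qed

text \<open>Write \<open>u = f + g\<close> with \<open>f\<close> small in L1: the mollified
  \<open>f\<close> costs \<open>schur_const\<close> times its norm, \<open>f\<close> itself costs
  its norm once, and \<open>g\<close> contributes its oscillation times the volume of a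
  ball.\<close>

lemma (in variable_mollifier) mollify_diff_le:
  assumes u: "integrable lborel u" and g: "continuous_on UNIV g" "\<And>z. z \<notin> cball 0 R \<Longrightarrow> g z = 0"
    and e: "\<And>x z. norm (z - x) \<le> \<tau> \<Longrightarrow> \<bar>g z - g x\<bar> \<le> e" "e \<ge> 0" and \<tau>: "\<tau> \<le> 1"
  shows "(\<integral>\<^sup>+x\<in>\<Omega>. ennreal \<bar>mollify u x - u x\<bar> \<partial>lborel) \<le>
    ennreal ((schur_const + 1) * (LINT z|lborel. \<bar>u z - g z\<bar>) + e * measure lborel (cball (0::'a) (R + 1)))"
proof -
  have gi: "integrable lborel g" by (rule compact_support_integrable[OF g])
  define f where "f z = u z - g z" for z
  have fi: "integrable lborel f" unfolding f_def using u gi by auto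
  have [measurable]: "u \<in> borel_measurable borel" "g \<in> borel_measurable borel" "f \<in> borel_measurable borel"
    using u gi fi by auto
  have [measurable]: "\<Omega> \<in> sets borel" using open_\<Omega> by simp
  have "continuous_on \<Omega> (mollify f)"
    using mollify_C1(1)[OF fi] Ck_on_Suc_imp[of 0 \<Omega> "mollify f"] by (simp del: Ck_on.simps(2))
  then have "(\<lambda>x. indicator \<Omega> x *\<^sub>R mollify f x) \<in> borel_measurable borel"
    by (intro borel_measurable_continuous_on_indicator) auto
  then have m: "(\<lambda>x. ennreal \<bar>indicator \<Omega> x *\<^sub>R mollify f x\<bar>) \<in> borel_measurable lborel" by measurable
  have nf: "(\<integral>\<^sup>+z. ennreal \<bar>f z\<bar> \<partial>lborel) = ennreal (LINT z|lborel. \<bar>f z\<bar>)"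
    using fi by (intro nn_integral_eq_integral) auto
  have "(\<integral>\<^sup>+x\<in>\<Omega>. ennreal \<bar>mollify u x - u x\<bar> \<partial>lborel) \<le>
      (\<integral>\<^sup>+x. ennreal \<bar>indicator \<Omega> x *\<^sub>R mollify f x\<bar> + (ennreal \<bar>f x\<bar> + ennreal e * indicator (cball 0 (R + 1)) x) \<partial>lborel)"
  proof (rule nn_integral_mono)
    fix x
    show "ennreal \<bar>mollify u x - u x\<bar> * indicator \<Omega> x \<le>
      ennreal \<bar>indicator \<Omega> x *\<^sub>R mollify f x\<bar> + (ennreal \<bar>f x\<bar> + ennreal e * indicator (cball 0 (R + 1)) x)"
    proof (cases "x \<in> \<Omega>")
      case True
      have k: "integrable lborel (\<lambda>z. u z * kernel \<eta> x z)" "integrable lborel (\<lambda>z. g z * kernel \<eta> x z)"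
        using kernel_integral.k_int[OF mollify_kernel_integral[OF u] True]
          kernel_integral.k_int[OF mollify_kernel_integral[OF gi] True] .
      have "mollify f x = mollify u x - mollify g x"
        using k by (simp add: mollify_def f_def left_diff_distrib)
      moreover have "\<bar>mollify g x - g x\<bar> \<le> e * indicator (cball 0 (R + 1)) x"
        by (rule mollify_close[OF gi g(2) e(1) \<tau> True])
      ultimately have "\<bar>mollify u x - u x\<bar> \<le> \<bar>mollify f x\<bar> + (\<bar>f x\<bar> + e * indicator (cball 0 (R + 1)) x)"
        unfolding f_def by linarith
      then have "ennreal \<bar>mollify u x - u x\<bar> \<le> ennreal (\<bar>mollify f x\<bar> + (\<bar>f x\<bar> + e * indicator (cball 0 (R + 1)) x))"
        by (rule ennreal_leI)
      also have "\<dots> = ennreal \<bar>mollify f x\<bar> + (ennreal \<bar>f x\<bar> + ennreal e * indicator (cball 0 (R + 1)) x)"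
        using e(2) by (auto split: split_indicator)
      finally show ?thesis using True by simp
    qed simp
  qed
  also have "\<dots> = (\<integral>\<^sup>+x. ennreal \<bar>indicator \<Omega> x *\<^sub>R mollify f x\<bar> \<partial>lborel) +
      ((\<integral>\<^sup>+x. ennreal \<bar>f x\<bar> \<partial>lborel) + ennreal e * emeasure lborel (cball (0::'a) (R + 1)))"
  proof -
    have m2: "(\<lambda>x. ennreal \<bar>f x\<bar>) \<in> borel_measurable lborel"
      "(\<lambda>x. ennreal e * indicator (cball (0::'a) (R + 1)) x) \<in> borel_measurable lborel"
      by simp (intro borel_measurable_times_ennreal borel_measurable_indicator, auto)
    show ?thesis
      using nn_integral_add[OF m borel_measurable_add[OF m2]] nn_integral_add[OF m2]
      by (simp add: nn_integral_cmult_indicator)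
  qed
  also have "(\<integral>\<^sup>+x. ennreal \<bar>indicator \<Omega> x *\<^sub>R mollify f x\<bar> \<partial>lborel) = (\<integral>\<^sup>+x\<in>\<Omega>. ennreal \<bar>mollify f x\<bar> \<partial>lborel)"
    by (intro nn_integral_cong) (auto split: split_indicator)
  also have "\<dots> \<le> ennreal schur_const * (\<integral>\<^sup>+z. ennreal \<bar>f z\<bar> \<partial>lborel)"
    by (rule mollify_nn_integral_le[OF fi])
  also have "emeasure lborel (cball (0::'a) (R + 1)) = ennreal (measure lborel (cball (0::'a) (R + 1)))"
    using emeasure_lborel_cball_finite[of "0::'a" "R + 1"] by (intro emeasure_eq_ennreal_measure) auto
  also have "ennreal schur_const * (\<integral>\<^sup>+z. ennreal \<bar>f z\<bar> \<partial>lborel) + ((\<integral>\<^sup>+z. ennreal \<bar>f z\<bar> \<partial>lborel) +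
        ennreal e * ennreal (measure lborel (cball (0::'a) (R + 1)))) =
      ennreal (schur_const * (LINT z|lborel. \<bar>f z\<bar>) + ((LINT z|lborel. \<bar>f z\<bar>) + e * measure lborel (cball (0::'a) (R + 1))))"
    unfolding nf using schur_const_nonneg e(2) by (simp add: ennreal_mult ennreal_plus integral_nonneg_AE)
  finally show ?thesis by (simp add: f_def distrib_right add.assoc add_left_mono)
qed

text \<open>The order of quantifiers is essential: \<open>C\<close> depends on Du, the dimension and
  the mollifier, but not on \<open>e\<close>. Exactly this uniformity is needed for weak*
  convergence.\<close>

proposition BV_approximation:
  fixes u :: "'a::euclidean_space \<Rightarrow> real"
  assumes \<Omega>: "open \<Omega>" and u: "u \<in> BV \<Omega>"
  shows "\<exists>C. \<forall>e>0. \<exists>v. Ck_on 1 \<Omega> v \<and> set_integrable lborel \<Omega> v \<and>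
    set_integrable lborel \<Omega> (gradient v) \<and> (LINT x:\<Omega>|lborel. norm (gradient v x)) \<le> C \<and>
    (LINT x:\<Omega>|lebesgue. \<bar>v x - u x\<bar>) \<le> e"
proof -
  obtain \<mu> where \<mu>: "has_gradient_measure \<Omega> u \<mu>" using u by (auto simp: BV_def)
  have ui: "integrable lebesgue (\<lambda>x. indicator \<Omega> x *\<^sub>R u x)"
    using u by (simp add: BV_def set_integrable_def)
  \<comment> \<open>\<open>u\<close> is merely Lebesgue measurable, whereas the kernel estimates use
    \<open>lborel\<close>. So its zero extension is replaced by a Borel function equal to it almost
    everywhere.\<close>
  obtain u' where u'[measurable]: "u' \<in> borel_measurable lborel" and AE': "AE x in lborel. indicator \<Omega> x *\<^sub>R u x = u' x"
    using completion_ex_borel_measurable_real[OF borel_measurable_integrable[OF ui]] by blast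
  have AE: "AE x in lebesgue. indicator \<Omega> x *\<^sub>R u x = u' x" using AE' by (rule AE_completion)
  have u'm: "u' \<in> borel_measurable lebesgue" using u' by (rule measurable_completion)
  have "integrable lebesgue u'"
    using ui integrable_cong_AE[OF borel_measurable_integrable[OF ui] u'm AE] by blast
  then have u'i: "integrable lborel u'" using u' by (subst (asm) integrable_completion) auto
  have \<nu>: "signed_measure_on \<Omega> (\<lambda>E. \<mu> E \<bullet> b)" for b
    using \<mu> by (auto simp: has_gradient_measure_def intro: signed_measure_on_inner)
  have parts: "(LINT z|lborel. u' z * (gradient \<psi> z \<bullet> b)) = - signed_integral \<Omega> (\<lambda>E. \<mu> E \<bullet> b) \<psi>"
    if \<psi>: "\<psi> \<in> test_functions \<Omega>" and b: "b \<in> Basis" for \<psi> b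
  proof -
    interpret \<psi>: C1_compact \<psi> "closure {x. \<psi> x \<noteq> 0}" by (rule test_function_C1_compact[OF \<psi>])
    obtain B where B: "\<And>z. norm (gradient \<psi> z) \<le> B" using \<psi>.bounded_gradient by blast
    have gm: "gradient \<psi> \<in> borel_measurable lborel" using borel_measurable_continuous_onI[OF \<psi>.cont_grad] by simp
    then have gm': "gradient \<psi> \<in> borel_measurable lebesgue" by (rule measurable_completion)
    have i: "integrable lborel (\<lambda>z. u' z *\<^sub>R gradient \<psi> z)"
      by (rule integrable_mult_bounded[OF u'i gm B])
    have "(LINT x:\<Omega>|lebesgue. u x *\<^sub>R gradient \<psi> x) = (LINT x|lebesgue. (indicator \<Omega> x *\<^sub>R u x) *\<^sub>R gradient \<psi> x)"
      by (simp add: set_lebesgue_integral_def)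
    also have "\<dots> = (LINT x|lebesgue. u' x *\<^sub>R gradient \<psi> x)"
      by (rule integral_cong_AE[OF borel_measurable_scaleR[OF borel_measurable_integrable[OF ui] gm']
            borel_measurable_scaleR[OF u'm gm']]) (use AE in auto)
    also have "\<dots> = (LINT x|lborel. u' x *\<^sub>R gradient \<psi> x)"
      using i by (intro integral_completion) auto
    finally have "(LINT x|lborel. u' x *\<^sub>R gradient \<psi> x) = - vector_integral \<Omega> \<mu> \<psi>"
      using \<mu> \<psi> by (simp add: has_gradient_measure_def)
    then have "(LINT x|lborel. u' x *\<^sub>R gradient \<psi> x) \<bullet> b = - signed_integral \<Omega> (\<lambda>E. \<mu> E \<bullet> b) \<psi>"
      by (simp add: vector_integral_inner[OF b])
    then show ?thesis
      using integral_inner_left[of b lborel "\<lambda>z. u' z *\<^sub>R gradient \<psi> z"] i by simp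
  qed
  obtain \<eta> :: "'a \<Rightarrow> real" and H where \<eta>: "\<And>k. Ck_on k UNIV \<eta>" "\<And>x. \<eta> x \<ge> 0" "\<And>x. norm x \<ge> 1 \<Longrightarrow> \<eta> x = 0"
    "(LINT x|lborel. \<eta> x) = 1" "\<And>x. \<eta> x \<le> H" "\<And>x. norm (gradient \<eta> x) \<le> H"
    using mollifier_exists by metis
  obtain \<delta> :: "'a \<Rightarrow> real" where \<delta>: "\<And>x. \<delta> differentiable (at x)" "continuous_on UNIV (gradient \<delta>)"
    "\<And>x. norm (gradient \<delta> x) \<le> 1 / 2" "\<And>x. x \<in> \<Omega> \<Longrightarrow> \<delta> x > 0" "\<And>x. \<delta> x \<le> 1"
    "\<And>x. x \<in> \<Omega> \<Longrightarrow> cball x (\<delta> x) \<subseteq> \<Omega>"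
    using smooth_scale_exists[OF \<Omega>] by metis
  \<comment> \<open>This is \<open>schur_const\<close> written out: the constant must be fixed
    before \<open>e\<close>, hence before the scale \<open>t\<close> is chosen and the locale
    interpreted.\<close>
  define c where "c = 6 ^ DIM('a) * H * measure lborel (ball (0 :: 'a) 1)"
  define C where "C = (1 + DIM('a)) * c *
    (\<Sum>b\<in>Basis. measure (positive_variation \<Omega> (\<lambda>E. \<mu> E \<bullet> b)) \<Omega> + measure (positive_variation \<Omega> (\<lambda>E. - (\<mu> E \<bullet> b))) \<Omega>)"
  have H0: "H \<ge> 0" using \<eta>(2,5) order_trans by blast
  then have c0: "c \<ge> 0" by (simp add: c_def)
  have C0: "C \<ge> 0" unfolding C_def using c0 by (intro mult_nonneg_nonneg sum_nonneg) auto
  show ?thesis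
  proof (intro exI[of _ C] allI impI)
    fix e :: real assume e: "e > 0"
    \<comment> \<open>\<open>e1\<close> allots half of \<open>e\<close> to the distance between
      \<open>u'\<close> and \<open>g\<close>, enlarged by the factor \<open>c + 1\<close>;
      \<open>e2\<close> below allots the other half to the oscillation of \<open>g\<close> over a
      ball of volume \<open>r\<close>.\<close>
    define e1 where "e1 = e / (2 * (c + 1))"
    have e1: "e1 > 0" using e c0 by (simp add: e1_def)
    obtain g R where g: "continuous_on UNIV g" "\<And>x. x \<notin> cball 0 R \<Longrightarrow> g x = 0" "(LINT x|lborel. \<bar>u' x - g x\<bar>) \<le> e1"
      using integrable_L1_approx[OF u'i] e1 unfolding L1_approx_def by metis
    define r where "r = measure lborel (cball (0::'a) (R + 1))"
    have r0: "r \<ge> 0" by (simp add: r_def)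
    define e2 where "e2 = e / (2 * (r + 1))"
    have e2: "e2 > 0" using e r0 by (simp add: e2_def)
    obtain t where t: "t > 0" "t \<le> 1" "\<And>x z. norm (z - x) \<le> t \<Longrightarrow> \<bar>g z - g x\<bar> \<le> e2"
      using compact_support_uniformly_continuous[OF g(1,2) e2] by metis
    interpret M: variable_mollifier \<Omega> \<eta> H "\<lambda>x. t * \<delta> x" t
      by (rule variable_mollifier_scaled[OF \<Omega> \<eta> \<delta> t(1,2)])
    have sc: "M.schur_const = c" by (simp add: M.schur_const_def c_def)
    define v where "v = M.mollify u'"
    have v: "Ck_on 1 \<Omega> v" unfolding v_def by (rule M.mollify_C1(1)[OF u'i])
    have gv: "continuous_on \<Omega> (gradient v)" and dv: "\<And>x. x \<in> \<Omega> \<Longrightarrow> v differentiable (at x)"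
      using v by (auto simp only: Ck_on_1_iff)
    have cv: "continuous_on \<Omega> v"
      by (simp add: continuous_at_imp_continuous_on dv differentiable_imp_continuous_within)
    have G: "(\<integral>\<^sup>+x\<in>\<Omega>. ennreal (norm (gradient v x)) \<partial>lborel) \<le> ennreal C"
      using M.mollify_gradient_nn_integral_le[OF u'i \<nu> parts] by (simp only: C_def sc v_def)
    have gvi: "set_integrable lborel \<Omega> (gradient v)" by (rule set_integrable_continuousI[OF \<Omega> gv G])
    have "(\<integral>\<^sup>+x\<in>\<Omega>. ennreal (norm (v x)) \<partial>lborel) \<le> ennreal c * (\<integral>\<^sup>+z. ennreal \<bar>u' z\<bar> \<partial>lborel)"
      using M.mollify_nn_integral_le[OF u'i] by (simp add: sc v_def)
    also have "\<dots> = ennreal c * ennreal (LINT z|lborel. \<bar>u' z\<bar>)"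
      using u'i by (subst nn_integral_eq_integral) auto
    also have "\<dots> = ennreal (c * (LINT z|lborel. \<bar>u' z\<bar>))"
      using c0 by (simp add: ennreal_mult integral_nonneg_AE)
    finally have vi: "set_integrable lborel \<Omega> v" by (rule set_integrable_continuousI[OF \<Omega> cv])
    have vu: "set_integrable lborel \<Omega> (\<lambda>x. \<bar>v x - u' x\<bar>)"
    proof -
      have "set_integrable lborel \<Omega> u'"
        unfolding set_integrable_def using integrable_mult_indicator[of \<Omega> lborel u'] \<Omega> u'i by simp
      then show ?thesis using vi by (intro set_integrable_abs set_integral_diff)
    qed
    have "(\<integral>\<^sup>+x\<in>\<Omega>. ennreal \<bar>v x - u' x\<bar> \<partial>lborel) \<le> ennreal ((c + 1) * (LINT z|lborel. \<bar>u' z - g z\<bar>) + e2 * r)"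
      using M.mollify_diff_le[OF u'i g(1,2) t(3) less_imp_le[OF e2] t(2)] by (simp add: sc v_def r_def)
    also have "\<dots> \<le> ennreal e"
    proof (rule ennreal_leI)
      have "(c + 1) * (LINT z|lborel. \<bar>u' z - g z\<bar>) \<le> (c + 1) * e1" using g(3) c0 by (intro mult_left_mono) auto
      also have "\<dots> = e / 2" using c0 by (simp add: e1_def field_simps)
      finally have 1: "(c + 1) * (LINT z|lborel. \<bar>u' z - g z\<bar>) \<le> e / 2" .
      have "e2 * r \<le> e2 * (r + 1)" using e2 by simp
      also have "\<dots> = e / 2" using r0 by (simp add: e2_def field_simps)
      finally show "(c + 1) * (LINT z|lborel. \<bar>u' z - g z\<bar>) + e2 * r \<le> e" using 1 by simp
    qed
    finally have "ennreal (LINT x:\<Omega>|lborel. \<bar>v x - u' x\<bar>) \<le> ennreal e"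
      using set_nn_integral_eq_set_integral[OF vu] by simp
    then have close: "(LINT x:\<Omega>|lborel. \<bar>v x - u' x\<bar>) \<le> e" using e by (subst (asm) ennreal_le_iff) auto
    have "(LINT x:\<Omega>|lebesgue. \<bar>v x - u x\<bar>) = (LINT x|lebesgue. \<bar>indicator \<Omega> x *\<^sub>R v x - indicator \<Omega> x *\<^sub>R u x\<bar>)"
      unfolding set_lebesgue_integral_def
      by (intro Bochner_Integration.integral_cong refl) (simp split: split_indicator)
    also have "\<dots> = (LINT x|lebesgue. indicator \<Omega> x *\<^sub>R \<bar>v x - u' x\<bar>)"
    proof (rule integral_cong_AE)
      have "(\<lambda>x. indicator \<Omega> x *\<^sub>R v x) \<in> borel_measurable lebesgue"
        using vi by (auto simp: set_integrable_def intro: measurable_completion)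
      then show "(\<lambda>x. \<bar>indicator \<Omega> x *\<^sub>R v x - indicator \<Omega> x *\<^sub>R u x\<bar>) \<in> borel_measurable lebesgue"
        using ui by (intro borel_measurable_abs borel_measurable_diff) auto
      show "(\<lambda>x. indicator \<Omega> x *\<^sub>R \<bar>v x - u' x\<bar>) \<in> borel_measurable lebesgue"
        using vu by (auto simp: set_integrable_def intro: measurable_completion)
      show "AE x in lebesgue. \<bar>indicator \<Omega> x *\<^sub>R v x - indicator \<Omega> x *\<^sub>R u x\<bar> = indicator \<Omega> x *\<^sub>R \<bar>v x - u' x\<bar>"
        using AE by eventually_elim (auto split: split_indicator)
    qed
    also have "\<dots> = (LINT x:\<Omega>|lborel. \<bar>v x - u' x\<bar>)"
      unfolding set_lebesgue_integral_def using vu by (intro integral_completion) (auto simp: set_integrable_def)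
    finally have "(LINT x:\<Omega>|lebesgue. \<bar>v x - u x\<bar>) \<le> e" using close by simp
    moreover have "(LINT x:\<Omega>|lborel. norm (gradient v x)) \<le> C"
    proof -
      have "ennreal (LINT x:\<Omega>|lborel. norm (gradient v x)) \<le> ennreal C"
        using G set_nn_integral_eq_set_integral[OF set_integrable_norm[OF gvi]] by simp
      then show ?thesis using C0 by (subst (asm) ennreal_le_iff) auto
    qed
    ultimately show "\<exists>v. Ck_on 1 \<Omega> v \<and> set_integrable lborel \<Omega> v \<and>
        set_integrable lborel \<Omega> (gradient v) \<and> (LINT x:\<Omega>|lborel. norm (gradient v x)) \<le> C \<and>
        (LINT x:\<Omega>|lebesgue. \<bar>v x - u x\<bar>) \<le> e"
      using v vi gvi by blast
  qed
qed

theorem theorem4p1: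
  fixes \<phi> :: "real \<Rightarrow> real" and \<Omega> :: "(real ^ 'm) set" and u :: "real ^ 'm \<Rightarrow> real"
  assumes nonneg: "\<And>t. t \<ge> 0 \<Longrightarrow> \<phi> t \<ge> 0"
    and zero: "\<phi> 0 = 0"
    and increasing: "mono_on {0..} \<phi>"
    and subadditive: "\<And>s t. s \<ge> 0 \<Longrightarrow> t \<ge> 0 \<Longrightarrow> \<phi> (s + t) \<le> \<phi> s + \<phi> t"
    and continuous: "continuous_on {0..} \<phi>"
    and sublinear: "((\<lambda>t. \<phi> t / t) \<longlongrightarrow> 0) at_top"
    and open_\<Omega>: "open \<Omega>"
    and boundary: "lipschitz_boundary \<Omega>"
    and u_BV: "u \<in> BV \<Omega>"
  shows "TV_c \<phi> \<Omega> u = 0"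
proof -
  obtain C where C: "\<forall>e>0. \<exists>v. Ck_on 1 \<Omega> v \<and> set_integrable lborel \<Omega> v \<and>
    set_integrable lborel \<Omega> (gradient v) \<and> (LINT x:\<Omega>|lborel. norm (gradient v x)) \<le> C \<and>
    (LINT x:\<Omega>|lebesgue. \<bar>v x - u x\<bar>) \<le> e"
    using BV_approximation[OF open_\<Omega> u_BV] ..
  have ui: "set_integrable lebesgue \<Omega> u" using u_BV by (simp add: BV_def)
  \<comment> \<open>Mollify, then apply a staircase: each stage costs \<open>e\<close> in L1, and
    the gradient bound \<open>16 * C + 1\<close> is the same for all \<open>e\<close>, so the
    diagonal sequence meets the requirements of \<open>weak_star_BV_C1\<close>.\<close>
  have "\<exists>w. Ck_on 1 \<Omega> w \<and> set_integrable lborel \<Omega> w \<and> set_integrable lborel \<Omega> (gradient w) \<and>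
      (LINT x:\<Omega>|lborel. norm (gradient w x)) \<le> 16 * C + 1 \<and>
      (LINT x:\<Omega>|lebesgue. \<bar>w x - u x\<bar>) \<le> 2 * e \<and> TV_smooth \<phi> \<Omega> w \<le> ennreal e" if e: "e > 0" for e
  proof -
    obtain v where v: "Ck_on 1 \<Omega> v" "set_integrable lborel \<Omega> v" "set_integrable lborel \<Omega> (gradient v)"
      "(LINT x:\<Omega>|lborel. norm (gradient v x)) \<le> C" "(LINT x:\<Omega>|lebesgue. \<bar>v x - u x\<bar>) \<le> e"
      using C e by blast
    obtain w where w: "Ck_on 1 \<Omega> w" "set_integrable lborel \<Omega> w" "set_integrable lborel \<Omega> (gradient w)"
      "(LINT x:\<Omega>|lborel. \<bar>w x - v x\<bar>) \<le> e"
      "(LINT x:\<Omega>|lborel. norm (gradient w x)) \<le> 16 * (LINT x:\<Omega>|lborel. norm (gradient v x)) + 1"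
      "TV_smooth \<phi> \<Omega> w \<le> ennreal e"
      by (rule staircase_approximation[OF nonneg zero increasing continuous sublinear open_\<Omega> v(1-3) e])
    have leb: "set_integrable lebesgue \<Omega> f" if "set_integrable lborel \<Omega> f" for f :: "real ^ 'm \<Rightarrow> real"
      using that unfolding set_integrable_def by (intro integrable_completion[THEN iffD2]) auto
    have wv: "set_integrable lborel \<Omega> (\<lambda>x. \<bar>w x - v x\<bar>)"
      using w(2) v(2) by (intro set_integrable_abs set_integral_diff)
    have "(LINT x:\<Omega>|lebesgue. \<bar>w x - u x\<bar>) \<le> (LINT x:\<Omega>|lebesgue. \<bar>w x - v x\<bar> + \<bar>v x - u x\<bar>)"
      using leb[OF w(2)] leb[OF v(2)] ui
      by (intro set_integral_mono set_integral_add set_integrable_abs set_integral_diff) auto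
    also have "\<dots> = (LINT x:\<Omega>|lebesgue. \<bar>w x - v x\<bar>) + (LINT x:\<Omega>|lebesgue. \<bar>v x - u x\<bar>)"
      using leb[OF w(2)] leb[OF v(2)] ui by (intro set_integral_add set_integrable_abs set_integral_diff)
    also have "(LINT x:\<Omega>|lebesgue. \<bar>w x - v x\<bar>) = (LINT x:\<Omega>|lborel. \<bar>w x - v x\<bar>)"
      unfolding set_lebesgue_integral_def using wv by (intro integral_completion) (auto simp: set_integrable_def)
    finally have "(LINT x:\<Omega>|lebesgue. \<bar>w x - u x\<bar>) \<le> 2 * e" using w(4) v(5) by linarith
    moreover have "(LINT x:\<Omega>|lborel. norm (gradient w x)) \<le> 16 * C + 1" using w(5) v(4) by linarith
    ultimately show ?thesis using w by blast
  qed
  then have "\<forall>i::nat. \<exists>w. Ck_on 1 \<Omega> w \<and> set_integrable lborel \<Omega> w \<and> set_integrable lborel \<Omega> (gradient w) \<and>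
      (LINT x:\<Omega>|lborel. norm (gradient w x)) \<le> 16 * C + 1 \<and>
      (LINT x:\<Omega>|lebesgue. \<bar>w x - u x\<bar>) \<le> 2 * inverse (real (Suc i)) \<and> TV_smooth \<phi> \<Omega> w \<le> ennreal (inverse (real (Suc i)))"
    by simp
  from choice[OF this] obtain W where
    "\<forall>i. Ck_on 1 \<Omega> (W i) \<and> set_integrable lborel \<Omega> (W i) \<and> set_integrable lborel \<Omega> (gradient (W i)) \<and>
      (LINT x:\<Omega>|lborel. norm (gradient (W i) x)) \<le> 16 * C + 1 \<and>
      (LINT x:\<Omega>|lebesgue. \<bar>W i x - u x\<bar>) \<le> 2 * inverse (real (Suc i)) \<and>
      TV_smooth \<phi> \<Omega> (W i) \<le> ennreal (inverse (real (Suc i)))" ..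
  then have W: "\<And>i. Ck_on 1 \<Omega> (W i)" "\<And>i. set_integrable lborel \<Omega> (W i)"
    "\<And>i. set_integrable lborel \<Omega> (gradient (W i))"
    "\<And>i. (LINT x:\<Omega>|lborel. norm (gradient (W i) x)) \<le> 16 * C + 1"
    "\<And>i. (LINT x:\<Omega>|lebesgue. \<bar>W i x - u x\<bar>) \<le> 2 * inverse (real (Suc i))"
    "\<And>i. TV_smooth \<phi> \<Omega> (W i) \<le> ennreal (inverse (real (Suc i)))"
    by blast+
  have "weak_star_BV \<Omega> W u"
  proof (rule weak_star_BV_C1[OF open_\<Omega> u_BV W(1-4)])
    show "(\<lambda>i. LINT x:\<Omega>|lebesgue. \<bar>W i x - u x\<bar>) \<longlonglongrightarrow> 0"
    proof (rule tendsto_sandwich[where f = "\<lambda>_. 0"])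
      show "(\<lambda>i. 2 * inverse (real (Suc i))) \<longlonglongrightarrow> 0"
        by (rule tendsto_mult_right_zero[OF LIMSEQ_inverse_real_of_nat])
      show "\<forall>\<^sub>F i in sequentially. (LINT x:\<Omega>|lebesgue. \<bar>W i x - u x\<bar>) \<le> 2 * inverse (real (Suc i))"
        by (intro always_eventually allI W(5))
      show "\<forall>\<^sub>F i in sequentially. 0 \<le> (LINT x:\<Omega>|lebesgue. \<bar>W i x - u x\<bar>)"
        unfolding set_lebesgue_integral_def by (intro always_eventually allI integral_nonneg_AE AE_I2) simp
    qed (rule tendsto_const)
  qed
  then have "TV_c \<phi> \<Omega> u \<le> liminf (\<lambda>i. TV_smooth \<phi> \<Omega> (W i))"
    unfolding TV_c_def using W(1) by (intro INF_lower) auto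
  also have "\<dots> \<le> liminf (\<lambda>i. ennreal (inverse (real (Suc i))))"
    using W(6) by (intro Liminf_mono always_eventually) auto
  also have "\<dots> = 0"
  proof (rule lim_imp_Liminf)
    show "(\<lambda>i. ennreal (inverse (real (Suc i)))) \<longlonglongrightarrow> 0"
      using tendsto_ennrealI[OF LIMSEQ_inverse_real_of_nat] by simp
  qed simp
  finally show ?thesis by simp
qed

end
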